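(* Let $g$ be a non-constant real-valued trigonometric polynomial of period $1$. Then there exists $\lambda_0$ such that the following holds for the operators $H_{\lambda,\theta,\omega}$ on $\ell^2(\mathbb{Z})$ given by $[H_{\lambda,\theta,\omega}\psi](n)=\psi(n+1)+\psi(n-1)+\lambda g(n\theta+\omega)\psi(n)$. For every $\lambda>\lambda_0$, every irrational $\theta\in\mathbb{R}$, and every $\omega\in[0,1)$, we have $\alpha_u^-(\lambda,\theta,\omega)=0$. Moreover, if the irrational $\theta$ satisfies $$\lim_{k\to\infty}\frac{\log q_{k+1}}{q_k}=0,$$ where $p_k/q_k$ are the continued fraction convergents of $\theta$, then $\alpha_u^+(\lambda,\theta,\omega)=0$ for every $\lambda>\lambda_0$ and $\omega\in[0,1)$.
   Context: The convergents $p_k/q_k=a_0+\cfrac{1}{a_1+\cfrac{1}{\cdots+\cfrac1{a_k}}}$ (in lowest terms, $q_k\ge1$) are the truncations of the continued fraction expansion of $\theta$. Transport exponents of $H=H_{\lambda,\theta,\omega}$: let $(\delta_n)$ be the canonical basis of $\ell^2(\mathbb{Z})$. For $T>0$ let $a(n,T)=\frac{2}{T}\int_0^\infty e^{-2t/T}|\langle e^{-itH}\delta_1,\delta_n\rangle|^2\,dt$, and for real $N$ let $P(N,T)=\sum_{|n|>N}a(n,T)$. For $\alpha\in[0,+\infty]$ let $S^-(\alpha)=-\liminf_{T\to\infty}\frac{\log P(T^\alpha-2,T)}{\log T}$ and $S^+(\alpha)=-\limsup_{T\to\infty}\frac{\log P(T^\alpha-2,T)}{\log T}$ (values in $[0,\infty]$),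 and $\alpha_u^\pm(\lambda,\theta,\omega)=\sup\{\alpha\ge0: S^\pm(\alpha)<\infty\}$. *)

theory Defs
  imports "HOL-Analysis.Analysis"
begin

section \<open>The Hilbert space of square-summable complex sequences over the integers\<close>

typedef ell2 = "{\<psi> :: int \<Rightarrow> complex. (\<lambda>n. (cmod (\<psi> n))\<^sup>2) summable_on UNIV}"
  morphisms coord Abs_ell2
  by (rule exI[of _ "\<lambda>_. 0"]) simp

setup_lifting type_definition_ell2

lemma sq_summable_add:
  fixes \<phi> \<psi> :: "int \<Rightarrow> complex"
  assumes "(\<lambda>n. (cmod (\<phi> n))\<^sup>2) summable_on UNIV" "(\<lambda>n. (cmod (\<psi> n))\<^sup>2) summable_on UNIV"
  shows "(\<lambda>n. (cmod (\<phi> n + \<psi> n))\<^sup>2) summable_on UNIV"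
proof (rule summable_on_comparison_test)
  show "(\<lambda>n. 2 * (cmod (\<phi> n))\<^sup>2 + 2 * (cmod (\<psi> n))\<^sup>2) summable_on UNIV"
    by (intro summable_on_add summable_on_cmult_right assms)
  show "(cmod (\<phi> n + \<psi> n))\<^sup>2 \<le> 2 * (cmod (\<phi> n))\<^sup>2 + 2 * (cmod (\<psi> n))\<^sup>2" for n
  proof -
    have "(cmod (\<phi> n + \<psi> n))\<^sup>2 \<le> (cmod (\<phi> n) + cmod (\<psi> n))\<^sup>2"
      by (intro power_mono norm_triangle_ineq) simp
    also have "\<dots> \<le> 2 * (cmod (\<phi> n))\<^sup>2 + 2 * (cmod (\<psi> n))\<^sup>2"
      using sum_squares_ge_zero[of "cmod (\<phi> n) - cmod (\<psi> n)" 0]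
      by (simp add: power2_eq_square algebra_simps)
    finally show ?thesis .
  qed
qed simp

lemma sq_summable_bounded_mult:
  fixes \<psi> :: "int \<Rightarrow> complex"
  assumes "(\<lambda>n. (cmod (\<psi> n))\<^sup>2) summable_on UNIV" and "\<And>n. cmod (c n) \<le> B"
  shows "(\<lambda>n. (cmod (c n * \<psi> n))\<^sup>2) summable_on UNIV"
proof (rule summable_on_comparison_test)
  show "(\<lambda>n. B\<^sup>2 * (cmod (\<psi> n))\<^sup>2) summable_on UNIV"
    by (intro summable_on_cmult_right assms)
  show "(cmod (c n * \<psi> n))\<^sup>2 \<le> B\<^sup>2 * (cmod (\<psi> n))\<^sup>2" for n
    using assms(2)[of n] by (simp add: norm_mult power_mult_distrib mult_right_mono power_mono)
qed simp

lemma sq_summable_shift: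
  fixes \<psi> :: "int \<Rightarrow> complex"
  assumes "(\<lambda>n. (cmod (\<psi> n))\<^sup>2) summable_on UNIV"
  shows "(\<lambda>n. (cmod (\<psi> (n + j)))\<^sup>2) summable_on UNIV"
proof -
  have "bij_betw (\<lambda>n. n + j) UNIV (UNIV :: int set)"
    by (rule bij_betwI[where g = "\<lambda>n. n - j"]) auto
  from summable_on_reindex_bij_betw[OF this, of "\<lambda>n. (cmod (\<psi> n))\<^sup>2"] assms
  show ?thesis by simp
qed

lift_definition delta :: "int \<Rightarrow> ell2" is "\<lambda>m n. if n = m then 1 else 0"
proof -
  fix m :: int
  show "(\<lambda>n. (cmod (if n = m then 1 else 0))\<^sup>2) summable_on UNIV"
    by (rule finite_nonzero_values_imp_summable_on) (auto intro: finite_subset[of _ "{m}"])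
qed

lift_definition scaleC_ell2 :: "complex \<Rightarrow> ell2 \<Rightarrow> ell2" is "\<lambda>c \<psi> n. c * \<psi> n"
  by (rule sq_summable_bounded_mult) auto

lift_definition cinner :: "ell2 \<Rightarrow> ell2 \<Rightarrow> complex" is
  "\<lambda>\<phi> \<psi>. \<Sum>\<^sub>\<infinity>n. \<phi> n * cnj (\<psi> n)" .

lemma summable_cinner: "(\<lambda>n. coord \<phi> n * cnj (coord \<psi> n)) summable_on UNIV"
proof (rule abs_summable_summable, rule abs_summable_product)
  show "(\<lambda>n. norm (coord \<phi> n * coord \<phi> n)) summable_on UNIV"
    using coord[of \<phi>] by (simp add: norm_mult power2_eq_square)
  show "(\<lambda>n. norm (cnj (coord \<psi> n) * cnj (coord \<psi> n))) summable_on UNIV"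
    using coord[of \<psi>] by (simp add: norm_mult power2_eq_square)
qed

instantiation ell2 :: real_vector
begin

lift_definition zero_ell2 :: ell2 is "\<lambda>_. 0" by simp
lift_definition plus_ell2 :: "ell2 \<Rightarrow> ell2 \<Rightarrow> ell2" is "\<lambda>\<phi> \<psi> n. \<phi> n + \<psi> n"
  by (rule sq_summable_add)
lift_definition uminus_ell2 :: "ell2 \<Rightarrow> ell2" is "\<lambda>\<psi> n. - \<psi> n" by simp
lift_definition minus_ell2 :: "ell2 \<Rightarrow> ell2 \<Rightarrow> ell2" is "\<lambda>\<phi> \<psi> n. \<phi> n - \<psi> n"
  subgoal for \<phi> \<psi> using sq_summable_add[of \<phi> "\<lambda>n. - \<psi> n"] by simp
  done
lift_definition scaleR_ell2 :: "real \<Rightarrow> ell2 \<Rightarrow> ell2" is "\<lambda>r \<psi> n. of_real r * \<psi> n"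
  by (rule sq_summable_bounded_mult) auto

instance
  by standard (transfer; simp add: algebra_simps)+

end

instantiation ell2 :: real_inner
begin

definition inner_ell2 :: "ell2 \<Rightarrow> ell2 \<Rightarrow> real" where
  "inner_ell2 \<phi> \<psi> = Re (cinner \<phi> \<psi>)"
definition norm_ell2 :: "ell2 \<Rightarrow> real" where
  "norm_ell2 \<psi> = sqrt (inner \<psi> \<psi>)"
definition dist_ell2 :: "ell2 \<Rightarrow> ell2 \<Rightarrow> real" where
  "dist_ell2 \<phi> \<psi> = norm (\<phi> - \<psi>)"
definition sgn_ell2 :: "ell2 \<Rightarrow> ell2" where
  "sgn_ell2 \<psi> = \<psi> /\<^sub>R norm \<psi>"
definition uniformity_ell2 :: "(ell2 \<times> ell2) filter" where
  "uniformity_ell2 = (INF e\<in>{0<..}. principal {(\<phi>, \<psi>). dist \<phi> \<psi> < e})"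
definition open_ell2 :: "ell2 set \<Rightarrow> bool" where
  "open_ell2 U \<longleftrightarrow> (\<forall>x\<in>U. eventually (\<lambda>(x', y). x' = x \<longrightarrow> y \<in> U) uniformity)"

lemma inner_ell2_eq: "inner \<phi> \<psi> = (\<Sum>\<^sub>\<infinity>n. Re (coord \<phi> n * cnj (coord \<psi> n)))"
  unfolding inner_ell2_def cinner.rep_eq by (rule infsum_Re[OF summable_cinner, symmetric])

lemma inner_ell2_self: "inner \<psi> \<psi> = (\<Sum>\<^sub>\<infinity>n. (cmod (coord \<psi> n))\<^sup>2)"
  unfolding inner_ell2_eq by (simp add: complex_mult_cnj cmod_power2)

instance
proof
  fix x y z :: ell2 and r :: real
  show "dist x y = norm (x - y)" by (rule dist_ell2_def)
  show "sgn x = x /\<^sub>R norm x" by (rule sgn_ell2_def)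
  show "uniformity = (INF e\<in>{0<..}. principal {(x, y :: ell2). dist x y < e})"
    by (rule uniformity_ell2_def)
  show "open U \<longleftrightarrow> (\<forall>x\<in>U. eventually (\<lambda>(x', y). x' = x \<longrightarrow> y \<in> U) uniformity)"
    for U :: "ell2 set"
    by (rule open_ell2_def)
  show "norm x = sqrt (inner x x)" by (rule norm_ell2_def)
  show "inner x y = inner y x"
    unfolding inner_ell2_eq by (simp add: algebra_simps)
  have su: "(\<lambda>n. Re (coord x n * cnj (coord y n))) summable_on UNIV" for x y
    by (rule summable_on_Re[OF summable_cinner])
  show "inner (x + y) z = inner x z + inner y z"
    unfolding inner_ell2_eq
    by (subst infsum_add[OF su su, symmetric], rule infsum_cong)
      (simp add: plus_ell2.rep_eq algebra_simps)
  show "inner (r *\<^sub>R x) y = r * inner x y"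
    unfolding inner_ell2_eq
    by (subst infsum_cmult_right'[symmetric], rule infsum_cong)
      (simp add: scaleR_ell2.rep_eq algebra_simps)
  show "0 \<le> inner x x"
    unfolding inner_ell2_self by (rule infsum_nonneg) simp
  show "inner x x = 0 \<longleftrightarrow> x = 0"
  proof
    assume "inner x x = 0"
    then have "(cmod (coord x n))\<^sup>2 = 0" for n
      unfolding inner_ell2_self
      by (intro nonneg_infsum_le_0D[where A = UNIV and f = "\<lambda>n. (cmod (coord x n))\<^sup>2"])
        (use coord[of x] in auto)
    then show "x = 0" by transfer auto
  next
    assume "x = 0"
    then show "inner x x = 0" unfolding inner_ell2_self by (simp add: zero_ell2.rep_eq)
  qed
qed

end

lemma norm_ell2_sq: "(norm \<psi>)\<^sup>2 = (\<Sum>\<^sub>\<infinity>n. (cmod (coord \<psi> n))\<^sup>2)"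
  by (metis inner_ell2_self power2_norm_eq_inner)

lemma sum_coord_le_norm: "finite F \<Longrightarrow> (\<Sum>n\<in>F. (cmod (coord \<psi> n))\<^sup>2) \<le> (norm \<psi>)\<^sup>2"
  unfolding norm_ell2_sq by (rule finite_sum_le_infsum) (use coord[of \<psi>] in auto)

lemma coord_le_norm: "cmod (coord \<psi> n) \<le> norm \<psi>"
  using sum_coord_le_norm[of "{n}" \<psi>] by (simp add: power2_le_iff_abs_le)

instance ell2 :: banach
proof
  fix X :: "nat \<Rightarrow> ell2"
  assume X: "Cauchy X"
  have "Cauchy (\<lambda>k. coord (X k) n)" for n
  proof (rule metric_CauchyI)
    fix e :: real assume "e > 0"
    then obtain M where M: "\<And>k l. k \<ge> M \<Longrightarrow> l \<ge> M \<Longrightarrow> dist (X k) (X l) < e"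
      using metric_CauchyD[OF X] by blast
    have "dist (coord (X k) n) (coord (X l) n) \<le> dist (X k) (X l)" for k l
      using coord_le_norm[of "X k - X l" n] by (simp add: dist_norm minus_ell2.rep_eq)
    then show "\<exists>M. \<forall>k\<ge>M. \<forall>l\<ge>M. dist (coord (X k) n) (coord (X l) n) < e"
      using M by (meson le_less_trans)
  qed
  then have "\<exists>l. (\<lambda>k. coord (X k) n) \<longlonglongrightarrow> l" for n
    by (simp add: Cauchy_convergent convergentD)
  then obtain L where L: "\<And>n. (\<lambda>k. coord (X k) n) \<longlonglongrightarrow> L n" by metis
  have tail: "\<exists>M. \<forall>k\<ge>M. \<forall>F. finite F \<longrightarrow> (\<Sum>n\<in>F. (cmod (coord (X k) n - L n))\<^sup>2) \<le> e\<^sup>2"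
    if "e > 0" for e :: real
  proof -
    obtain M where M: "\<And>k l. k \<ge> M \<Longrightarrow> l \<ge> M \<Longrightarrow> dist (X k) (X l) < e"
      using metric_CauchyD[OF X \<open>e > 0\<close>] by blast
    have "(\<Sum>n\<in>F. (cmod (coord (X k) n - L n))\<^sup>2) \<le> e\<^sup>2" if "k \<ge> M" "finite F" for k F
    proof (rule LIMSEQ_le_const2)
      show "(\<lambda>l. \<Sum>n\<in>F. (cmod (coord (X k) n - coord (X l) n))\<^sup>2)
          \<longlonglongrightarrow> (\<Sum>n\<in>F. (cmod (coord (X k) n - L n))\<^sup>2)"
        by (intro tendsto_intros L)
      have "(\<Sum>n\<in>F. (cmod (coord (X k) n - coord (X l) n))\<^sup>2) \<le> e\<^sup>2" if "l \<ge> M" for l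
      proof -
        have "(\<Sum>n\<in>F. (cmod (coord (X k) n - coord (X l) n))\<^sup>2) \<le> (norm (X k - X l))\<^sup>2"
          using sum_coord_le_norm[OF \<open>finite F\<close>, of "X k - X l"] by (simp add: minus_ell2.rep_eq)
        also have "\<dots> \<le> e\<^sup>2"
          using M[OF \<open>k \<ge> M\<close> that] by (intro power_mono) (auto simp: dist_norm)
        finally show ?thesis .
      qed
      then show "\<exists>N. \<forall>l\<ge>N. (\<Sum>n\<in>F. (cmod (coord (X k) n - coord (X l) n))\<^sup>2) \<le> e\<^sup>2" by blast
    qed
    then show ?thesis by blast
  qed
  have diff: "(\<lambda>n. (cmod (coord (X k) n - L n))\<^sup>2) summable_on UNIV"
    if "\<forall>F. finite F \<longrightarrow> (\<Sum>n\<in>F. (cmod (coord (X k) n - L n))\<^sup>2) \<le> e\<^sup>2" for k e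
    by (rule nonneg_bdd_above_summable_on) (use that in \<open>auto intro!: bdd_aboveI[of _ "e\<^sup>2"]\<close>)
  obtain M1 where "\<forall>F. finite F \<longrightarrow> (\<Sum>n\<in>F. (cmod (coord (X M1) n - L n))\<^sup>2) \<le> 1\<^sup>2"
    using tail[of 1] by auto
  from diff[OF this] have "(\<lambda>n. (cmod (L n - coord (X M1) n))\<^sup>2) summable_on UNIV"
    by (simp add: norm_minus_commute)
  from sq_summable_add[OF this, of "coord (X M1)"]
  have "(\<lambda>n. (cmod (L n))\<^sup>2) summable_on UNIV" using coord[of "X M1"] by simp
  then have cL: "coord (Abs_ell2 L) = L" by (simp add: Abs_ell2_inverse)
  have "X \<longlonglongrightarrow> Abs_ell2 L"
  proof (rule metric_LIMSEQ_I)
    fix r :: real assume "r > 0"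
    then obtain M where M: "\<forall>k\<ge>M. \<forall>F. finite F \<longrightarrow>
        (\<Sum>n\<in>F. (cmod (coord (X k) n - L n))\<^sup>2) \<le> (r / 2)\<^sup>2"
      using tail[of "r / 2"] by auto
    have "dist (X k) (Abs_ell2 L) < r" if "k \<ge> M" for k
    proof -
      have "(norm (X k - Abs_ell2 L))\<^sup>2 \<le> (r / 2)\<^sup>2"
        unfolding norm_ell2_sq minus_ell2.rep_eq cL
        by (rule infsum_le_finite_sums) (use M that diff[of k "r / 2"] in auto)
      then have "norm (X k - Abs_ell2 L) \<le> r / 2"
        using \<open>r > 0\<close> by (simp add: power2_le_iff_abs_le)
      then show ?thesis using \<open>r > 0\<close> by (simp add: dist_norm)
    qed
    then show "\<exists>M. \<forall>k\<ge>M. dist (X k) (Abs_ell2 L) < r" by blast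
  qed
  then show "convergent X" by (rule convergentI)
qed


section \<open>Discrete Schroedinger operators and their dynamics\<close>

text \<open>The operator is meaningful for bounded potentials, which covers every potential sampled
  from a trigonometric polynomial; see \<open>coord_schrodinger\<close> and \<open>trig_poly_bounded\<close>.\<close>

definition schrodinger :: "(int \<Rightarrow> real) \<Rightarrow> ell2 \<Rightarrow> ell2" where
  "schrodinger V \<psi> =
     Abs_ell2 (\<lambda>n. coord \<psi> (n + 1) + coord \<psi> (n - 1) + of_real (V n) * coord \<psi> n)"

lemma coord_schrodinger:
  assumes "\<And>n. \<bar>V n\<bar> \<le> B"
  shows "coord (schrodinger V \<psi>) n =
    coord \<psi> (n + 1) + coord \<psi> (n - 1) + of_real (V n) * coord \<psi> n"
proof -
  have s: "(\<lambda>n. (cmod (coord \<psi> n))\<^sup>2) summable_on UNIV" using coord[of \<psi>] by simp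
  have "(\<lambda>n. (cmod (coord \<psi> (n + 1) + coord \<psi> (n + - 1) + of_real (V n) * coord \<psi> n))\<^sup>2)
      summable_on UNIV"
    by (intro sq_summable_add sq_summable_shift sq_summable_bounded_mult[where B = B] s)
      (use assms in auto)
  then show ?thesis unfolding schrodinger_def by (subst Abs_ell2_inverse) auto
qed

text \<open>For a bounded operator \<open>A\<close> this is the operator exponential \<open>exp (- \<i> t A)\<close>, the
  exponential series being evaluated at a vector.\<close>

definition propagator :: "(ell2 \<Rightarrow> ell2) \<Rightarrow> real \<Rightarrow> ell2 \<Rightarrow> ell2" where
  "propagator A t \<psi> = (\<Sum>k. scaleC_ell2 ((- \<i> * of_real t) ^ k / fact k) ((A ^^ k) \<psi>))"

lemma norm_scaleC_ell2: "norm (scaleC_ell2 c \<psi>) = cmod c * norm \<psi>"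
proof -
  have "(norm (scaleC_ell2 c \<psi>))\<^sup>2 = (cmod c * norm \<psi>)\<^sup>2"
    by (simp add: norm_ell2_sq scaleC_ell2.rep_eq norm_mult power_mult_distrib infsum_cmult_right')
  then show ?thesis by (simp add: power2_eq_iff_nonneg)
qed

lemma propagator_sums:
  assumes A: "\<And>\<phi>. norm (A \<phi>) \<le> B * norm \<phi>" and B: "0 \<le> B"
  shows "(\<lambda>k. scaleC_ell2 ((- \<i> * of_real t) ^ k / fact k) ((A ^^ k) \<psi>)) sums propagator A t \<psi>"
proof -
  have Ak: "norm ((A ^^ k) \<psi>) \<le> B ^ k * norm \<psi>" for k
  proof (induction k)
    case (Suc k)
    have "norm (A ((A ^^ k) \<psi>)) \<le> B * norm ((A ^^ k) \<psi>)" by (rule A)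
    also have "\<dots> \<le> B * (B ^ k * norm \<psi>)" by (intro mult_left_mono Suc.IH B)
    finally show ?case by (simp add: mult_ac)
  qed simp
  have "summable (\<lambda>k. scaleC_ell2 ((- \<i> * of_real t) ^ k / fact k) ((A ^^ k) \<psi>))"
  proof (rule summable_comparison_test')
    show "summable (\<lambda>k. inverse (fact k) * (\<bar>t\<bar> * B) ^ k * norm \<psi>)"
      by (intro summable_mult2 summable_exp)
    show "norm (scaleC_ell2 ((- \<i> * of_real t) ^ k / fact k) ((A ^^ k) \<psi>))
        \<le> inverse (fact k) * (\<bar>t\<bar> * B) ^ k * norm \<psi>" if "k \<ge> 0" for k
      using mult_left_mono[OF Ak[of k], of "\<bar>t\<bar> ^ k / fact k"]
      by (simp add: norm_scaleC_ell2 norm_divide norm_power norm_mult power_mult_distrib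
          field_simps)
  qed
  then show ?thesis unfolding propagator_def by (rule summable_sums)
qed

lemma norm_schrodinger_le:
  assumes V: "\<And>n. \<bar>V n\<bar> \<le> B"
  shows "norm (schrodinger V \<psi>) \<le> (2 + B) * norm \<psi>"
proof -
  have B: "0 \<le> B" using V[of 0] by simp
  have s: "(\<lambda>n. (cmod (coord \<psi> n))\<^sup>2) summable_on UNIV" using coord[of \<psi>] by simp
  define S where "S j = Abs_ell2 (\<lambda>n. coord \<psi> (n + j))" for j
  define W where "W = Abs_ell2 (\<lambda>n. of_real (V n) * coord \<psi> n)"
  have cS: "coord (S j) = (\<lambda>n. coord \<psi> (n + j))" for j
    unfolding S_def by (rule Abs_ell2_inverse) (simp add: sq_summable_shift[OF s])
  have cW: "coord W = (\<lambda>n. of_real (V n) * coord \<psi> n)"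
    unfolding W_def using sq_summable_bounded_mult[OF s, of "\<lambda>n. of_real (V n)" B] V
    by (intro Abs_ell2_inverse) auto
  have nS: "norm (S j) = norm \<psi>" for j
  proof -
    have "bij_betw (\<lambda>n. n + j) UNIV (UNIV :: int set)"
      by (rule bij_betwI[where g = "\<lambda>n. n - j"]) auto
    from infsum_reindex_bij_betw[OF this, of "\<lambda>n. (cmod (coord \<psi> n))\<^sup>2"]
    have "(norm (S j))\<^sup>2 = (norm \<psi>)\<^sup>2" by (simp add: norm_ell2_sq cS)
    then show ?thesis by (simp add: power2_eq_iff_nonneg)
  qed
  have "(norm W)\<^sup>2 \<le> (B * norm \<psi>)\<^sup>2"
    unfolding power_mult_distrib norm_ell2_sq cW infsum_cmult_right'[symmetric]
  proof (rule infsum_mono)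
    show "(\<lambda>n. (cmod (of_real (V n) * coord \<psi> n))\<^sup>2) summable_on UNIV"
      by (rule sq_summable_bounded_mult[OF s, of _ B]) (use V in auto)
    show "(\<lambda>n. B\<^sup>2 * (cmod (coord \<psi> n))\<^sup>2) summable_on UNIV"
      by (intro summable_on_cmult_right s)
    show "(cmod (of_real (V n) * coord \<psi> n))\<^sup>2 \<le> B\<^sup>2 * (cmod (coord \<psi> n))\<^sup>2" for n
      using V[of n] B
      by (simp add: norm_mult power_mult_distrib mult_right_mono abs_le_square_iff[symmetric])
  qed
  then have nW: "norm W \<le> B * norm \<psi>"
    by (rule power2_le_imp_le) (simp add: B)
  have "schrodinger V \<psi> = S 1 + S (- 1) + W"
    by (simp add: coord_inject[symmetric] fun_eq_iff plus_ell2.rep_eq coord_schrodinger[OF V] cS cW)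
  then have "norm (schrodinger V \<psi>) \<le> norm (S 1) + norm (S (- 1)) + norm W"
    by (metis norm_triangle_ineq norm_triangle_le add_mono order_refl)
  then show ?thesis using nS nW by (simp add: algebra_simps)
qed

definition time_avg :: "(ell2 \<Rightarrow> ell2) \<Rightarrow> int \<Rightarrow> real \<Rightarrow> real" where
  "time_avg A n T = 2 / T *
     (LBINT t:{0..}. exp (- 2 * t / T) * (cmod (cinner (propagator A t (delta 1)) (delta n)))\<^sup>2)"

definition outside_prob :: "(ell2 \<Rightarrow> ell2) \<Rightarrow> ereal \<Rightarrow> real \<Rightarrow> real" where
  "outside_prob A N T = (\<Sum>\<^sub>\<infinity>n\<in>{n. N < ereal \<bar>real_of_int n\<bar>}. time_avg A n T)"


section \<open>Transport exponents\<close>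

text \<open>\<open>T\<^sup>\<alpha> - 2\<close> for \<open>\<alpha> \<in> [0, \<infinity>]\<close>.\<close>

definition cutoff :: "ereal \<Rightarrow> real \<Rightarrow> ereal" where
  "cutoff \<alpha> T = (if \<alpha> = \<infinity> then \<infinity> else ereal (T powr real_of_ereal \<alpha> - 2))"

text \<open>The logarithm of a nonnegative number, with \<open>log 0 = - \<infinity>\<close> (the library sets
  \<open>ln 0 = 0\<close>).\<close>

definition elog :: "real \<Rightarrow> ereal" where
  "elog x = (if x = 0 then - \<infinity> else ereal (ln x))"

definition S_minus :: "(ell2 \<Rightarrow> ell2) \<Rightarrow> ereal \<Rightarrow> ereal" where
  "S_minus A \<alpha> = - Liminf at_top (\<lambda>T. elog (outside_prob A (cutoff \<alpha> T) T) / ereal (ln T))"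

definition S_plus :: "(ell2 \<Rightarrow> ell2) \<Rightarrow> ereal \<Rightarrow> ereal" where
  "S_plus A \<alpha> = - Limsup at_top (\<lambda>T. elog (outside_prob A (cutoff \<alpha> T) T) / ereal (ln T))"

definition alpha_u_minus :: "(ell2 \<Rightarrow> ell2) \<Rightarrow> ereal" where
  "alpha_u_minus A = Sup {\<alpha>. 0 \<le> \<alpha> \<and> S_minus A \<alpha> < \<infinity>}"

definition alpha_u_plus :: "(ell2 \<Rightarrow> ell2) \<Rightarrow> ereal" where
  "alpha_u_plus A = Sup {\<alpha>. 0 \<le> \<alpha> \<and> S_plus A \<alpha> < \<infinity>}"


section \<open>Trigonometric polynomials and quasi-periodic operators\<close>

definition trig_poly :: "(real \<Rightarrow> real) \<Rightarrow> bool" where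
  "trig_poly g \<longleftrightarrow> (\<exists>(m :: nat) (c :: int \<Rightarrow> complex).
     \<forall>x. complex_of_real (g x) = (\<Sum>k\<in>{- int m..int m}. c k * cis (2 * pi * of_int k * x)))"

lemma trig_poly_bounded:
  assumes "trig_poly g"
  shows "\<exists>B. \<forall>x. \<bar>g x\<bar> \<le> B"
proof -
  obtain m c where g: "\<And>x. complex_of_real (g x) =
      (\<Sum>k\<in>{- int m..int m}. c k * cis (2 * pi * of_int k * x))"
    using assms unfolding trig_poly_def by blast
  have "\<bar>g x\<bar> \<le> (\<Sum>k\<in>{- int m..int m}. cmod (c k))" for x
    using norm_sum[of "\<lambda>k. c k * cis (2 * pi * of_int k * x)" "{- int m..int m}"]
    by (simp add: g[of x, symmetric] norm_mult)
  then show ?thesis by blast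
qed

definition qp_operator ::
    "(real \<Rightarrow> real) \<Rightarrow> real \<Rightarrow> real \<Rightarrow> real \<Rightarrow> ell2 \<Rightarrow> ell2" where
  "qp_operator g lam \<theta> \<omega> = schrodinger (\<lambda>n. lam * g (of_int n * \<theta> + \<omega>))"

lemma coord_qp_operator:
  assumes "trig_poly g"
  shows "coord (qp_operator g lam \<theta> \<omega> \<psi>) n =
    coord \<psi> (n + 1) + coord \<psi> (n - 1) + of_real (lam * g (of_int n * \<theta> + \<omega>)) * coord \<psi> n"
proof -
  obtain B where B: "\<And>x. \<bar>g x\<bar> \<le> B" using trig_poly_bounded[OF assms] by blast
  show ?thesis
    unfolding qp_operator_def
    by (rule coord_schrodinger[where B = "\<bar>lam\<bar> * B"]) (simp add: abs_mult mult_left_mono B)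
qed


section \<open>Continued fraction convergents\<close>

fun complete_quotient :: "real \<Rightarrow> nat \<Rightarrow> real" where
  "complete_quotient \<theta> 0 = \<theta>"
| "complete_quotient \<theta> (Suc k) = 1 / frac (complete_quotient \<theta> k)"

definition partial_quotient :: "real \<Rightarrow> nat \<Rightarrow> int" where
  "partial_quotient \<theta> k = \<lfloor>complete_quotient \<theta> k\<rfloor>"

fun cont_frac :: "int list \<Rightarrow> rat" where
  "cont_frac [] = 0"
| "cont_frac [a] = of_int a"
| "cont_frac (a # b # as) = of_int a + 1 / cont_frac (b # as)"

definition cf_convergent :: "real \<Rightarrow> nat \<Rightarrow> rat" where
  "cf_convergent \<theta> k = cont_frac (map (partial_quotient \<theta>) [0..<Suc k])"

text \<open>\<open>quotient_of\<close> returns numerator and denominator in lowest terms, with positive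
  denominator.\<close>

definition convergent_denom :: "real \<Rightarrow> nat \<Rightarrow> int" where
  "convergent_denom \<theta> k = snd (quotient_of (cf_convergent \<theta> k))"

end

theory Submission
  imports Defs "HOL-Complex_Analysis.Complex_Analysis"
    "HOL-Computational_Algebra.Fundamental_Theorem_Algebra"
begin

text \<open>
  Let \<open>c\<^sub>m\<close> be the leading coefficient of \<open>g\<close>. The determinant of \<open>z - H\<close> restricted to \<open>n\<close> consecutive
  sites is a trigonometric polynomial of degree \<open>m n\<close> in the phase whose leading coefficient has
  modulus \<open>(\<lambda> \<bar>c\<^sub>m\<bar>)\<^sup>n\<close> for every complex \<open>z\<close>. If \<open>p / q\<close> is a convergent of \<open>\<theta>\<close> and \<open>16 m n \<le> q\<close>, the
  phases \<open>\<omega> + j \<theta>\<close> with \<open>j \<le> 2 m n\<close> are separated like \<open>q\<close>-th roots of unity, so Lagrange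
  interpolation makes the determinant at least \<open>exp n\<close> at one of them once \<open>\<lambda>\<close> is large: every
  window of length \<open>q\<close> contains a block of \<open>n\<close> sites with a large determinant, whatever \<open>\<omega>\<close> and \<open>z\<close>.

  Such a block stops the resolvent. On the block, compare the solution \<open>v\<close> vanishing at its left end with
  \<open>u = (z - H)\<^sup>-\<^sup>1 \<delta>\<^sub>1\<close>: their Wronskian is constant, and the currents \<open>Im (cnj v\<^sub>k v\<^sub>k\<^sub>+\<^sub>1)\<close> and
  \<open>Im (cnj u\<^sub>k\<^sub>+\<^sub>1 u\<^sub>k)\<close> have signs forced by \<open>Im z > 0\<close>, which bounds the mass of \<open>u\<close> beyond the block by
  \<open>1 / ((Im z)\<^sup>3 exp n)\<close>. Writing \<open>exp (- \<i> t H)\<close> as a contour integral of the resolvent over a rectangle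
  at height \<open>1 / (2 T)\<close>, the probability outside \<open>[- q, q]\<close> is \<open>O(T\<^sup>3 exp (- q / (16 m)))\<close>. This beats every
  power of \<open>T\<close> along \<open>T\<^sup>\<alpha> = q\<^sub>k + 2\<close>, and for all \<open>T\<close> if \<open>ln q\<^sub>k\<^sub>+\<^sub>1 = o(q\<^sub>k)\<close>.
\<close>

section \<open>Interpolation at the points of a rotation\<close>

text \<open>\<open>Q\<close> equals its Lagrange interpolant at the \<open>d + 1\<close> nodes, and
  every unnormalised basis polynomial \<open>L j\<close> is monic of degree \<open>d\<close>. The
  formula forces a large value at some node when the leading coefficient is large.\<close>

lemma lagrange_leading_coeff:
  fixes Q :: "complex poly" and z :: "nat \<Rightarrow> complex"
  assumes inj: "inj_on z {..d}" and deg: "degree Q \<le> d"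
  shows "coeff Q d = (\<Sum>j\<le>d. poly Q (z j) / (\<Prod>i\<in>{..d} - {j}. z j - z i))"
proof -
  define L where "L j = (\<Prod>i\<in>{..d} - {j}. [:- z i, 1:])" for j
  define w where "w j = (\<Prod>i\<in>{..d} - {j}. z j - z i)" for j
  define P where "P = (\<Sum>j\<le>d. smult (poly Q (z j) / w j) (L j))"
  have degL: "degree (L j) = d" if "j \<le> d" for j
    unfolding L_def by (subst degree_prod_sum_eq) (use that in auto)
  have coL: "coeff (L j) d = 1" if "j \<le> d" for j
    using lead_coeff_prod[of "\<lambda>i. [:- z i, 1:]" "{..d} - {j}"] degL[OF that]
    unfolding L_def by simp
  have w0: "w j \<noteq> 0" if "j \<le> d" for j
    using inj that unfolding w_def by (auto simp: inj_on_def)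
  have poL: "poly (L j) (z k) = (if j = k then w j else 0)" if "j \<le> d" "k \<le> d" for j k
    using that by (auto simp: L_def w_def poly_prod)
  have "poly P (z k) = poly Q (z k)" if k: "k \<le> d" for k
  proof -
    have "poly P (z k) = (\<Sum>j\<le>d. if j = k then poly Q (z j) else 0)"
      unfolding P_def poly_sum using k by (intro sum.cong) (auto simp: poL w0)
    then show ?thesis using k by simp
  qed
  moreover have "degree P \<le> d"
    unfolding P_def by (intro degree_sum_le) (auto simp: degL intro: order.trans[OF degree_smult_le])
  moreover have "card (z ` {..d}) = Suc d" using card_image[OF inj] by simp
  ultimately have "Q = P"
    by (intro poly_eqI_degree[where A = "z ` {..d}"]) (use deg in auto)
  then have "coeff Q d = coeff P d" by simp
  also have "\<dots> = (\<Sum>j\<le>d. poly Q (z j) / w j)"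
    unfolding P_def by (simp add: coeff_sum coL)
  finally show ?thesis by (simp add: w_def)
qed

text \<open>Both sides are the derivative of \<open>x ^ q - 1\<close> at \<open>1\<close>: once from
  the power, once by the product rule after splitting off the root \<open>1\<close>.\<close>

lemma prod_one_minus_roots_of_unity:
  assumes "q > 0"
  shows "(\<Prod>x\<in>{x :: complex. x ^ q = 1} - {1}. 1 - x) = of_nat q"
proof -
  define P where "P = monom 1 q - (1 :: complex poly)"
  define R where "R = {x :: complex. x ^ q = 1}"
  have P: "poly P x = x ^ q - 1" for x by (simp add: P_def poly_monom)
  have dP: "pderiv P = monom (of_nat q) (q - 1)"
    by (simp add: P_def pderiv_diff pderiv_monom)
  have "rsquarefree P"
    unfolding rsquarefree_roots using assms by (auto simp: P dP poly_monom power_0_left)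
  then have "smult (lead_coeff P) (\<Prod>x\<in>R. [:- x, 1:]) = P"
    using complex_poly_decompose_rsquarefree[of P] by (simp add: P R_def)
  moreover have "degree P = q"
    unfolding P_def using assms by (subst diff_conv_add_uminus, subst degree_add_eq_left) (auto simp: degree_monom_eq)
  then have "lead_coeff P = 1" using assms by (simp add: P_def)
  ultimately have eq: "P = (\<Prod>x\<in>R. [:- x, 1:])" by simp
  have fin: "finite R" unfolding R_def using finite_roots_unity[of q] assms by simp
  have "P = [:- 1, 1:] * (\<Prod>x\<in>R - {1}. [:- x, 1:])"
    unfolding eq by (rule prod.remove[OF fin]) (simp add: R_def)
  then have "pderiv P = [:- 1, 1:] * pderiv (\<Prod>x\<in>R - {1}. [:- x, 1:]) + (\<Prod>x\<in>R - {1}. [:- x, 1:])"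
    by (simp only: pderiv_mult) (simp add: pderiv_pCons)
  then have "poly (pderiv P) 1 = (\<Prod>x\<in>R - {1}. 1 - x)"
    by (simp only: poly_add poly_mult poly_prod) simp
  then show ?thesis by (simp add: dP poly_monom R_def)
qed

text \<open>The full product has modulus \<open>q\<close>, which is at least 1, and each of the
  \<open>q - 1 - card S\<close> omitted factors is at most 2.\<close>

lemma prod_one_minus_roots_lower_bound:
  assumes q: "q > 0" and S: "S \<subseteq> {x :: complex. x ^ q = 1} - {1}"
  shows "1 \<le> 2 ^ (q - 1 - card S) * (\<Prod>x\<in>S. cmod (1 - x))"
proof -
  define R where "R = {x :: complex. x ^ q = 1} - {1}"
  have fin: "finite R" unfolding R_def using finite_roots_unity[of q] q by simp
  have S': "S \<subseteq> R" using S by (simp add: R_def)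
  then have fS: "finite S" using fin finite_subset by auto
  have "card {x :: complex. x ^ q = 1} = q" using card_roots_unity_eq q by blast
  then have cR: "card R = q - 1" unfolding R_def by (subst card_Diff_singleton) auto
  have le2: "cmod (1 - x) \<le> 2" if "x \<in> R" for x
  proof -
    have "cmod x ^ q = 1 ^ q" using that by (simp add: R_def flip: norm_power)
    then have "cmod x = 1" using q by (subst (asm) power_eq_iff_eq_base) auto
    then show ?thesis using norm_triangle_ineq4[of 1 x] by simp
  qed
  have "1 \<le> real q" using q by simp
  also have "real q = cmod (\<Prod>x\<in>R. 1 - x)"
    unfolding R_def by (subst prod_one_minus_roots_of_unity[OF q]) simp
  also have "\<dots> = (\<Prod>x\<in>R - S. cmod (1 - x)) * (\<Prod>x\<in>S. cmod (1 - x))"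
    unfolding prod_norm[symmetric] by (rule prod.subset_diff[OF S' fin])
  also have "\<dots> \<le> (\<Prod>x\<in>R - S. 2) * (\<Prod>x\<in>S. cmod (1 - x))"
    by (intro mult_right_mono prod_mono prod_nonneg) (use le2 in auto)
  also have "(\<Prod>x\<in>R - S. 2 :: real) = 2 ^ (q - 1 - card S)"
    using card_Diff_subset[OF fS S'] by (simp add: cR)
  finally show ?thesis .
qed

text \<open>The powers of \<open>w\<close> sum to zero, so \<open>q\<close> is the sum of
  \<open>1 - w ^ k\<close> over \<open>k < q\<close>; telescoping bounds each term by
  \<open>k * cmod (1 - w)\<close>.\<close>

lemma root_of_unity_gap:
  fixes w :: complex
  assumes "w ^ q = 1" "w \<noteq> 1" "q > 0"
  shows "2 \<le> real q * cmod (1 - w)"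
proof -
  have nw: "cmod w = 1"
  proof -
    have "cmod w ^ q = 1 ^ q" using assms by (simp flip: norm_power)
    then show ?thesis using assms(3) by (subst (asm) power_eq_iff_eq_base) auto
  qed
  have le: "cmod (1 - w ^ k) \<le> k * cmod (1 - w)" for k
  proof (induction k)
    case (Suc k)
    have "1 - w ^ Suc k = (1 - w ^ k) + w ^ k * (1 - w)" by (simp add: algebra_simps)
    then have "cmod (1 - w ^ Suc k) \<le> cmod (1 - w ^ k) + cmod (w ^ k * (1 - w))"
      by (metis norm_triangle_ineq)
    also have "cmod (w ^ k * (1 - w)) = cmod (1 - w)" by (simp add: norm_mult norm_power nw)
    finally show ?case using Suc by (simp add: algebra_simps)
  qed simp
  have "(\<Sum>k<q. w ^ k) = 0"
    using assms by (simp add: sum_gp_strict)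
  then have "of_nat q = (\<Sum>k<q. 1 - w ^ k)"
    by (simp add: sum_subtractf)
  then have "real q = cmod (\<Sum>k<q. 1 - w ^ k)"
    by (metis norm_of_nat)
  also have "\<dots> \<le> (\<Sum>k<q. k * cmod (1 - w))"
    by (intro sum_norm_le le)
  also have "\<dots> = (\<Sum>k<q. real k) * cmod (1 - w)" by (simp add: sum_distrib_right)
  also have "(\<Sum>k<q. real k) = real q * (real q - 1) / 2"
    by (induction q) (auto simp: field_simps)
  finally have "real q * 2 \<le> real q * ((real q - 1) * cmod (1 - w))" by simp
  then have "2 \<le> (real q - 1) * cmod (1 - w)" using assms(3) by simp
  also have "\<dots> \<le> real q * cmod (1 - w)" by (intro mult_right_mono) auto
  finally show ?thesis .
qed

lemma cmod_cis_diff_le: "cmod (cis a - cis b) \<le> \<bar>a - b\<bar>"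
proof -
  have "cmod (exp (\<i> * (a - b)) - 1) = cmod (cis a - cis b)"
  proof -
    have "cis a - cis b = cis b * (cis (a - b) - 1)"
      by (simp add: algebra_simps cis_mult)
    then show ?thesis by (simp add: norm_mult cis_conv_exp)
  qed
  moreover have "cmod (exp (\<i> * of_real (a - b)) - 1) = 2 * \<bar>sin ((a - b) / 2)\<bar>"
    by (rule dist_exp_i_1)
  moreover have "\<bar>sin ((a - b) / 2)\<bar> \<le> \<bar>(a - b) / 2\<bar>" by (rule abs_sin_x_le_abs_x)
  ultimately show ?thesis by simp
qed

lemma cis_rat_eq_1_iff:
  assumes "coprime p (int q)" "q > 0" 
  shows "cis (2 * pi * of_int k * (of_int p / of_nat q)) = 1 \<longleftrightarrow> int q dvd k"
proof -
  have "cis (2 * pi * of_int k * (of_int p / of_nat q)) = 1 \<longleftrightarrow>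
      (\<exists>n::int. 2 * pi * of_int k * (of_int p / of_nat q) = of_int (2 * n) * pi)"
    unfolding cis_conv_exp exp_eq_1 by simp
  also have "\<dots> \<longleftrightarrow> (\<exists>n::int. real_of_int (k * p) = real_of_int (n * int q))"
    using assms(2) by (intro ex_cong1) (auto simp: field_simps)
  also have "\<dots> \<longleftrightarrow> int q dvd k * p"
    unfolding of_int_eq_iff by (auto simp: dvd_def mult.commute)
  also have "\<dots> \<longleftrightarrow> int q dvd k"
    using assms(1) by (metis coprime_commute coprime_dvd_mult_left_iff)
  finally show ?thesis .
qed

text \<open>The differences are compared with those of the rotation by \<open>p / q\<close>, which
  have the moduli of \<open>1 - y i\<close> for distinct nontrivial \<open>q\<close>-th roots of
  unity \<open>y i\<close>. Replacing \<open>\<theta>\<close> by \<open>p / q\<close> costs a factor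
  2 per node, the \<open>q - 1 - d\<close> roots that do not occur cost a factor 2 each, and the
  total stays below \<open>2 ^ q\<close>.\<close>

lemma rotation_nodes_separated:
  fixes \<theta> :: real
  assumes cop: "coprime p (int q)" and q: "q > 0"
    and \<theta>: "\<bar>\<theta> - of_int p / of_nat q\<bar> \<le> 1 / (of_nat q)\<^sup>2"
    and d: "8 * d \<le> q" and j: "j \<le> d"
  defines "z \<equiv> \<lambda>i :: nat. cis (2 * pi * (of_nat i * \<theta>))"
  shows "1 \<le> 2 ^ q * (\<Prod>i\<in>{..d} - {j}. cmod (z j - z i))"
proof -
  define y where "y i = cis (2 * pi * of_int (int i - int j) * (of_int p / of_nat q))" for i
  have dq: "d < q" using d q by simp
  have close: "cmod (1 - y i) \<le> 2 * cmod (z j - z i)" if i: "i \<in> {..d} - {j}" for i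
  proof -
    have nd: "\<not> int q dvd int i - int j"
    proof
      assume "int q dvd int i - int j"
      moreover have "int i - int j \<noteq> 0" using i by simp
      ultimately have "int q \<le> \<bar>int i - int j\<bar>"
        by (metis dvd_imp_le_int abs_of_nat)
      then show False using i j dq by auto
    qed
    then have y1: "y i \<noteq> 1" unfolding y_def cis_rat_eq_1_iff[OF cop q] .
    have yq: "y i ^ q = 1"
    proof -
      have "y i ^ q = cis (2 * pi * of_int ((int i - int j) * int q) * (of_int p / of_nat q))"
        unfolding y_def Complex.DeMoivre by (simp add: mult_ac)
      then show ?thesis by (simp only: cis_rat_eq_1_iff[OF cop q]) simp
    qed
    have "z j - z i = z j * (1 - cis (2 * pi * (of_int (int i - int j) * \<theta>)))"
      by (simp add: z_def right_diff_distrib cis_mult algebra_simps)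
    then have zz: "cmod (z j - z i) = cmod (1 - cis (2 * pi * (of_int (int i - int j) * \<theta>)))"
      by (simp add: norm_mult z_def)
    have "cmod (1 - y i) \<le> cmod (z j - z i) + cmod (cis (2 * pi * (of_int (int i - int j) * \<theta>)) - y i)"
      unfolding zz using norm_triangle_sub[of "1 - y i" "1 - cis (2 * pi * (of_int (int i - int j) * \<theta>))"]
      by simp
    also have "cmod (cis (2 * pi * (of_int (int i - int j) * \<theta>)) - y i)
       \<le> \<bar>2 * pi * (of_int (int i - int j) * \<theta>) - 2 * pi * of_int (int i - int j) * (of_int p / of_nat q)\<bar>"
      unfolding y_def by (rule cmod_cis_diff_le)
    also have "\<dots> = 2 * pi * \<bar>of_int (int i - int j)\<bar> * \<bar>\<theta> - of_int p / of_nat q\<bar>"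
    proof -
      have "2 * pi * (of_int (int i - int j) * \<theta>) - 2 * pi * of_int (int i - int j) * (of_int p / of_nat q)
        = 2 * pi * of_int (int i - int j) * (\<theta> - of_int p / of_nat q)"
        by (simp only: algebra_simps)
      then show ?thesis by (simp only: abs_mult) simp
    qed
    \<comment> \<open>Here \<open>pi\<close> is bounded by 4 and the index difference by
      \<open>d\<close>; the hypothesis \<open>8 * d \<le> q\<close> is calibrated to the resulting
      constant 8.\<close>
    also have "\<dots> \<le> 2 * 4 * real d * (1 / (of_nat q)\<^sup>2)"
      using i j pi_less_4 by (intro mult_mono \<theta>) auto
    also have "\<dots> \<le> 1 / real q"
    proof -
      have "8 * real d \<le> real q" using d by linarith
      then show ?thesis using q by (simp add: field_simps power2_eq_square)
    qed
    \<comment> \<open>The gap \<open>2 / q\<close> of the roots of unity makes the perturbation at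
      most half of the main term, so it can be absorbed.\<close>
    also have "1 / real q \<le> cmod (1 - y i) / 2"
      using root_of_unity_gap[OF yq y1 q] q by (simp add: field_simps)
    finally show ?thesis by simp
  qed
  have y_root: "y ` ({..d} - {j}) \<subseteq> {x. x ^ q = 1} - {1}"
  proof (rule image_subsetI)
    fix i assume "i \<in> {..d} - {j}"
    then have i: "i \<le> d" "i \<noteq> j" by auto
    have "y i ^ q = cis (2 * pi * of_int ((int i - int j) * int q) * (of_int p / of_nat q))"
      unfolding y_def Complex.DeMoivre by (simp add: mult_ac)
    then have "y i ^ q = 1" by (simp only: cis_rat_eq_1_iff[OF cop q]) simp
    moreover have "y i \<noteq> 1"
    proof
      assume "y i = 1"
      then have "int q dvd int i - int j" unfolding y_def cis_rat_eq_1_iff[OF cop q] .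
      then have "int q \<le> \<bar>int i - int j\<bar>" using i by (metis dvd_imp_le_int abs_of_nat eq_iff_diff_eq_0 of_nat_eq_iff)
      then show False using i j dq by auto
    qed
    ultimately show "y i \<in> {x. x ^ q = 1} - {1}" by simp
  qed
  have inj: "inj_on y ({..d} - {j})"
  proof (rule inj_onI)
    fix i k assume ik: "i \<in> {..d} - {j}" "k \<in> {..d} - {j}" "y i = y k"
    have "cis (2 * pi * of_int (int i - int k) * (of_int p / of_nat q)) = y i / y k"
      unfolding y_def cis_divide by (simp add: algebra_simps diff_divide_distrib)
    also have "\<dots> = 1" using ik by (simp add: y_def)
    finally have "int q dvd int i - int k" unfolding cis_rat_eq_1_iff[OF cop q] .
    then have "int q \<le> \<bar>int i - int k\<bar>" if "i \<noteq> k"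
      using that by (metis dvd_imp_le_int abs_of_nat eq_iff_diff_eq_0 of_nat_eq_iff)
    moreover have "\<bar>int i - int k\<bar> < int q" using ik dq by auto
    ultimately show "i = k" by fastforce
  qed
  have card: "card ({..d} - {j}) = d" using j by simp
  have "1 \<le> 2 ^ (q - 1 - d) * (\<Prod>x\<in>y ` ({..d} - {j}). cmod (1 - x))"
    using prod_one_minus_roots_lower_bound[OF q y_root] by (simp add: card_image[OF inj] card)
  also have "(\<Prod>x\<in>y ` ({..d} - {j}). cmod (1 - x)) = (\<Prod>i\<in>{..d} - {j}. cmod (1 - y i))"
    by (simp add: prod.reindex[OF inj])
  also have "\<dots> \<le> (\<Prod>i\<in>{..d} - {j}. 2 * cmod (z j - z i))"
    by (intro prod_mono) (use close in auto)
  also have "\<dots> = 2 ^ d * (\<Prod>i\<in>{..d} - {j}. cmod (z j - z i))"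
    unfolding prod.distrib using card by simp
  finally have "1 \<le> 2 ^ (q - 1 - d) * 2 ^ d * (\<Prod>i\<in>{..d} - {j}. cmod (z j - z i))"
    by (simp add: mult.assoc)
  also have "(2 :: real) ^ (q - 1 - d) * 2 ^ d = 2 ^ (q - 1)"
    using dq by (simp flip: power_add)
  also have "2 ^ (q - 1) * (\<Prod>i\<in>{..d} - {j}. cmod (z j - z i)) \<le> 2 ^ q * (\<Prod>i\<in>{..d} - {j}. cmod (z j - z i))"
    by (intro mult_right_mono power_increasing prod_nonneg) auto
  finally show ?thesis .
qed

section \<open>Determinants of quasi-periodic Jacobi matrices\<close>

lemma coeff_mult_degree_le:
  fixes p r :: "'a :: comm_semiring_0 poly"
  assumes "degree p \<le> m" "degree r \<le> n"
  shows "coeff (p * r) (m + n) = coeff p m * coeff r n"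
proof -
  have "coeff (p * r) (m + n) = (\<Sum>i\<le>m + n. if i = m then coeff p m * coeff r n else 0)"
    unfolding coeff_mult
  proof (intro sum.cong refl)
    fix i assume "i \<in> {..m + n}"
    show "coeff p i * coeff r (m + n - i) = (if i = m then coeff p m * coeff r n else 0)"
      using assms by (cases i m rule: linorder_cases) (auto simp: coeff_eq_0)
  qed
  then show ?thesis by simp
qed

text \<open>Index convention: \<open>continuant x (Suc n)\<close> is the determinant of the \<open>n \<times> n\<close> tridiagonal matrix
  with diagonal \<open>x\<close> and off-diagonal entries \<open>1\<close>, and \<open>continuant x\<close> solves the eigenvalue equation with
  initial values \<open>0, 1\<close>.\<close>

fun continuant :: "(nat \<Rightarrow> complex) \<Rightarrow> nat \<Rightarrow> complex" where
  "continuant x 0 = 0"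
| "continuant x (Suc 0) = 1"
| "continuant x (Suc (Suc k)) = x k * continuant x (Suc k) - continuant x k"

text \<open>Clearing the negative powers of \<open>\<zeta> = exp (2 \<pi> \<i> \<omega>)\<close> turns the diagonal entries into polynomials of degree
  \<open>2 m\<close> in \<open>\<zeta>\<close>.\<close>

fun hom_continuant :: "nat \<Rightarrow> (nat \<Rightarrow> complex poly) \<Rightarrow> nat \<Rightarrow> complex poly" where
  "hom_continuant m X 0 = 0"
| "hom_continuant m X (Suc 0) = 1"
| "hom_continuant m X (Suc (Suc k)) =
     X k * hom_continuant m X (Suc k) - monom 1 (2 * m) * hom_continuant m X k"

text \<open>The factor \<open>monom 1 (2 * m)\<close> in the recursion compensates for the two
  powers of \<open>\<zeta> ^ m\<close> that separate \<open>k\<close> from \<open>k + 2\<close>. The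
  factor \<open>\<zeta> ^ m\<close> on the left avoids an exponent
  \<open>m * (k - 1)\<close>.\<close>

lemma poly_hom_continuant:
  assumes "\<And>k. poly (X k) \<zeta> = \<zeta> ^ m * x k"
  shows "\<zeta> ^ m * poly (hom_continuant m X k) \<zeta> = \<zeta> ^ (m * k) * continuant x k"
proof (induction k rule: induct_nat_012)
  case (ge2 k)
  have "\<zeta> ^ m * poly (hom_continuant m X (Suc (Suc k))) \<zeta> =
    \<zeta> ^ m * x k * (\<zeta> ^ m * poly (hom_continuant m X (Suc k)) \<zeta>)
      - \<zeta> ^ (2 * m) * (\<zeta> ^ m * poly (hom_continuant m X k) \<zeta>)"
    by (simp add: assms poly_monom algebra_simps)
  also have "\<dots> = \<zeta> ^ (m * Suc (Suc k)) * continuant x (Suc (Suc k))"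
    unfolding ge2 by (simp add: algebra_simps power_add power2_eq_square power_mult)
  finally show ?case .
qed simp_all

text \<open>Multiplication by \<open>X k\<close> raises the degree bound by \<open>2 * m\<close> in
  one step, whereas the subtracted term needs two steps for the same amount. So only the product of
  the diagonal entries reaches the top coefficient.\<close>

lemma hom_continuant_leading:
  assumes m: "m > 0" and deg: "\<And>k. degree (X k) \<le> 2 * m"
  shows "degree (hom_continuant m X (Suc k)) \<le> 2 * m * k \<and>
    coeff (hom_continuant m X (Suc k)) (2 * m * k) = (\<Prod>i<k. coeff (X i) (2 * m))"
proof (induction k rule: less_induct)
  case (less k)
  show ?case
  proof (cases k)
    case (Suc l)
    let ?H = "hom_continuant m X"
    have IH: "degree (?H (Suc l)) \<le> 2 * m * l"
      "coeff (?H (Suc l)) (2 * m * l) = (\<Prod>i<l. coeff (X i) (2 * m))"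
      using less.IH[of l] Suc by auto
    have dl: "degree (?H l) \<le> 2 * m * (l - 1)"
      using less.IH[of "l - 1"] Suc by (cases l) auto
    have small: "degree (monom 1 (2 * m) * ?H l) < 2 * m * Suc l"
    proof (cases "l = 0")
      case False
      have "degree (monom 1 (2 * m) * ?H l) \<le> 2 * m + 2 * m * (l - 1)"
        using degree_mult_le[of "monom 1 (2 * m)" "?H l"] degree_monom_le[of "1 :: complex" "2 * m"] dl
        by linarith
      also have "\<dots> < 2 * m * Suc l" using m False by (cases l) auto
      finally show ?thesis .
    qed (use m in auto)
    have big: "degree (X l * ?H (Suc l)) \<le> 2 * m * Suc l"
      using degree_mult_le[of "X l" "?H (Suc l)"] deg[of l] IH(1) by simp
    have "coeff (X l * ?H (Suc l)) (2 * m + 2 * m * l) = coeff (X l) (2 * m) * coeff (?H (Suc l)) (2 * m * l)"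
      by (intro coeff_mult_degree_le deg IH)
    moreover have "coeff (monom 1 (2 * m) * ?H l) (2 * m * Suc l) = 0"
      by (rule coeff_eq_0[OF small])
    ultimately show ?thesis
      using degree_diff_le[OF big less_imp_le[OF small]] IH(2) unfolding Suc
      by (simp add: mult.commute)
  qed simp
qed

text \<open>If the determinant were below \<open>exp n\<close> at all \<open>2 * m * n + 1\<close>
  phases, interpolation would bound its leading coefficient, of modulus
  \<open>(lam * cmod (c m)) ^ n\<close>, strictly by \<open>(2 * m * n + 1) * exp n * 2 ^ q\<close>.
  The lower bound on \<open>lam\<close> contradicts this.\<close>

lemma large_determinant:
  fixes g :: "real \<Rightarrow> real" and c :: "int \<Rightarrow> complex"
  assumes g: "\<And>x. complex_of_real (g x) = (\<Sum>k\<in>{- int m..int m}. c k * cis (2 * pi * of_int k * x))"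
    and m: "m > 0" and n: "n > 0"
    and lam: "exp 1 * 2 ^ (32 * m) * 3 ^ m \<le> lam * cmod (c (int m))" and lam0: "lam \<ge> 0"
    and cop: "coprime p (int q)"
    and \<theta>: "\<bar>\<theta> - of_int p / of_nat q\<bar> \<le> 1 / (of_nat q)\<^sup>2"
    and q: "16 * m * n \<le> q" "q < 16 * m * Suc n"
  shows "\<exists>j\<le>2 * m * n.
    exp (real n) \<le> cmod (continuant (\<lambda>k. z - of_real (lam * g (of_nat (j + k) * \<theta> + \<omega>))) (Suc n))"
proof -
  \<comment> \<open>\<open>X k\<close> is \<open>\<zeta> ^ m\<close> times the diagonal entry. The
    energy \<open>z\<close> enters at degree \<open>m\<close> only, strictly below
    \<open>2 * m\<close>, which makes the final bound uniform in \<open>z\<close>.\<close>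
  define X where "X k = monom z m -
    (\<Sum>i\<le>2 * m. monom (of_real lam * c (int i - int m) * cis (2 * pi * of_int (int i - int m) * (of_nat k * \<theta>))) i)"
    for k :: nat
  define x where "x w k = z - of_real (lam * g (of_nat k * \<theta> + w))" for w :: real and k :: nat
  have poly_X: "poly (X k) (cis (2 * pi * w)) = cis (2 * pi * w) ^ m * x w k" for k w
  proof -
    have "cis (2 * pi * w) ^ m * complex_of_real (g (of_nat k * \<theta> + w)) =
      (\<Sum>i\<le>2 * m. cis (2 * pi * w) ^ m * (c (int i - int m) *
         cis (2 * pi * of_int (int i - int m) * (of_nat k * \<theta> + w))))"
      unfolding g sum_distrib_left
      by (rule sum.reindex_bij_witness[of _ "\<lambda>i. int i - int m" "\<lambda>i. nat (i + int m)"]) auto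
    also have "\<dots> = (\<Sum>i\<le>2 * m. c (int i - int m) *
         cis (2 * pi * of_int (int i - int m) * (of_nat k * \<theta>)) * cis (2 * pi * w) ^ i)"
    proof (intro sum.cong refl)
      fix i
      have "cis (2 * pi * w) ^ m * cis (2 * pi * of_int (int i - int m) * (of_nat k * \<theta> + w)) =
        cis (2 * pi * of_int (int i - int m) * (of_nat k * \<theta>)) * cis (2 * pi * w) ^ i"
        unfolding Complex.DeMoivre cis_mult by (simp add: algebra_simps)
      then show "cis (2 * pi * w) ^ m * (c (int i - int m) *
         cis (2 * pi * of_int (int i - int m) * (of_nat k * \<theta> + w))) = c (int i - int m) *
         cis (2 * pi * of_int (int i - int m) * (of_nat k * \<theta>)) * cis (2 * pi * w) ^ i"
        by (simp only: mult_ac)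
    qed
    finally have "cis (2 * pi * w) ^ m * complex_of_real (lam * g (of_nat k * \<theta> + w)) =
      (\<Sum>i\<le>2 * m. of_real lam * (c (int i - int m) *
         cis (2 * pi * of_int (int i - int m) * (of_nat k * \<theta>)) * cis (2 * pi * w) ^ i))"
      unfolding sum_distrib_left[symmetric] of_real_mult by (simp only: mult_ac)
    then show ?thesis
      unfolding X_def x_def by (simp add: poly_sum poly_monom right_diff_distrib mult_ac)
  qed
  have deg_X: "degree (X k) \<le> 2 * m" for k
    unfolding X_def
    by (intro degree_diff_le degree_sum_le order.trans[OF degree_monom_le]) auto
  have coeff_X: "cmod (coeff (X k) (2 * m)) = lam * cmod (c (int m))" for k
  proof -
    have "coeff (X k) (2 * m) = - (of_real lam * c (int m) * cis (2 * pi * of_int (int m) * (of_nat k * \<theta>)))"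
      unfolding X_def using m by (simp add: coeff_sum if_distrib cong: if_cong)
    then show ?thesis using lam0 by (simp add: norm_mult)
  qed
  define d where "d = 2 * m * n"
  define Q where "Q = hom_continuant m X (Suc n)"
  define \<zeta> where "\<zeta> j = cis (2 * pi * (\<omega> + of_nat j * \<theta>))" for j :: nat
  have deg_Q: "degree Q \<le> d" and coeff_Q: "coeff Q d = (\<Prod>i<n. coeff (X i) (2 * m))"
    using hom_continuant_leading[of m X n, OF m deg_X] by (auto simp: Q_def d_def)
  have norm_Q: "cmod (poly Q (\<zeta> j)) = cmod (continuant (x (\<omega> + of_nat j * \<theta>)) (Suc n))" for j
  proof -
    have "cmod (\<zeta> j ^ m * poly Q (\<zeta> j)) = cmod (\<zeta> j ^ (m * Suc n) * continuant (x (\<omega> + of_nat j * \<theta>)) (Suc n))"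
      unfolding Q_def \<zeta>_def by (subst poly_hom_continuant[OF poly_X]) simp
    then show ?thesis by (simp add: norm_mult norm_power \<zeta>_def)
  qed
  have q0: "q > 0" using q m n by (metis gr_zeroI le_zero_eq mult_eq_0_iff neq0_conv zero_neq_numeral)
  have dq: "8 * d \<le> q" using q by (simp add: d_def)
  have sep: "1 \<le> 2 ^ q * cmod (\<Prod>i\<in>{..d} - {j}. \<zeta> j - \<zeta> i)" if "j \<le> d" for j
  proof -
    have "\<zeta> j - \<zeta> i = cis (2 * pi * \<omega>) * (cis (2 * pi * (of_nat j * \<theta>)) - cis (2 * pi * (of_nat i * \<theta>)))" for i
      unfolding \<zeta>_def right_diff_distrib cis_mult by (simp add: distrib_left)
    then show ?thesis
      using rotation_nodes_separated[OF cop q0 \<theta> dq that]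
      by (simp add: prod_norm[symmetric] norm_mult)
  qed
  have inj: "inj_on \<zeta> {..d}"
  proof (rule inj_onI, rule ccontr)
    fix i j assume ij: "i \<in> {..d}" "j \<in> {..d}" "\<zeta> i = \<zeta> j" "i \<noteq> j"
    then have "(\<Prod>i\<in>{..d} - {j}. \<zeta> j - \<zeta> i) = 0" by (intro prod_zero bexI[of _ i]) auto
    moreover have "j \<le> d" using ij by simp
    note sep[OF this]
    ultimately show False by (simp only: norm_zero mult_zero_right)
  qed
  have "\<exists>j\<le>d. exp (real n) \<le> cmod (poly Q (\<zeta> j))"
  proof (rule ccontr)
    assume "\<not> ?thesis"
    then have small: "cmod (poly Q (\<zeta> j)) < exp (real n)" if "j \<le> d" for j using that by force
    have "(exp 1 * 2 ^ (32 * m) * 3 ^ m) ^ n \<le> (lam * cmod (c (int m))) ^ n"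
      by (intro power_mono lam) simp
    also have "\<dots> = cmod (coeff Q d)"
      unfolding coeff_Q by (simp add: prod_norm[symmetric] coeff_X)
    also have "\<dots> \<le> (\<Sum>j\<le>d. cmod (poly Q (\<zeta> j) / (\<Prod>i\<in>{..d} - {j}. \<zeta> j - \<zeta> i)))"
      unfolding lagrange_leading_coeff[OF inj deg_Q] by (rule norm_sum)
    also have "\<dots> < (\<Sum>j\<le>d. exp (real n) * 2 ^ q)"
    proof (rule sum_strict_mono)
      fix j assume "j \<in> {..d}"
      then have j: "j \<le> d" by simp
      define w where "w = cmod (\<Prod>i\<in>{..d} - {j}. \<zeta> j - \<zeta> i)"
      have w: "1 \<le> 2 ^ q * w" using sep[OF j] by (simp add: w_def)
      then have "w > 0" by (metis linorder_not_le mult_nonneg_nonpos not_one_le_zero order_trans zero_le_numeral zero_le_power)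
      then have "cmod (poly Q (\<zeta> j)) / w \<le> cmod (poly Q (\<zeta> j)) * 2 ^ q"
        using w mult_left_mono[OF w, of "cmod (poly Q (\<zeta> j))"] by (simp add: field_simps)
      also have "\<dots> < exp (real n) * 2 ^ q" using small[OF j] by simp
      finally show "cmod (poly Q (\<zeta> j) / (\<Prod>i\<in>{..d} - {j}. \<zeta> j - \<zeta> i)) < exp (real n) * 2 ^ q"
        by (simp add: norm_divide w_def)
    qed auto
    also have "\<dots> = exp (real n) * (real (Suc d) * 2 ^ q)" by simp
    also have "\<dots> \<le> exp (real n) * (3 ^ (m * n) * 2 ^ (32 * m * n))"
    proof (intro mult_left_mono mult_mono)
      \<comment> \<open>Bernoulli trades the number of nodes for a factor \<open>3 ^ m\<close> per
        site; below, \<open>q < 16 * m * Suc n\<close> with \<open>n \<ge> 1\<close> gives a factor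
        \<open>2 ^ (32 * m)\<close> per site.\<close>
      have "1 + real (m * n) * 2 \<le> (1 + 2) ^ (m * n)" by (rule Bernoulli_inequality) simp
      then show "real (Suc d) \<le> 3 ^ (m * n)" by (simp add: d_def mult_ac)
      have "q \<le> 32 * m * n"
      proof -
        have "16 * m \<le> 16 * m * n" using n by simp
        moreover have "16 * m * Suc n = 16 * m * n + 16 * m" "32 * m * n = 2 * (16 * m * n)" by simp_all
        ultimately show ?thesis using q by linarith
      qed
      then show "(2 :: real) ^ q \<le> 2 ^ (32 * m * n)" by (intro power_increasing) auto
    qed auto
    also have "\<dots> = (exp 1 * 2 ^ (32 * m) * 3 ^ m) ^ n"
      by (simp add: power_mult_distrib exp_of_nat_mult[symmetric] flip: power_mult)
    finally show False by simp
  qed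
  then obtain j where j: "j \<le> 2 * m * n" "exp (real n) \<le> cmod (poly Q (\<zeta> j))"
    by (auto simp: d_def)
  have "x (\<omega> + of_nat j * \<theta>) = (\<lambda>k. z - of_real (lam * g (of_nat (j + k) * \<theta> + \<omega>)))"
    by (simp add: x_def fun_eq_iff algebra_simps)
  then show ?thesis using j norm_Q[of j] by auto
qed

section \<open>Decay of solutions of the eigenvalue equation\<close>

text \<open>The Wronskian with \<open>v\<close> gives \<open>U n = r * U (Suc n) + U 0 / D\<close>,
  where \<open>r = v n / D\<close> has \<open>Im r \<le> 0\<close> because the current of
  \<open>v\<close> starts at 0 and never decreases. Hence minus the current of \<open>U\<close> at
  \<open>n\<close> is at most the right-hand side. That current grows by
  \<open>Im z * (cmod (U i))\<^sup>2\<close> per site and tends to 0, so minus its value at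
  \<open>n\<close> is \<open>Im z\<close> times the whole tail.\<close>

lemma jacobi_tail_upper_half_plane:
  fixes U :: "nat \<Rightarrow> complex" and V :: "nat \<Rightarrow> real" and n :: nat
  assumes U: "\<And>i. U (Suc (Suc i)) = (z - of_real (V i)) * U (Suc i) - U i"
    and lim: "U \<longlonglongrightarrow> 0" and z: "Im z > 0"
  defines "D \<equiv> continuant (\<lambda>i. z - of_real (V i)) (Suc n)"
  assumes D: "D \<noteq> 0" and F: "finite F" "F \<subseteq> {n<..}"
  shows "Im z * (\<Sum>i\<in>F. (cmod (U i))\<^sup>2) \<le> cmod (U 0) * cmod (U (Suc n)) / cmod D"
proof -
  define v where "v = continuant (\<lambda>i. z - of_real (V i))"
  have v0: "v 0 = 0" "v (Suc 0) = 1" by (simp_all add: v_def)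
  have v: "v (Suc (Suc i)) = (z - of_real (V i)) * v (Suc i) - v i" for i by (simp add: v_def)
  define current where "current f i = Im (cnj (f i) * f (Suc i))" for f :: "nat \<Rightarrow> complex" and i
  have current: "current f (Suc i) = current f i + Im z * (cmod (f (Suc i)))\<^sup>2"
    if "f (Suc (Suc i)) = (z - of_real (V i)) * f (Suc i) - f i" for f i
    unfolding current_def that cmod_power2 by (simp add: algebra_simps power2_eq_square)
  have wronskian: "v i * U (Suc i) - U i * v (Suc i) = - U 0" for i
  proof (induction i)
    case (Suc i)
    then show ?case by (simp add: U v algebra_simps)
  qed (simp add: v0)
  have current_v: "current v i \<ge> 0" for i
  proof (induction i)
    case (Suc i)
    then show ?case using current[OF v, of i] z by simp
  qed (simp add: v0 current_def)
  have current_U: "current U (n + k) = current U n + Im z * (\<Sum>i\<in>{n<..n + k}. (cmod (U i))\<^sup>2)" for k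
  proof (induction k)
    case (Suc k)
    have "{n<..n + Suc k} = insert (n + Suc k) {n<..n + k}" by auto
    then show ?case using Suc current[OF U, of "n + k"] by (simp add: algebra_simps)
  qed simp
  have vD: "v (Suc n) = D" by (simp add: v_def D_def)
  define r where "r = v n / D"
  have "U n = r * U (Suc n) + U 0 / D"
    using wronskian[of n] D by (simp add: r_def vD field_simps)
  then have "cnj (U (Suc n)) * U n = r * of_real ((cmod (U (Suc n)))\<^sup>2) + cnj (U (Suc n)) * U 0 / D"
    by (simp add: complex_norm_square[symmetric] algebra_simps)
  moreover have "Im r \<le> 0"
  proof -
    have "Im r = - current v n / (cmod D)\<^sup>2"
      unfolding r_def current_def vD by (simp add: Im_divide cmod_power2)
    then show ?thesis using current_v[of n] by simp
  qed
  ultimately have "Im (cnj (U (Suc n)) * U n) \<le> Im (cnj (U (Suc n)) * U 0 / D)"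
    by (simp add: mult_nonpos_nonneg del: of_real_power)
  also have "\<dots> \<le> cmod (cnj (U (Suc n)) * U 0 / D)"
    by (rule order.trans[OF abs_ge_self abs_Im_le_cmod])
  also have "\<dots> = cmod (U 0) * cmod (U (Suc n)) / cmod D" by (simp add: norm_mult norm_divide)
  finally have bd: "- current U n \<le> cmod (U 0) * cmod (U (Suc n)) / cmod D"
    by (simp add: current_def algebra_simps)
  obtain N where N: "F \<subseteq> {..N}" using F(1) finite_nat_iff_bounded_le by blast
  \<comment> \<open>The current at \<open>n + k\<close> is kept as an error term here and disappears
    in the limit below.\<close>
  have "Im z * (\<Sum>i\<in>F. (cmod (U i))\<^sup>2) \<le> cmod (U 0) * cmod (U (Suc n)) / cmod D + current U (n + k)"
    if "k \<ge> N" for k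
  proof -
    have "Im z * (\<Sum>i\<in>F. (cmod (U i))\<^sup>2) \<le> Im z * (\<Sum>i\<in>{n<..n + k}. (cmod (U i))\<^sup>2)"
      using z that F N by (intro mult_left_mono sum_mono2) force+
    then show ?thesis using bd current_U[of k] by simp
  qed
  moreover have "(\<lambda>k. cmod (U 0) * cmod (U (Suc n)) / cmod D + current U (n + k))
      \<longlonglongrightarrow> cmod (U 0) * cmod (U (Suc n)) / cmod D + Im (cnj 0 * 0)"
    unfolding current_def
    by (intro tendsto_intros) 
      (use LIMSEQ_ignore_initial_segment[OF lim, of n] LIMSEQ_ignore_initial_segment[OF lim, of "Suc n"] in \<open>auto simp: add.commute\<close>)
  ultimately show ?thesis
    using LIMSEQ_le_const[of _ _ "Im z * (\<Sum>i\<in>F. (cmod (U i))\<^sup>2)"] by fastforce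
qed

text \<open>Meant for the vertical sides of the contour, where \<open>Im z\<close> may vanish. The
  diagonal entries have modulus at least 5, so the squares satisfy
  \<open>25 * a (i + 1) \<le> 2 * a (i + 2) + 2 * a i\<close>. Summed over a tail this gives
  \<open>S (n + 1) \<le> (2 / 23) * S n\<close>, and \<open>2 / 23\<close> is below
  \<open>exp (- 1)\<close>.\<close>

lemma jacobi_tail_large_energy:
  fixes U :: "nat \<Rightarrow> complex" and V :: "nat \<Rightarrow> real" and n :: nat
  assumes U: "\<And>i. U (Suc (Suc i)) = (z - of_real (V i)) * U (Suc i) - U i"
    and V: "\<And>i. \<bar>V i\<bar> \<le> B" and z: "B + 5 \<le> cmod z"
    and sm: "summable (\<lambda>i. (cmod (U i))\<^sup>2)"
    and F: "finite F" "F \<subseteq> {n..}"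
  shows "(\<Sum>i\<in>F. (cmod (U i))\<^sup>2) \<le> exp (- real n) * (\<Sum>i. (cmod (U i))\<^sup>2)"
proof -
  define a where "a i = (cmod (U i))\<^sup>2" for i
  define S where "S n = (\<Sum>i. a (i + n))" for n
  have sma: "summable (\<lambda>i. a (i + n))" for n
    using summable_ignore_initial_segment[OF sm] by (simp add: a_def)
  have S_nonneg: "S n \<ge> 0" for n unfolding S_def by (intro suminf_nonneg sma) (simp add: a_def)
  have S_mono: "S (Suc n) \<le> S n" for n
    using suminf_split_head[OF sma, of n] by (simp add: S_def a_def)
  have a: "25 * a (Suc i) \<le> 2 * a (Suc (Suc i)) + 2 * a i" for i
  proof -
    have "5 \<le> cmod (z - of_real (V i))"
      using V[of i] z norm_triangle_ineq2[of z "of_real (V i)"] by simp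
    then have "5 * cmod (U (Suc i)) \<le> cmod ((z - of_real (V i)) * U (Suc i))"
      by (simp add: norm_mult mult_right_mono)
    also have "(z - of_real (V i)) * U (Suc i) = U (Suc (Suc i)) + U i" by (simp add: U)
    also have "cmod \<dots> \<le> cmod (U (Suc (Suc i))) + cmod (U i)" by (rule norm_triangle_ineq)
    finally have "(5 * cmod (U (Suc i)))\<^sup>2 \<le> (cmod (U (Suc (Suc i))) + cmod (U i))\<^sup>2"
      by (intro power_mono) auto
    also have "\<dots> \<le> 2 * a (Suc (Suc i)) + 2 * a i"
      using sum_squares_ge_zero[of "cmod (U (Suc (Suc i))) - cmod (U i)" 0]
      by (simp add: a_def power2_eq_square algebra_simps)
    finally show ?thesis by (simp add: a_def power_mult_distrib)
  qed
  have step: "23 * S (Suc n) \<le> 2 * S n" for n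
  proof -
    have "(\<Sum>i. 25 * a (i + Suc n)) \<le> (\<Sum>i. 2 * a (i + Suc (Suc n)) + 2 * a (i + n))"
      by (intro suminf_le summable_add summable_mult sma) (use a in simp)
    also have "\<dots> = 2 * S (Suc (Suc n)) + 2 * S n"
      unfolding S_def by (simp only: suminf_add[symmetric] suminf_mult summable_mult sma)
    also have "(\<Sum>i. 25 * a (i + Suc n)) = 25 * S (Suc n)"
      unfolding S_def by (rule suminf_mult[OF sma])
    finally show ?thesis using S_mono[of "Suc n"] by simp
  qed
  have "S n \<le> exp (- real n) * S 0"
  proof (induction n)
    case (Suc n)
    have "S (Suc n) \<le> (2 / 23) * S n" using step[of n] by simp
    also have "\<dots> \<le> exp (- 1) * S n"
      using exp_le S_nonneg by (intro mult_right_mono) (auto simp: exp_minus field_simps)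
    also have "\<dots> \<le> exp (- 1) * (exp (- real n) * S 0)" by (intro mult_left_mono Suc) simp
    also have "\<dots> = exp (- real (Suc n)) * S 0" by (simp add: exp_add[symmetric] mult.assoc[symmetric])
    finally show ?case .
  qed simp
  moreover have "(\<Sum>i\<in>F. a i) \<le> S n"
  proof -
    have "(\<Sum>i\<in>F. a i) = (\<Sum>i\<in>(\<lambda>i. i - n) ` F. a (i + n))"
      using F(2) by (subst sum.reindex) (auto simp: inj_on_def subset_iff intro!: sum.cong dest: eq_diff_iff)
    also have "\<dots> \<le> S n"
      unfolding S_def by (intro sum_le_suminf sma) (use F in \<open>auto simp: a_def\<close>)
    finally show ?thesis .
  qed
  ultimately show ?thesis by (simp add: S_def a_def)
qed

section \<open>The resolvent\<close>

locale bounded_potential =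
  fixes V :: "int \<Rightarrow> real" and B :: real
  assumes V_bound: "\<bar>V n\<bar> \<le> B"
begin

abbreviation "H \<equiv> schrodinger V"

definition shifted :: "complex \<Rightarrow> ell2 \<Rightarrow> ell2" where
  "shifted z x = scaleC_ell2 z x - H x"

lemma B_nonneg: "0 \<le> B" using V_bound[of 0] by simp

lemma coord_H: "coord (H x) n = coord x (n + 1) + coord x (n - 1) + of_real (V n) * coord x n"
  by (rule coord_schrodinger[OF V_bound])

lemma norm_H: "norm (H x) \<le> (2 + B) * norm x"
  by (rule norm_schrodinger_le[OF V_bound])

lemmas coord_simps = plus_ell2.rep_eq minus_ell2.rep_eq uminus_ell2.rep_eq scaleC_ell2.rep_eq
  zero_ell2.rep_eq scaleR_ell2.rep_eq

lemma ell2_eqI: "(\<And>n. coord x n = coord y n) \<Longrightarrow> x = y"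
  by (simp add: coord_inject[symmetric] fun_eq_iff)

lemma coord_shifted:
  "coord (shifted z x) n = z * coord x n - coord x (n + 1) - coord x (n - 1) - of_real (V n) * coord x n"
  by (simp add: shifted_def coord_simps coord_H)

lemma shifted_diff: "shifted z (x - y) = shifted z x - shifted z y"
  by (rule ell2_eqI) (simp add: coord_shifted coord_simps algebra_simps)

lemma shifted_scaleC: "shifted z (scaleC_ell2 a x) = scaleC_ell2 a (shifted z x)"
  by (rule ell2_eqI) (simp add: coord_shifted coord_simps algebra_simps)

lemma shifted_change: "shifted z x = shifted w x + scaleC_ell2 (z - w) x"
  by (rule ell2_eqI) (simp add: coord_shifted coord_simps algebra_simps)

lemma norm_shifted_le: "norm (shifted z x) \<le> (cmod z + 2 + B) * norm x"
  using norm_triangle_ineq4[of "scaleC_ell2 z x" "H x"] norm_H[of x]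
  by (simp add: shifted_def norm_scaleC_ell2 algebra_simps)

section \<open>Symmetry of \<open>H\<close> and lower bounds for \<open>z - H\<close>\<close>

lemma sq_summable: "(\<lambda>n. (cmod (coord x n))\<^sup>2) summable_on UNIV"
  using coord[of x] by simp

lemma summable_shift_mult:
  "(\<lambda>n. coord x (n + j) * cnj (coord y n)) summable_on UNIV"
proof -
  have s: "(\<lambda>n. (cmod (coord x (n + j)))\<^sup>2) summable_on UNIV"
    by (rule sq_summable_shift[OF sq_summable])
  then have "coord (Abs_ell2 (\<lambda>n. coord x (n + j))) = (\<lambda>n. coord x (n + j))"
    by (intro Abs_ell2_inverse) simp
  then show ?thesis using summable_cinner[of "Abs_ell2 (\<lambda>n. coord x (n + j))" y] by simp
qed

text \<open>\<open>inner\<close> is the real part of \<open>cinner\<close>, so this says that the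
  complex pairing of \<open>H x\<close> with \<open>x\<close> is real. The potential contributes
  nothing, and the hopping terms become \<open>f (n - 1) - f n\<close>, whose sum vanishes by shift
  invariance.\<close>

lemma inner_H_imaginary: "inner (scaleC_ell2 \<i> (H x)) x = 0"
proof -
  define f where "f n = Im (coord x (n + 1) * cnj (coord x n))" for n
  have f: "f summable_on UNIV" unfolding f_def by (rule summable_on_Im[OF summable_shift_mult])
  have bij: "bij_betw (\<lambda>n. n - 1) UNIV (UNIV :: int set)"
    by (rule bij_betwI[where g = "\<lambda>n. n + 1"]) auto
  have f': "(\<lambda>n. f (n - 1)) summable_on UNIV"
    using summable_on_reindex_bij_betw[OF bij, of f] f by simp
  have "inner (scaleC_ell2 \<i> (H x)) x = (\<Sum>\<^sub>\<infinity>n. f (n - 1) + - f n)"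
    unfolding inner_ell2_eq
    by (rule infsum_cong) (simp add: coord_simps coord_H f_def algebra_simps)
  also have "\<dots> = (\<Sum>\<^sub>\<infinity>n. f (n - 1)) + (\<Sum>\<^sub>\<infinity>n. - f n)"
    by (rule infsum_add[OF f']) (simp add: f summable_on_uminus)
  also have "(\<Sum>\<^sub>\<infinity>n. f (n - 1)) = (\<Sum>\<^sub>\<infinity>n. f n)" by (rule infsum_reindex_bij_betw[OF bij])
  finally show ?thesis by (simp add: infsum_uminus)
qed

lemma inner_scaleC_self: "inner (scaleC_ell2 a x) x = Re a * (norm x)\<^sup>2"
proof -
  have "inner (scaleC_ell2 a x) x = (\<Sum>\<^sub>\<infinity>n. Re a * (cmod (coord x n))\<^sup>2)"
    unfolding inner_ell2_eq
    by (rule infsum_cong, simp add: coord_simps cmod_power2) (simp add: algebra_simps power2_eq_square)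
  then show ?thesis by (simp add: infsum_cmult_right' norm_ell2_sq)
qed

lemma inner_shifted: "inner (scaleC_ell2 \<i> (shifted z x)) x = - Im z * (norm x)\<^sup>2"
proof -
  have "scaleC_ell2 \<i> (shifted z x) = scaleC_ell2 (\<i> * z) x - scaleC_ell2 \<i> (H x)"
    by (rule ell2_eqI) (simp add: coord_simps shifted_def algebra_simps)
  then show ?thesis by (simp add: inner_diff_left inner_scaleC_self inner_H_imaginary)
qed

lemma norm_shifted_ge_Im: "\<bar>Im z\<bar> * norm x \<le> norm (shifted z x)"
proof (cases "x = 0")
  case False
  have "\<bar>Im z\<bar> * norm x * norm x = \<bar>inner (scaleC_ell2 \<i> (shifted z x)) x\<bar>"
    unfolding inner_shifted by (simp add: abs_mult power2_eq_square)
  also have "\<dots> \<le> norm (shifted z x) * norm x"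
    using Cauchy_Schwarz_ineq2[of "scaleC_ell2 \<i> (shifted z x)" x] by (simp add: norm_scaleC_ell2)
  finally show ?thesis using False by simp
qed simp

lemma norm_shifted_ge_norm: "(cmod z - (2 + B)) * norm x \<le> norm (shifted z x)"
  using norm_triangle_ineq2[of "scaleC_ell2 z x" "H x"] norm_H[of x]
  by (simp add: shifted_def norm_scaleC_ell2 algebra_simps)

text \<open>The energies at which \<open>z - H\<close> is bounded below by elementary means: off the
  real axis by symmetry, or beyond the norm bound \<open>2 + B\<close> of \<open>H\<close>. The
  second alternative admits the points where a contour around the spectrum crosses the real
  axis.\<close>

definition regular :: "complex set" where
  "regular = {z. Im z \<noteq> 0 \<or> 2 + B < cmod z}"

lemma open_regular: "open regular"
proof -
  have "regular = {z. Im z \<noteq> 0} \<union> {z. 2 + B < cmod z}" by (auto simp: regular_def)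
  then show ?thesis
    by (simp only:) (intro open_Un open_Collect_neq open_Collect_less continuous_intros)
qed

section \<open>Existence and holomorphy of the resolvent\<close>

lemma shifted_bounded_below:
  assumes "z \<in> regular"
  obtains c where "c > 0" "\<And>x. c * norm x \<le> norm (shifted z x)"
proof (cases "Im z = 0")
  case True
  then show thesis
    using that[of "cmod z - (2 + B)"] norm_shifted_ge_norm[of z] assms by (simp add: regular_def)
qed (use that[of "\<bar>Im z\<bar>"] norm_shifted_ge_Im[of z] in simp)

text \<open>Both cases are contraction arguments. Beyond the norm of \<open>H\<close> the equation
  is iterated as \<open>x = (f + H x) / z\<close>. Off the real axis, \<open>x\<close> is corrected
  by a small multiple of \<open>\<i>\<close> times the residual; the first-order change of the
  squared norm is then negative by \<open>inner_shifted\<close>.\<close>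

lemma shifted_surj:
  assumes "z \<in> regular"
  shows "\<exists>x. shifted z x = f"
proof (cases "Im z = 0")
  case True
  then have z: "2 + B < cmod z" using assms by (simp add: regular_def)
  define \<Phi> where "\<Phi> x = scaleC_ell2 (1 / z) (f + H x)" for x
  have z0: "z \<noteq> 0" using z B_nonneg by auto
  have "dist (\<Phi> x) (\<Phi> y) \<le> (2 + B) / cmod z * dist x y" for x y
  proof -
    have "\<Phi> x - \<Phi> y = scaleC_ell2 (1 / z) (H (x - y))"
      by (rule ell2_eqI) (simp add: \<Phi>_def coord_simps coord_H algebra_simps diff_divide_distrib)
    then have "dist (\<Phi> x) (\<Phi> y) = norm (H (x - y)) / cmod z"
      by (simp add: dist_norm norm_scaleC_ell2 norm_divide)
    also have "\<dots> \<le> (2 + B) * norm (x - y) / cmod z"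
      by (intro divide_right_mono norm_H) simp
    finally show ?thesis by (simp add: dist_norm)
  qed
  then have "\<exists>!x. \<Phi> x = x"
  proof (intro banach_fix_type[of "(2 + B) / cmod z"] allI)
    show "(2 + B) / cmod z < 1"
      using z B_nonneg by (subst divide_less_eq_1_pos) linarith+
  qed (use B_nonneg in auto)
  then obtain x where x: "\<Phi> x = x" by blast
  have "scaleC_ell2 z x = f + H x"
    by (subst x[symmetric], rule ell2_eqI) (simp add: \<Phi>_def coord_simps z0)
  then have "shifted z x = f" by (simp add: shifted_def)
  then show ?thesis by blast
next
  case False
  define L where "L = cmod z + 2 + B"
  have L: "L > 0" "\<bar>Im z\<bar> \<le> L" using B_nonneg abs_Im_le_cmod[of z] by (auto simp: L_def)
  \<comment> \<open>This value minimises
    \<open>1 - 2 * \<tau> * Im z + \<tau>\<^sup>2 * L\<^sup>2\<close>, the bound for the squared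
    contraction factor; the minimum is \<open>c\<^sup>2\<close>.\<close>
  define \<tau> where "\<tau> = Im z / L\<^sup>2"
  have \<tau>0: "\<tau> \<noteq> 0" using False L by (simp add: \<tau>_def)
  define c where "c = sqrt (1 - (Im z)\<^sup>2 / L\<^sup>2)"
  have "(Im z)\<^sup>2 \<le> L\<^sup>2" using L by (simp add: abs_le_square_iff[symmetric])
  then have "(Im z)\<^sup>2 / L\<^sup>2 \<le> 1" "0 < (Im z)\<^sup>2 / L\<^sup>2" using False L by simp_all
  then have c: "0 \<le> c" "c < 1" "c\<^sup>2 = 1 - (Im z)\<^sup>2 / L\<^sup>2"
    unfolding c_def by simp_all
  define \<Phi> where "\<Phi> x = x + scaleC_ell2 (\<i> * of_real \<tau>) (shifted z x - f)" for x
  have "dist (\<Phi> x) (\<Phi> y) \<le> c * dist x y" for x y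
  proof -
    define w where "w = x - y"
    have eq: "\<Phi> x - \<Phi> y = w + \<tau> *\<^sub>R scaleC_ell2 \<i> (shifted z w)"
      by (rule ell2_eqI) (simp add: \<Phi>_def w_def coord_simps coord_shifted algebra_simps)
    have "(norm (\<Phi> x - \<Phi> y))\<^sup>2 = (norm w)\<^sup>2 + 2 * \<tau> * inner (scaleC_ell2 \<i> (shifted z w)) w
        + \<tau>\<^sup>2 * (norm (shifted z w))\<^sup>2"
    proof -
      have "(norm (w + \<tau> *\<^sub>R y))\<^sup>2 = (norm w)\<^sup>2 + 2 * \<tau> * inner y w + \<tau>\<^sup>2 * (norm y)\<^sup>2" for y
      proof -
        have ring: "a + \<tau> * b + \<tau> * (b + \<tau> * c) = a + 2 * \<tau> * b + \<tau>\<^sup>2 * c" for a b c :: real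
          by (simp add: power2_eq_square algebra_simps)
        have "inner (w + \<tau> *\<^sub>R y) (w + \<tau> *\<^sub>R y) =
            inner w w + \<tau> * inner y w + \<tau> * (inner y w + \<tau> * inner y y)"
          by (simp only: inner_add_left inner_add_right inner_scaleR_left inner_scaleR_right
              inner_commute[of w y] distrib_left)
        then show ?thesis unfolding power2_norm_eq_inner ring .
      qed
      from this[of "scaleC_ell2 \<i> (shifted z w)"] show ?thesis
        unfolding eq norm_scaleC_ell2 norm_ii mult_1 .
    qed
    also have "\<dots> \<le> (norm w)\<^sup>2 + 2 * \<tau> * (- Im z * (norm w)\<^sup>2) + \<tau>\<^sup>2 * (L * norm w)\<^sup>2"
    proof -
      have "(norm (shifted z w))\<^sup>2 \<le> (L * norm w)\<^sup>2"
        unfolding L_def by (intro power_mono norm_shifted_le) simp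
      from mult_left_mono[OF this zero_le_power2[of \<tau>]] show ?thesis unfolding inner_shifted by linarith
    qed
    also have "\<dots> = (1 - (Im z)\<^sup>2 / L\<^sup>2) * (norm w)\<^sup>2"
    proof -
      define s where "s = (Im z)\<^sup>2 / L\<^sup>2"
      have s: "\<tau> * Im z = s" "\<tau>\<^sup>2 * L\<^sup>2 = s"
        using L by (simp_all add: \<tau>_def s_def power2_eq_square)
      have "(norm w)\<^sup>2 + 2 * \<tau> * (- Im z * (norm w)\<^sup>2) + \<tau>\<^sup>2 * (L * norm w)\<^sup>2 =
        (norm w)\<^sup>2 - 2 * (\<tau> * Im z) * (norm w)\<^sup>2 + (\<tau>\<^sup>2 * L\<^sup>2) * (norm w)\<^sup>2"
        by (simp only: power_mult_distrib mult_minus_left mult_minus_right mult.assoc diff_conv_add_uminus)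
      also have "\<dots> = (1 - s) * (norm w)\<^sup>2" unfolding s by (simp only: left_diff_distrib)
      finally show ?thesis by (simp only: s_def)
    qed
    also have "\<dots> = (c * norm w)\<^sup>2" unfolding power_mult_distrib c(3) ..
    finally have "norm (\<Phi> x - \<Phi> y) \<le> c * norm w"
      by (rule power2_le_imp_le) (use c(1) in simp)
    then show ?thesis by (simp only: dist_norm w_def)
  qed
  then have "\<exists>!x. \<Phi> x = x" by (intro banach_fix_type[OF c(1,2)] allI)
  then obtain x where "\<Phi> x = x" by blast
  then have "scaleC_ell2 (\<i> * of_real \<tau>) (shifted z x - f) = 0" by (simp add: \<Phi>_def)
  then have "norm (shifted z x - f) = 0"
    using \<tau>0 norm_scaleC_ell2[of "\<i> * of_real \<tau>" "shifted z x - f"] by (simp add: norm_mult)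
  then show ?thesis by auto
qed

text \<open>Meaningful on \<open>regular\<close>, where \<open>shifted_surj\<close> supplies a
  solution and the lower bound on \<open>shifted z\<close> makes it unique.\<close>

definition resolvent :: "complex \<Rightarrow> ell2 \<Rightarrow> ell2" where
  "resolvent z f = (SOME x. shifted z x = f)"

lemma shifted_resolvent: "z \<in> regular \<Longrightarrow> shifted z (resolvent z f) = f"
  unfolding resolvent_def by (rule someI_ex[OF shifted_surj])

lemma norm_resolvent_Im: "Im z \<noteq> 0 \<Longrightarrow> norm (resolvent z f) \<le> norm f / \<bar>Im z\<bar>"
  using norm_shifted_ge_Im[of z "resolvent z f"] shifted_resolvent[of z f]
  by (simp add: regular_def field_simps)

lemma norm_resolvent_large: "2 + B < cmod z \<Longrightarrow> norm (resolvent z f) \<le> norm f / (cmod z - (2 + B))"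
  using norm_shifted_ge_norm[of z "resolvent z f"] shifted_resolvent[of z f]
  by (simp add: regular_def field_simps)

lemma resolvent_recurrence:
  "z \<in> regular \<Longrightarrow> z * coord (resolvent z f) n =
    coord (H (resolvent z f)) n + coord f n"
  using coord_shifted[of z "resolvent z f" n] by (simp add: shifted_resolvent coord_H)

text \<open>The resolvent identity suggests the derivative \<open>Y\<close>, which is minus the
  square of the resolvent at \<open>w\<close> applied to \<open>f\<close>. Applying
  \<open>shifted w\<close> to the differences and dividing by its lower bound \<open>c\<close> shows
  that the remainder is quadratic in \<open>z - w\<close>.\<close>

lemma resolvent_holomorphic: "(\<lambda>z. coord (resolvent z f) n) holomorphic_on regular"
proof (subst holomorphic_on_open[OF open_regular], rule ballI)
  fix w assume w: "w \<in> regular"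
  obtain c where c: "c > 0" "\<And>x. c * norm x \<le> norm (shifted w x)"
    using shifted_bounded_below[OF w] by blast
  define u where "u z = resolvent z f" for z
  define Y where "Y = resolvent w (- u w)"
  have Y: "shifted w Y = - u w" unfolding Y_def by (rule shifted_resolvent[OF w])
  define C where "C = 2 * norm f / c ^ 3"
  have est: "cmod ((coord (u z) n - coord (u w) n) / (z - w) - coord Y n) \<le> C * cmod (z - w)"
    if z: "z \<in> regular" "dist z w < c / 2" "z \<noteq> w" for z
  proof -
    have Tz: "shifted z (u z) = f" "shifted w (u w) = f"
      using z w shifted_resolvent by (auto simp: u_def)
    have eq1: "shifted w (u z) = f - scaleC_ell2 (z - w) (u z)"
      using shifted_change[of z "u z" w] Tz by (simp add: algebra_simps)
    have "c * norm (u z) \<le> norm f + cmod (z - w) * norm (u z)"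
      using c(2)[of "u z"] norm_triangle_ineq4[of f "scaleC_ell2 (z - w) (u z)"]
      by (simp add: eq1 norm_scaleC_ell2)
    also have "\<dots> \<le> norm f + c / 2 * norm (u z)"
      using z by (intro add_left_mono mult_right_mono) (auto simp: dist_norm)
    finally have uz: "norm (u z) \<le> 2 * norm f / c" using c(1) by (simp add: field_simps)
    have "shifted w (u z - u w) = - scaleC_ell2 (z - w) (u z)"
      by (simp add: shifted_diff eq1 Tz)
    then have "c * norm (u z - u w) \<le> cmod (z - w) * norm (u z)"
      using c(2)[of "u z - u w"] by (simp add: norm_scaleC_ell2)
    also have "\<dots> \<le> cmod (z - w) * (2 * norm f / c)" by (intro mult_left_mono uz) simp
    finally have d1: "norm (u z - u w) \<le> cmod (z - w) * (2 * norm f / c) / c"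
      using c(1) by (simp add: field_simps)
    \<comment> \<open>The first-order remainder; it solves an equation whose right-hand side is
      already a product of two small factors.\<close>
    define R where "R = u z - u w - scaleC_ell2 (z - w) Y"
    have "shifted w R = - scaleC_ell2 (z - w) (u z - u w)"
      unfolding R_def shifted_diff shifted_scaleC eq1 Tz Y
      by (rule ell2_eqI) (simp add: coord_simps algebra_simps)
    then have "c * norm R \<le> cmod (z - w) * norm (u z - u w)"
      using c(2)[of R] by (simp add: norm_scaleC_ell2)
    also have "\<dots> \<le> cmod (z - w) * (cmod (z - w) * (2 * norm f / c) / c)"
      by (intro mult_left_mono d1) simp
    finally have "norm R \<le> C * cmod (z - w) * cmod (z - w)"
      using c(1) by (simp add: C_def field_simps power3_eq_cube)
    then have "cmod (coord R n) \<le> C * cmod (z - w) * cmod (z - w)"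
      using coord_le_norm[of R n] by simp
    moreover have "(coord (u z) n - coord (u w) n) / (z - w) - coord Y n = coord R n / (z - w)"
      using z by (simp add: R_def coord_simps field_simps)
    ultimately show ?thesis using z by (simp add: norm_divide field_simps)
  qed
  have "((\<lambda>z. (coord (u z) n - coord (u w) n) / (z - w) - coord Y n) \<longlongrightarrow> 0) (at w)"
  proof (rule Lim_null_comparison)
    have "eventually (\<lambda>z. z \<in> regular) (at w)"
      using open_regular w eventually_at_topological by blast
    moreover have "eventually (\<lambda>z. dist z w < c / 2) (at w)"
      using c(1) eventually_at[of "\<lambda>z. dist z w < c / 2" w UNIV] by (auto intro!: exI[of _ "c / 2"])
    moreover have "eventually (\<lambda>z. z \<noteq> w) (at w)" by (simp add: eventually_at_filter)
    ultimately show "eventually (\<lambda>z. norm ((coord (u z) n - coord (u w) n) / (z - w) - coord Y n) \<le> C * cmod (z - w)) (at w)"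
      by eventually_elim (rule est)
    show "((\<lambda>z. C * cmod (z - w)) \<longlongrightarrow> 0) (at w)"
      by (rule tendsto_eq_intros refl | simp)+
  qed
  then have "((\<lambda>z. coord (u z) n) has_field_derivative coord Y n) (at w)"
    unfolding has_field_derivative_iff using LIM_zero_iff by blast
  then show "\<exists>f'. ((\<lambda>z. coord (resolvent z f) n) has_field_derivative f') (at w)"
    by (auto simp: u_def)
qed

end

section \<open>The propagator as a contour integral\<close>

lemma contour_integral_rectpath_bound:
  assumes f: "continuous_on (path_image (rectpath a b)) f" and ab: "Re a \<le> Re b" "Im a \<le> Im b"
    and M: "\<And>z. z \<in> path_image (rectpath a b) \<Longrightarrow> cmod (f z) \<le> M"
  shows "cmod (contour_integral (rectpath a b) f) \<le> M * (2 * (Re b - Re a) + 2 * (Im b - Im a))"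
proof -
  define a2 where "a2 = Complex (Re b) (Im a)"
  define a4 where "a4 = Complex (Re a) (Im b)"
  have rp: "rectpath a b = linepath a a2 +++ linepath a2 b +++ linepath b a4 +++ linepath a4 a"
    by (simp add: rectpath_def a2_def a4_def Let_def)
  have im: "path_image (rectpath a b) =
    closed_segment a a2 \<union> closed_segment a2 b \<union> closed_segment b a4 \<union> closed_segment a4 a"
    unfolding rp by (simp add: path_image_join Un_assoc)
  have "a \<in> path_image (rectpath a b)" unfolding im by simp
  then have M0: "0 \<le> M" using M norm_ge_zero order.trans by blast
  have int: "f contour_integrable_on linepath x y"
    if "closed_segment x y \<subseteq> path_image (rectpath a b)" for x y
    by (intro contour_integrable_continuous_linepath continuous_on_subset[OF f that])
  have bd: "cmod (contour_integral (linepath x y) f) \<le> M * cmod (y - x)"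
    if "closed_segment x y \<subseteq> path_image (rectpath a b)" for x y
    by (rule contour_integral_bound_linepath[OF int[OF that] M0]) (use M that in auto)
  have "contour_integral (rectpath a b) f = contour_integral (linepath a a2) f +
      (contour_integral (linepath a2 b) f + (contour_integral (linepath b a4) f + contour_integral (linepath a4 a) f))"
    unfolding rp using int im by (subst contour_integral_join | force intro!: contour_integrable_joinI)+
  then have "cmod (contour_integral (rectpath a b) f) \<le> cmod (contour_integral (linepath a a2) f) +
      (cmod (contour_integral (linepath a2 b) f) + (cmod (contour_integral (linepath b a4) f) + cmod (contour_integral (linepath a4 a) f)))"
    by (simp only:) (intro norm_triangle_le add_left_mono order_refl)
  also have "\<dots> \<le> M * cmod (a2 - a) + (M * cmod (b - a2) + (M * cmod (a4 - b) + M * cmod (a - a4)))"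
    by (intro add_mono bd) (auto simp: im)
  also have "\<dots> = M * (2 * (Re b - Re a) + 2 * (Im b - Im a))"
  proof -
    have "a2 - a = of_real (Re b - Re a)" "b - a2 = \<i> * of_real (Im b - Im a)"
      "a4 - b = - of_real (Re b - Re a)" "a - a4 = - (\<i> * of_real (Im b - Im a))"
      by (simp_all add: complex_eq_iff a2_def a4_def)
    then have "cmod (a2 - a) = Re b - Re a" "cmod (b - a2) = Im b - Im a"
      "cmod (a4 - b) = Re b - Re a" "cmod (a - a4) = Im b - Im a"
      using ab by (simp_all only: norm_mult norm_minus_cancel norm_of_real norm_ii) simp_all
    note lens = this
    show ?thesis unfolding lens by (simp add: algebra_simps)
  qed
  finally show ?thesis .
qed

context bounded_potential
begin

lemma coord_funpow_H_sums:
  "(\<lambda>k. (- \<i> * of_real t) ^ k / fact k * coord ((H ^^ k) f) n) sums coord (propagator H t f) n"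
proof -
  have "bounded_linear (\<lambda>x. coord x n)"
    by (rule bounded_linear_intro[where K = 1])
      (auto simp: coord_simps scaleR_conv_of_real coord_le_norm)
  from bounded_linear.sums[OF this propagator_sums[of H "2 + B" t f]] show ?thesis
    using norm_H B_nonneg by (simp add: coord_simps)
qed

text \<open>The half-width \<open>B + 5\<close> exceeds the norm bound \<open>2 + B\<close>, so the
  rectangle winds around the spectrum, and it is the threshold of
  \<open>jacobi_tail_large_energy\<close>. The half-height will be
  \<open>1 / (2 * T)\<close>.\<close>

definition contour :: "real \<Rightarrow> real \<Rightarrow> complex" where
  "contour \<eta> = rectpath (Complex (- (B + 5)) (- \<eta>)) (Complex (B + 5) \<eta>)"

lemma contour_image:
  assumes "\<eta> > 0" "z \<in> path_image (contour \<eta>)"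
  shows "\<bar>Im z\<bar> = \<eta> \<or> \<bar>Re z\<bar> = B + 5" "\<bar>Im z\<bar> \<le> \<eta>" "\<bar>Re z\<bar> \<le> B + 5"
  using assms B_nonneg unfolding contour_def by (auto simp: path_image_rectpath)

lemma contour_scaled_regular:
  assumes "\<eta> > 0" "z \<in> path_image (contour \<eta>)" "s \<ge> 1"
  shows "of_real s * z \<in> regular"
proof (cases "Im z = 0")
  case True
  then have "\<bar>Re z\<bar> = B + 5" using contour_image[OF assms(1,2)] assms(1) by auto
  then have "B + 5 \<le> cmod z" using abs_Re_le_cmod[of z] by simp
  also have "\<dots> \<le> s * cmod z" using mult_right_mono[OF assms(3), of "cmod z"] by simp
  finally show ?thesis using assms(3) by (simp add: regular_def norm_mult)
qed (use assms in \<open>simp add: regular_def\<close>)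

lemma contour_regular: "\<eta> > 0 \<Longrightarrow> path_image (contour \<eta>) \<subseteq> regular"
  using contour_scaled_regular[of \<eta> _ 1] by auto

lemma valid_path_contour: "valid_path (contour \<eta>)"
  by (simp add: contour_def)

lemma closed_contour: "pathfinish (contour \<eta>) = pathstart (contour \<eta>)"
  by (simp add: contour_def)

lemma contour_integrable:
  "\<eta> > 0 \<Longrightarrow> f holomorphic_on regular \<Longrightarrow> f contour_integrable_on contour \<eta>"
  by (rule contour_integrable_holomorphic_simple[OF _ open_regular valid_path_contour contour_regular])

lemma contour_integral_bound:
  assumes "\<eta> > 0" "continuous_on (path_image (contour \<eta>)) f"
    "\<And>z. z \<in> path_image (contour \<eta>) \<Longrightarrow> cmod (f z) \<le> M"
  shows "cmod (contour_integral (contour \<eta>) f) \<le> M * (4 * (B + 5) + 4 * \<eta>)"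
  using contour_integral_rectpath_bound[of "Complex (- (B + 5)) (- \<eta>)" "Complex (B + 5) \<eta>" f M]
    assms B_nonneg by (simp add: contour_def algebra_simps)

lemma zero_not_regular: "0 \<notin> regular"
  using B_nonneg by (simp add: regular_def)

text \<open>Blowing the contour up to infinity, where the resolvent is \<open>1 / z + O(1 / z\<^sup>2)\<close>.\<close>

lemma contour_integral_resolvent:
  assumes \<eta>: "\<eta> > 0"
  shows "contour_integral (contour \<eta>) (\<lambda>z. coord (resolvent z f) n) = 2 * pi * \<i> * coord f n"
proof -
  \<comment> \<open>Subtracting the leading term at infinity leaves \<open>O(1 / z\<^sup>2)\<close>,
    which beats the linear growth of the perimeter.\<close>
  define h where "h z = coord (resolvent z f) n - coord f n / z" for z
  have hol_u: "(\<lambda>z. coord (resolvent z f) n) holomorphic_on regular" by (rule resolvent_holomorphic)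
  have hol_inv: "(\<lambda>z. coord f n / z) holomorphic_on regular"
    using zero_not_regular by (intro holomorphic_intros) auto
  have hol: "h holomorphic_on regular"
    unfolding h_def by (intro holomorphic_intros hol_u hol_inv)
  define a where "a = Complex (- (B + 5)) (- \<eta>)"
  define b where "b = Complex (B + 5) \<eta>"
  define \<gamma> where "\<gamma> s = rectpath (of_real s * a) (of_real s * b)" for s :: real
  have \<gamma>: "\<gamma> s t = of_real s * contour \<eta> t" for s t
    unfolding \<gamma>_def contour_def rectpath_def a_def[symmetric] b_def[symmetric] Let_def joinpaths_def linepath_def
    by (simp add: complex_eq_iff algebra_simps)
  have \<gamma>_image: "path_image (\<gamma> s) = (\<lambda>z. of_real s * z) ` path_image (contour \<eta>)" for s
    unfolding path_image_def by (auto simp: \<gamma>)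
  \<comment> \<open>Dilation by factors of at least 1 moves the contour within
    \<open>regular\<close>, so the integral does not change.\<close>
  have h_int_eq: "contour_integral (contour \<eta>) h = contour_integral (\<gamma> s) h" if s: "s \<ge> 1" for s
  proof (rule Cauchy_theorem_homotopic_loops[OF _ open_regular hol valid_path_contour])
    show "valid_path (\<gamma> s)" by (simp add: \<gamma>_def)
    show "homotopic_loops regular (contour \<eta>) (\<gamma> s)"
    proof (rule homotopic_loops_linear)
      show "path (contour \<eta>)" "path (\<gamma> s)" "pathfinish (contour \<eta>) = pathstart (contour \<eta>)"
        "pathfinish (\<gamma> s) = pathstart (\<gamma> s)"
        by (simp_all add: \<gamma>_def contour_def)
      fix t x :: real assume t: "t \<in> {0..1}"
      show "closed_segment (contour \<eta> t) (\<gamma> s t) \<subseteq> regular"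
      proof
        fix w assume "w \<in> closed_segment (contour \<eta> t) (\<gamma> s t)"
        then obtain v where v: "0 \<le> v" "v \<le> 1" "w = (1 - v) *\<^sub>R contour \<eta> t + v *\<^sub>R \<gamma> s t"
          unfolding closed_segment_def by blast
        then have "w = of_real (1 + v * (s - 1)) * contour \<eta> t"
          by (simp add: \<gamma> scaleR_conv_of_real algebra_simps)
        moreover have "1 + v * (s - 1) \<ge> 1" using v s by simp
        moreover have "contour \<eta> t \<in> path_image (contour \<eta>)" using t by (simp add: path_image_def)
        ultimately show "w \<in> regular" by (metis contour_scaled_regular[OF \<eta>])
      qed
    qed
  qed
  define r where "r = min (B + 5) \<eta>"
  have r: "r > 0" using \<eta> B_nonneg by (simp add: r_def)
  have r_le: "r \<le> cmod z" if "z \<in> path_image (contour \<eta>)" for z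
    using contour_image(1)[OF \<eta> that] abs_Re_le_cmod[of z] abs_Im_le_cmod[of z] by (auto simp: r_def)
  define K where "K = 2 + B"
  have K: "K > 0" using B_nonneg by (simp add: K_def)
  have h_bound: "cmod (h z) \<le> 2 * K * norm f / (cmod z)\<^sup>2" if z: "cmod z \<ge> 2 * K" for z
  proof -
    have reg: "z \<in> regular" using z K by (simp add: regular_def K_def)
    have z0: "z \<noteq> 0" using z K by auto
    \<comment> \<open>The recurrence identifies \<open>z * h z\<close> with a coordinate of
      \<open>H\<close> applied to the resolvent, which itself decays like
      \<open>1 / z\<close>.\<close>
    have "cmod (h z) * cmod z = cmod (coord (H (resolvent z f)) n)"
      using resolvent_recurrence[OF reg, of f n] z0
      unfolding h_def norm_mult[symmetric] by (simp add: algebra_simps)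
    also have "\<dots> \<le> norm (H (resolvent z f))" by (rule coord_le_norm)
    also have "\<dots> \<le> K * norm (resolvent z f)" unfolding K_def by (rule norm_H)
    also have "\<dots> \<le> K * (norm f / (cmod z - K))"
      using norm_resolvent_large[of z f] z K by (intro mult_left_mono) (auto simp: K_def)
    also have "\<dots> \<le> K * (norm f / (cmod z / 2))"
      using z K z0 by (intro mult_left_mono divide_left_mono mult_pos_pos) auto
    finally have "cmod (h z) * cmod z / cmod z \<le> K * (norm f / (cmod z / 2)) / cmod z"
      by (rule divide_right_mono) simp
    then show ?thesis using z0 by (simp add: power2_eq_square mult_ac)
  qed
  define P where "P = 4 * (B + 5) + 4 * \<eta>"
  define I where "I = cmod (contour_integral (contour \<eta>) h)"
  define C where "C = 2 * K * norm f / r\<^sup>2 * P"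
  have bound: "I \<le> C / s" if s: "s \<ge> 1" "s \<ge> 2 * K / r" for s
  proof -
    have img: "cmod z \<ge> s * r" "z \<in> regular" if "z \<in> path_image (\<gamma> s)" for z
    proof -
      have "\<exists>w\<in>path_image (contour \<eta>). z = of_real s * w"
        using that unfolding \<gamma>_image image_iff .
      then obtain w where w: "w \<in> path_image (contour \<eta>)" "z = of_real s * w" ..
      show "cmod z \<ge> s * r" using r_le[OF w(1)] s by (simp add: w norm_mult mult_left_mono)
      show "z \<in> regular" using contour_scaled_regular[OF \<eta> w(1) s(1)] w by simp
    qed
    have "I = cmod (contour_integral (\<gamma> s) h)" unfolding I_def h_int_eq[OF s(1)] ..
    also have "\<dots> \<le> (2 * K * norm f / (s * r)\<^sup>2) *
        (2 * (Re (of_real s * b) - Re (of_real s * a)) + 2 * (Im (of_real s * b) - Im (of_real s * a)))"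
      unfolding \<gamma>_def
    proof (rule contour_integral_rectpath_bound)
      show "continuous_on (path_image (rectpath (of_real s * a) (of_real s * b))) h"
        using img(2) by (intro holomorphic_on_imp_continuous_on holomorphic_on_subset[OF hol]) (auto simp: \<gamma>_def)
      show "Re (of_real s * a) \<le> Re (of_real s * b)" "Im (of_real s * a) \<le> Im (of_real s * b)"
        using s \<eta> B_nonneg by (auto simp: a_def b_def intro!: mult_left_mono)
      fix z assume "z \<in> path_image (rectpath (of_real s * a) (of_real s * b))"
      then have z: "cmod z \<ge> s * r" using img(1) by (simp add: \<gamma>_def)
      have "2 * K \<le> s * r" using s r by (simp add: field_simps)
      then have "cmod (h z) \<le> 2 * K * norm f / (cmod z)\<^sup>2" using z by (intro h_bound) simp
      also have "\<dots> \<le> 2 * K * norm f / (s * r)\<^sup>2"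
      proof -
        have "0 < s * r" using s r by simp
        moreover from this z have "0 < cmod z" by linarith
        ultimately show ?thesis
          using z K s r by (intro divide_left_mono power_mono mult_pos_pos zero_less_power) auto
      qed
      finally show "cmod (h z) \<le> 2 * K * norm f / (s * r)\<^sup>2" .
    qed
    also have "2 * (Re (of_real s * b) - Re (of_real s * a)) + 2 * (Im (of_real s * b) - Im (of_real s * a)) = s * P"
      by (simp add: a_def b_def P_def algebra_simps)
    also have "2 * K * norm f / (s * r)\<^sup>2 * (s * P) = C / s"
      using s r by (simp add: C_def field_simps power2_eq_square)
    finally show ?thesis .
  qed
  have "I \<le> 0"
  proof (rule tendsto_lowerbound)
    show "((\<lambda>s. C / s) \<longlongrightarrow> 0) at_top" by (intro tendsto_divide_0[OF tendsto_const] filterlim_at_top_imp_at_infinity filterlim_ident)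
    show "eventually (\<lambda>s. I \<le> C / s) at_top"
      using eventually_ge_at_top[of 1] eventually_ge_at_top[of "2 * K / r"]
      by eventually_elim (rule bound)
  qed simp
  then have "contour_integral (contour \<eta>) h = 0" by (simp add: I_def)
  moreover have "contour_integral (contour \<eta>) h =
      contour_integral (contour \<eta>) (\<lambda>z. coord (resolvent z f) n) - contour_integral (contour \<eta>) (\<lambda>z. coord f n / z)"
    unfolding h_def by (intro contour_integral_diff contour_integrable \<eta> hol_u hol_inv)
  moreover have "contour_integral (contour \<eta>) (\<lambda>z. coord f n / z) = 2 * pi * \<i> * coord f n"
  proof -
    have nz: "0 \<notin> path_image (contour \<eta>)" using contour_regular[OF \<eta>] zero_not_regular by blast
    have inv: "(\<lambda>z. 1 / (z - 0)) contour_integrable_on contour \<eta>"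
      using zero_not_regular by (intro contour_integrable \<eta> holomorphic_intros) auto
    have "winding_number (contour \<eta>) 0 = 1"
      unfolding contour_def using \<eta> B_nonneg by (intro winding_number_rectpath) (simp add: in_box_complex_iff)
    then have "contour_integral (contour \<eta>) (\<lambda>z. 1 / (z - 0)) = 2 * pi * \<i>"
      using winding_number_valid_path[OF valid_path_contour nz] by (simp add: field_simps)
    then show ?thesis using contour_integral_lmul[OF inv, of "coord f n"] by (simp add: mult_ac)
  qed
  ultimately show ?thesis by simp
qed

text \<open>Multiplying the resolvent by \<open>z\<close> amounts to applying \<open>H\<close> and
  adding \<open>f\<close>; the extra term \<open>z ^ k * coord f n\<close> is entire and integrates
  to 0. Each power of \<open>z\<close> thus becomes one application of \<open>H\<close>.\<close>

lemma contour_integral_moment: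
  assumes \<eta>: "\<eta> > 0"
  shows "contour_integral (contour \<eta>) (\<lambda>z. z ^ k * coord (resolvent z f) n) = 2 * pi * \<i> * coord ((H ^^ k) f) n"
proof (induction k arbitrary: n)
  case 0
  then show ?case using contour_integral_resolvent[OF \<eta>] by simp
next
  case (Suc k)
  define I where "I g = contour_integral (contour \<eta>) g" for g
  define u where "u n z = z ^ k * coord (resolvent z f) n" for n z
  have int: "u n contour_integrable_on contour \<eta>" for n
    unfolding u_def by (intro contour_integrable \<eta> holomorphic_intros resolvent_holomorphic)
  have int_V: "(\<lambda>z. of_real (V n) * u n z) contour_integrable_on contour \<eta>"
    by (intro contour_integrable_lmul int)
  have entire: "((\<lambda>z. z ^ k * coord f n) has_contour_integral 0) (contour \<eta>)"
    by (rule Cauchy_theorem_convex_simple[of _ UNIV])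
      (auto intro!: holomorphic_intros simp: valid_path_contour closed_contour)
  have "I (\<lambda>z. z ^ Suc k * coord (resolvent z f) n) =
      I (\<lambda>z. (u (n + 1) z + u (n - 1) z + of_real (V n) * u n z) + z ^ k * coord f n)"
    unfolding I_def
  proof (rule contour_integral_eq)
    fix z assume "z \<in> path_image (contour \<eta>)"
    then have "z \<in> regular" using contour_regular[OF \<eta>] by blast
    note rec = resolvent_recurrence[OF this, of f n]
    have "z ^ Suc k * coord (resolvent z f) n = z ^ k * (z * coord (resolvent z f) n)"
      by (simp only: power_Suc2 mult.assoc)
    also have "\<dots> = z ^ k * (coord (H (resolvent z f)) n + coord f n)" unfolding rec ..
    finally show "z ^ Suc k * coord (resolvent z f) n =
        u (n + 1) z + u (n - 1) z + of_real (V n) * u n z + z ^ k * coord f n"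
      by (simp add: coord_H u_def algebra_simps)
  qed
  also have "\<dots> = I (u (n + 1)) + I (u (n - 1)) + of_real (V n) * I (u n)"
    unfolding I_def
      contour_integral_add[OF contour_integrable_add[OF contour_integrable_add[OF int int] int_V]
        has_contour_integral_integrable[OF entire]]
      contour_integral_add[OF contour_integrable_add[OF int int] int_V]
      contour_integral_add[OF int int] contour_integral_lmul[OF int] contour_integral_unique[OF entire]
    by simp
  finally have step: "I (\<lambda>z. z ^ Suc k * coord (resolvent z f) n) =
      I (u (n + 1)) + I (u (n - 1)) + of_real (V n) * I (u n)" .
  have IH: "I (u m) = 2 * pi * \<i> * coord ((H ^^ k) f) m" for m
    unfolding I_def u_def by (rule Suc)
  show ?case using step unfolding IH unfolding I_def by (simp add: coord_H distrib_left mult_ac)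
qed

text \<open>The exponential series converges uniformly on the compact contour, where the resolvent
  is bounded, so it may be integrated term by term. The moments reproduce the series of the
  propagator.\<close>

lemma coord_propagator_contour:
  assumes \<eta>: "\<eta> > 0"
  shows "contour_integral (contour \<eta>) (\<lambda>z. exp (- \<i> * of_real t * z) * coord (resolvent z f) n)
    = 2 * pi * \<i> * coord (propagator H t f) n"
proof -
  define \<gamma> where "\<gamma> = contour \<eta>"
  define u where "u z = coord (resolvent z f) n" for z
  define c where "c = - \<i> * complex_of_real t"
  define S where "S m z = (\<Sum>k<m. (c * z) ^ k /\<^sub>R fact k)" for m z
  define A where "A = path_image \<gamma>"
  have hol_u: "u holomorphic_on regular" unfolding u_def by (rule resolvent_holomorphic)
  have A: "A \<subseteq> regular" using contour_regular[OF \<eta>] by (simp add: A_def \<gamma>_def)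
  have "compact A" unfolding A_def \<gamma>_def by (intro compact_path_image valid_path_imp_path valid_path_contour)
  have cont_u: "continuous_on A u"
    by (rule holomorphic_on_imp_continuous_on[OF holomorphic_on_subset[OF hol_u A]])
  obtain U where "U > 0" "\<forall>x\<in>u ` A. cmod x \<le> U"
    using compact_imp_bounded[OF compact_continuous_image[OF cont_u \<open>compact A\<close>]]
    unfolding bounded_pos by (elim exE conjE)
  then have U: "\<And>z. z \<in> A \<Longrightarrow> cmod (u z) \<le> U" "U > 0" by simp_all
  obtain r where "\<forall>z\<in>A. cmod z \<le> r"
    using compact_imp_bounded[OF \<open>compact A\<close>] unfolding bounded_iff by (elim exE)
  then have r: "cmod z \<le> r" if "z \<in> A" for z using that by simp
  have "uniform_limit A S (\<lambda>z. \<Sum>k. (c * z) ^ k /\<^sub>R fact k) sequentially"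
    unfolding S_def
  proof (rule Weierstrass_m_test)
    show "summable (\<lambda>k. (cmod c * r) ^ k /\<^sub>R fact k)" by (rule summable_exp_generic)
    show "norm ((c * z) ^ k /\<^sub>R fact k) \<le> (cmod c * r) ^ k /\<^sub>R fact k" if "z \<in> A" for k z
      using r[OF that] by (simp add: norm_power norm_mult mult_left_mono power_mono divide_right_mono)
  qed
  then have unif: "uniform_limit A S (\<lambda>z. exp (c * z)) sequentially"
    by (simp add: exp_def)
  have hol_e: "(\<lambda>z. exp (c * z) * u z) holomorphic_on regular"
    by (intro holomorphic_intros hol_u)
  have hol_S: "(\<lambda>z. S m z * u z) holomorphic_on regular" for m
    unfolding S_def scaleR_conv_of_real by (intro holomorphic_intros hol_u)
  define L where "L = 4 * (B + 5) + 4 * \<eta>"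
  have L: "L > 0" using \<eta> B_nonneg by (simp add: L_def)
  have "(\<lambda>m. contour_integral \<gamma> (\<lambda>z. S m z * u z)) \<longlonglongrightarrow> contour_integral \<gamma> (\<lambda>z. exp (c * z) * u z)"
  proof (rule metric_LIMSEQ_I)
    fix e :: real assume e: "e > 0"
    define d where "d = e / (2 * U * L)"
    have d: "d > 0" using e U L by (simp add: d_def)
    obtain N where N: "\<And>m z. m \<ge> N \<Longrightarrow> z \<in> A \<Longrightarrow> dist (S m z) (exp (c * z)) < d"
      using uniform_limitD[OF unif d] unfolding eventually_sequentially by blast
    have "dist (contour_integral \<gamma> (\<lambda>z. S m z * u z)) (contour_integral \<gamma> (\<lambda>z. exp (c * z) * u z)) < e"
      if m: "m \<ge> N" for m
    proof -
      have "contour_integral \<gamma> (\<lambda>z. S m z * u z) - contour_integral \<gamma> (\<lambda>z. exp (c * z) * u z) =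
          contour_integral \<gamma> (\<lambda>z. S m z * u z - exp (c * z) * u z)"
        unfolding \<gamma>_def by (intro contour_integral_diff[symmetric] contour_integrable \<eta> hol_e hol_S)
      also have "cmod \<dots> \<le> (d * U) * L"
        unfolding \<gamma>_def L_def
      proof (rule contour_integral_bound[OF \<eta>])
        show "continuous_on (path_image (contour \<eta>)) (\<lambda>z. S m z * u z - exp (c * z) * u z)"
          using contour_regular[OF \<eta>]
          by (intro holomorphic_on_imp_continuous_on holomorphic_on_subset[OF holomorphic_on_diff[OF hol_S hol_e]])
        fix z assume "z \<in> path_image (contour \<eta>)"
        then have z: "z \<in> A" by (simp add: A_def \<gamma>_def)
        have "cmod (S m z * u z - exp (c * z) * u z) = dist (S m z) (exp (c * z)) * cmod (u z)"
          by (simp add: dist_norm norm_mult[symmetric] left_diff_distrib)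
        also have "\<dots> \<le> d * U" using N[OF m z] U(1)[OF z] d by (intro mult_mono) auto
        finally show "cmod (S m z * u z - exp (c * z) * u z) \<le> d * U" .
      qed
      also have "d * U * L = e / 2" using U L by (simp add: d_def)
      finally show ?thesis using e by (simp add: dist_norm)
    qed
    then show "\<exists>N. \<forall>m\<ge>N. dist (contour_integral \<gamma> (\<lambda>z. S m z * u z)) (contour_integral \<gamma> (\<lambda>z. exp (c * z) * u z)) < e"
      by blast
  qed
  moreover have "contour_integral \<gamma> (\<lambda>z. S m z * u z) =
      2 * pi * \<i> * (\<Sum>k<m. c ^ k / fact k * coord ((H ^^ k) f) n)" for m
  proof -
    have hol: "(\<lambda>z. z ^ k * u z) holomorphic_on regular" for k by (intro holomorphic_intros hol_u)
    have "contour_integral \<gamma> (\<lambda>z. S m z * u z) =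
        contour_integral \<gamma> (\<lambda>z. \<Sum>k<m. c ^ k / fact k * (z ^ k * u z))"
      unfolding S_def sum_distrib_right
      by (simp add: scaleR_conv_of_real power_mult_distrib divide_inverse mult_ac)
    also have "\<dots> = (\<Sum>k<m. contour_integral \<gamma> (\<lambda>z. c ^ k / fact k * (z ^ k * u z)))"
      unfolding \<gamma>_def by (intro contour_integral_sum contour_integrable_lmul contour_integrable \<eta> hol) auto
    also have "\<dots> = (\<Sum>k<m. c ^ k / fact k * contour_integral \<gamma> (\<lambda>z. z ^ k * u z))"
      unfolding \<gamma>_def by (intro sum.cong refl contour_integral_lmul contour_integrable \<eta> hol)
    finally show ?thesis
      unfolding \<gamma>_def u_def contour_integral_moment[OF \<eta>] by (simp add: sum_distrib_left mult_ac)
  qed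
  ultimately have "(\<lambda>m. 2 * pi * \<i> * (\<Sum>k<m. c ^ k / fact k * coord ((H ^^ k) f) n))
      \<longlonglongrightarrow> contour_integral \<gamma> (\<lambda>z. exp (c * z) * u z)" by simp
  moreover have "(\<lambda>m. 2 * pi * \<i> * (\<Sum>k<m. c ^ k / fact k * coord ((H ^^ k) f) n))
      \<longlonglongrightarrow> 2 * pi * \<i> * coord (propagator H t f) n"
    using coord_funpow_H_sums[of t f n] unfolding sums_def c_def by (intro tendsto_mult tendsto_const)
  ultimately show ?thesis
    unfolding \<gamma>_def u_def c_def by (rule LIMSEQ_unique)
qed

text \<open>The contour formula is tested against the amplitudes \<open>x n\<close> themselves.
  Cauchy-Schwarz at each contour point then gives a multiple of \<open>sqrt M * sqrt S\<close>, and
  cancelling \<open>sqrt S\<close> yields a bound independent of the size of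
  \<open>F\<close>.\<close>

lemma propagator_mass_bound:
  assumes \<eta>: "\<eta> > 0" and t: "t \<ge> 0" and F: "finite F" and M: "M \<ge> 0"
    and u: "\<And>z. z \<in> path_image (contour \<eta>) \<Longrightarrow> (\<Sum>n\<in>F. (cmod (coord (resolvent z f) n))\<^sup>2) \<le> M"
  shows "(\<Sum>n\<in>F. (cmod (coord (propagator H t f) n))\<^sup>2) \<le> (B + 5 + \<eta>)\<^sup>2 * exp (2 * \<eta> * t) * M"
proof -
  define x where "x n = coord (propagator H t f) n" for n
  define S where "S = (\<Sum>n\<in>F. (cmod (x n))\<^sup>2)"
  have S: "S \<ge> 0" unfolding S_def by (intro sum_nonneg) simp
  define e where "e z = exp (- \<i> * of_real t * z)" for z
  define G where "G z = (\<Sum>n\<in>F. cnj (x n) * (e z * coord (resolvent z f) n))" for z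
  have hol_n: "(\<lambda>z. e z * coord (resolvent z f) n) holomorphic_on regular" for n
    unfolding e_def by (intro holomorphic_intros resolvent_holomorphic)
  have hol: "G holomorphic_on regular" unfolding G_def by (intro holomorphic_intros hol_n)
  have "contour_integral (contour \<eta>) G =
      (\<Sum>n\<in>F. contour_integral (contour \<eta>) (\<lambda>z. cnj (x n) * (e z * coord (resolvent z f) n)))"
    unfolding G_def by (intro contour_integral_sum F contour_integrable_lmul contour_integrable \<eta> hol_n)
  also have "\<dots> = (\<Sum>n\<in>F. cnj (x n) * contour_integral (contour \<eta>) (\<lambda>z. e z * coord (resolvent z f) n))"
    by (intro sum.cong refl contour_integral_lmul contour_integrable \<eta> hol_n)
  also have "\<dots> = 2 * pi * \<i> * of_real S"
    unfolding e_def coord_propagator_contour[OF \<eta>] S_def x_def of_real_sum sum_distrib_left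
    by (intro sum.cong refl) (simp only: complex_norm_square mult_ac)
  finally have "2 * pi * S = cmod (contour_integral (contour \<eta>) G)"
    using S by (simp add: norm_mult)
  also have "\<dots> \<le> (exp (\<eta> * t) * (sqrt M * sqrt S)) * (4 * (B + 5) + 4 * \<eta>)"
  proof (rule contour_integral_bound[OF \<eta>])
    show "continuous_on (path_image (contour \<eta>)) G"
      using contour_regular[OF \<eta>] by (intro holomorphic_on_imp_continuous_on holomorphic_on_subset[OF hol])
    fix z assume z: "z \<in> path_image (contour \<eta>)"
    have "cmod (G z) \<le> (\<Sum>n\<in>F. cmod (e z) * (cmod (coord (resolvent z f) n) * cmod (x n)))"
      unfolding G_def by (rule sum_norm_le) (simp add: norm_mult)
    also have "\<dots> = cmod (e z) * (\<Sum>n\<in>F. cmod (coord (resolvent z f) n) * cmod (x n))"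
      by (simp add: sum_distrib_left)
    also have "\<dots> \<le> exp (\<eta> * t) * (sqrt M * sqrt S)"
    proof (rule mult_mono)
      have "t * Im z \<le> t * \<eta>" using contour_image(2)[OF \<eta> z] t by (intro mult_left_mono) auto
      then show "cmod (e z) \<le> exp (\<eta> * t)" by (simp add: e_def mult.commute)
      have "(\<Sum>n\<in>F. cmod (coord (resolvent z f) n) * cmod (x n)) \<le>
          L2_set (\<lambda>n. cmod (coord (resolvent z f) n)) F * L2_set (\<lambda>n. cmod (x n)) F"
        using L2_set_mult_ineq[of "\<lambda>n. cmod (coord (resolvent z f) n)" "\<lambda>n. cmod (x n)" F] by simp
      also have "\<dots> \<le> sqrt M * sqrt S"
        unfolding L2_set_def S_def using u[OF z] by (intro mult_right_mono) (auto intro: sum_nonneg)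
      finally show "(\<Sum>n\<in>F. cmod (coord (resolvent z f) n) * cmod (x n)) \<le> sqrt M * sqrt S" .
    qed (auto intro: sum_nonneg)
    finally show "cmod (G z) \<le> exp (\<eta> * t) * (sqrt M * sqrt S)" .
  qed
  finally have main: "2 * pi * S \<le> exp (\<eta> * t) * (sqrt M * sqrt S) * (4 * (B + 5) + 4 * \<eta>)" .
  define Q where "Q = (B + 5 + \<eta>) * exp (\<eta> * t) * sqrt M"
  have "sqrt S \<le> Q"
  proof (cases "S = 0")
    case False
    \<comment> \<open>Replacing \<open>2 * pi\<close> by 4 cancels the factor 4 of the perimeter
      \<open>4 * (B + 5 + \<eta>)\<close>.\<close>
    have "4 * S \<le> 2 * pi * S" using pi_ge_two S by (intro mult_right_mono) auto
    also note main
    finally have "sqrt S * sqrt S \<le> Q * sqrt S" using S by (simp add: Q_def algebra_simps)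
    then show ?thesis by (rule mult_right_le_imp_le) (use False S in simp)
  qed (use M B_nonneg \<eta> in \<open>auto simp: Q_def\<close>)
  then have "(sqrt S)\<^sup>2 \<le> Q\<^sup>2" by (intro power_mono) (use S in auto)
  then show ?thesis
    using S M by (simp add: Q_def S_def x_def power_mult_distrib exp_double[symmetric] mult_ac)
qed

end

section \<open>Decay of the resolvent behind a barrier\<close>

text \<open>Within the sites \<open>2, \<dots>, N + 1\<close> some block \<open>[2 + j, 1 + j + n]\<close>, which may depend on the energy, has a
  determinant of size at least \<open>X\<close>. Barriers to the left of site 1 are those of the potential reflected by
  \<open>k \<mapsto> 2 - k\<close>.\<close>

definition barrier :: "(int \<Rightarrow> real) \<Rightarrow> real \<Rightarrow> nat \<Rightarrow> bool" where
  "barrier V X N \<longleftrightarrow> (\<forall>z. \<exists>j n. j + n \<le> N \<and>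
     X \<le> cmod (continuant (\<lambda>i. z - of_real (V (2 + int j + int i))) (Suc n)))"

lemma summable_on_int_half_line:
  fixes f :: "int \<Rightarrow> real"
  assumes f: "f summable_on UNIV" and nonneg: "\<And>k. 0 \<le> f k"
  shows "summable (\<lambda>i. f (a + int i))" "(\<Sum>i. f (a + int i)) \<le> (\<Sum>\<^sub>\<infinity>k. f k)"
proof -
  have le: "(\<Sum>i<m. f (a + int i)) \<le> (\<Sum>\<^sub>\<infinity>k. f k)" for m
  proof -
    have "(\<Sum>i<m. f (a + int i)) = (\<Sum>k\<in>(\<lambda>i. a + int i) ` {..<m}. f k)"
      by (subst sum.reindex) (auto simp: inj_on_def)
    also have "\<dots> \<le> (\<Sum>\<^sub>\<infinity>k. f k)"
      by (rule finite_sum_le_infsum[OF f]) (auto simp: nonneg)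
    finally show ?thesis .
  qed
  show s: "summable (\<lambda>i. f (a + int i))"
    by (rule bounded_imp_summable[of _ "\<Sum>\<^sub>\<infinity>k. f k"]) (use nonneg le[of "Suc _"] in \<open>auto simp: lessThan_Suc_atMost\<close>)
  show "(\<Sum>i. f (a + int i)) \<le> (\<Sum>\<^sub>\<infinity>k. f k)"
    by (rule suminf_le_const[OF s le])
qed

text \<open>The half-plane estimate is applied to the block supplied by the barrier at this very
  \<open>z\<close>; the two boundary values of \<open>u\<close> are each at most
  \<open>sqrt M\<close>.\<close>

lemma right_tail_upper:
  fixes u :: "int \<Rightarrow> complex"
  assumes eq: "\<And>k. k \<ge> 2 \<Longrightarrow> z * u k = u (k + 1) + u (k - 1) + of_real (V k) * u k"
    and sm: "(\<lambda>k. (cmod (u k))\<^sup>2) summable_on UNIV"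
    and M: "(\<Sum>\<^sub>\<infinity>k. (cmod (u k))\<^sup>2) \<le> M" and z: "Im z > 0"
    and X: "X > 0" "barrier V X N"
    and F: "finite F" "F \<subseteq> {int N + 2..}"
  shows "Im z * (\<Sum>k\<in>F. (cmod (u k))\<^sup>2) \<le> M / X"
proof -
  obtain j n where jn: "j + n \<le> N"
    "X \<le> cmod (continuant (\<lambda>i. z - of_real (V (2 + int j + int i))) (Suc n))"
    using X(2) unfolding barrier_def by metis
  define D where "D = continuant (\<lambda>i. z - of_real (V (2 + int j + int i))) (Suc n)"
  \<comment> \<open>Index 0 is the site just left of the block, so the block occupies the indices
    \<open>1\<close> to \<open>n\<close>. Since \<open>j + n \<le> N\<close>, all sites from
    \<open>N + 2\<close> on have index greater than \<open>n\<close>.\<close>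
  define U where "U i = u (1 + int j + int i)" for i
  have U: "U (Suc (Suc i)) = (z - of_real (V (2 + int j + int i))) * U (Suc i) - U i" for i
  proof -
    have "2 + int j + int i \<ge> 2" by simp
    note e = eq[OF this]
    have idx: "2 + int j + int i + 1 = 1 + int j + int (Suc (Suc i))" "2 + int j + int i - 1 = 1 + int j + int i"
      "2 + int j + int i = 1 + int j + int (Suc i)" by simp_all
    from e have "z * U (Suc i) = U (Suc (Suc i)) + U i + of_real (V (2 + int j + int i)) * U (Suc i)"
      unfolding U_def idx(1,2) by (simp add: add.commute add.left_commute)
    then show ?thesis unfolding left_diff_distrib by (simp only: add_diff_cancel_right' add_diff_cancel_left' diff_diff_eq2)
  qed
  have lim: "U \<longlonglongrightarrow> 0"
  proof -
    have "summable (\<lambda>i. (cmod (U i))\<^sup>2)"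
      unfolding U_def by (rule summable_on_int_half_line(1)[OF sm]) simp
    then have "(\<lambda>i. (cmod (U i))\<^sup>2) \<longlonglongrightarrow> 0" by (rule summable_LIMSEQ_zero)
    then have "(\<lambda>i. sqrt ((cmod (U i))\<^sup>2)) \<longlonglongrightarrow> sqrt 0" by (rule tendsto_real_sqrt)
    then show ?thesis by (simp add: tendsto_norm_zero_iff)
  qed
  have u_le: "(cmod (u k))\<^sup>2 \<le> M" for k
    using finite_sum_le_infsum[OF sm, of "{k}"] M by simp
  have M0: "0 \<le> M" using u_le[of 0] by (meson order.trans zero_le_power2)
  have u_le': "cmod (u k) \<le> sqrt M" for k using real_le_rsqrt[OF u_le] .
  define G where "G = (\<lambda>k. nat (k - (1 + int j))) ` F"
  have inj: "inj_on (\<lambda>k. nat (k - (1 + int j))) F"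
    using F(2) jn(1) by (auto simp: inj_on_def subset_iff)
  have "Im z * (\<Sum>i\<in>G. (cmod (U i))\<^sup>2) \<le> cmod (U 0) * cmod (U (Suc n)) / cmod D"
    unfolding D_def
  proof (rule jacobi_tail_upper_half_plane[OF U lim z])
    show "continuant (\<lambda>i. z - of_real (V (2 + int j + int i))) (Suc n) \<noteq> 0" using jn(2) X(1) by auto
    show "finite G" using F(1) by (simp add: G_def)
    show "G \<subseteq> {n<..}" unfolding G_def using F(2) jn(1) by force
  qed
  also have "\<dots> \<le> sqrt M * sqrt M / X"
    unfolding U_def using jn(2) X(1) by (intro frac_le mult_mono u_le') (auto simp: D_def M0)
  finally have "Im z * (\<Sum>i\<in>G. (cmod (U i))\<^sup>2) \<le> M / X" using M0 by simp
  also have "(\<Sum>i\<in>G. (cmod (U i))\<^sup>2) = (\<Sum>k\<in>F. (cmod (u k))\<^sup>2)"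
    unfolding G_def sum.reindex[OF inj] o_def U_def
    using F(2) jn(1) by (intro sum.cong refl) (auto simp: subset_iff intro!: arg_cong[where f = u])
  finally show ?thesis .
qed

text \<open>Covers all four sides of the contour by one bound: the upper side directly, the lower
  side by conjugation, and the remaining points of the vertical sides by the large-energy
  estimate.\<close>

lemma right_tail:
  fixes u :: "int \<Rightarrow> complex"
  assumes eq: "\<And>k. k \<ge> 2 \<Longrightarrow> z * u k = u (k + 1) + u (k - 1) + of_real (V k) * u k"
    and sm: "(\<lambda>k. (cmod (u k))\<^sup>2) summable_on UNIV"
    and M: "(\<Sum>\<^sub>\<infinity>k. (cmod (u k))\<^sup>2) \<le> M"
    and V: "\<And>k. \<bar>V k\<bar> \<le> B"
    and z: "\<bar>Im z\<bar> = \<eta> \<or> B + 5 \<le> cmod z" and \<eta>: "0 < \<eta>" "\<eta> \<le> 1"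
    and n: "n \<le> N" "barrier V (exp (real n)) N"
    and F: "finite F" "F \<subseteq> {int N + 2..}"
  shows "(\<Sum>k\<in>F. (cmod (u k))\<^sup>2) \<le> M * exp (- real n) / \<eta>"
proof (cases "\<bar>Im z\<bar> = \<eta>")
  case True
  have "\<eta> * (\<Sum>k\<in>F. (cmod (u k))\<^sup>2) \<le> M / exp (real n)"
  proof (cases "Im z > 0")
    case True': True
    then have "Im z = \<eta>" using True by simp
    then show ?thesis using right_tail_upper[OF eq sm M True' _ n(2) F] by simp
  next
    case False
    \<comment> \<open>As the potential is real, the conjugate sequence solves the equation at the
      conjugate energy.\<close>
    have eq': "cnj z * cnj (u k) = cnj (u (k + 1)) + cnj (u (k - 1)) + of_real (V k) * cnj (u k)"
      if "k \<ge> 2" for k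
      using arg_cong[OF eq[OF that], of cnj] by simp
    have "Im (cnj z) = \<eta>" using False True by simp
    then show ?thesis
      using right_tail_upper[of "cnj z" "\<lambda>k. cnj (u k)" V M "exp (real n)" N F, OF eq'] sm M \<eta> n F by simp
  qed
  then show ?thesis using \<eta> by (simp add: exp_minus field_simps)
next
  case False
  then have z': "B + 5 \<le> cmod z" using z by simp
  define U where "U i = u (1 + int i)" for i
  have sU: "summable (\<lambda>i. (cmod (U i))\<^sup>2)" "(\<Sum>i. (cmod (U i))\<^sup>2) \<le> M"
    unfolding U_def using summable_on_int_half_line[OF sm, of 1] M by (simp, simp add: order.trans)
  have M0: "0 \<le> M" using suminf_nonneg[OF sU(1)] sU(2) by simp
  have U: "U (Suc (Suc i)) = (z - of_real (V (2 + int i))) * U (Suc i) - U i" for i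
    using eq[of "2 + int i"] by (simp add: U_def algebra_simps)
  define G where "G = (\<lambda>k. nat (k - 1)) ` F"
  have inj: "inj_on (\<lambda>k. nat (k - 1)) F"
    using F(2) by (auto simp: inj_on_def subset_iff)
  have "(\<Sum>k\<in>F. (cmod (u k))\<^sup>2) = (\<Sum>i\<in>G. (cmod (U i))\<^sup>2)"
    unfolding G_def sum.reindex[OF inj] o_def U_def
    using F(2) by (intro sum.cong refl) (auto simp: subset_iff intro!: arg_cong[where f = u])
  also have "\<dots> \<le> exp (- real n) * (\<Sum>i. (cmod (U i))\<^sup>2)"
  proof (rule jacobi_tail_large_energy[OF U V z' sU(1)])
    show "finite G" using F(1) by (simp add: G_def)
    show "G \<subseteq> {n..}" unfolding G_def using F(2) n(1) by force
  qed
  also have "\<dots> \<le> exp (- real n) * M" by (intro mult_left_mono sU) simp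
  \<comment> \<open>Dividing by \<open>\<eta> \<le> 1\<close> only weakens the bound; it is done to
    match the other case.\<close>
  also have "\<dots> \<le> M * exp (- real n) / \<eta>"
    using divide_left_mono[of \<eta> 1 "M * exp (- real n)"] \<eta> M0 by (simp add: mult.commute)
  finally show ?thesis .
qed

lemma norm_delta: "norm (delta m) = 1"
proof -
  have "(norm (delta m))\<^sup>2 = (\<Sum>\<^sub>\<infinity>n. if n = m then 1 else (0 :: real))"
    unfolding norm_ell2_sq by (rule infsum_cong) (simp add: delta.rep_eq)
  also have "\<dots> = (\<Sum>\<^sub>\<infinity>n\<in>{m}. 1 :: real)" by (rule infsum_cong_neutral) auto
  finally have "(norm (delta m))\<^sup>2 = 1\<^sup>2" by simp
  then show ?thesis by (simp only: power2_eq_iff_nonneg norm_ge_zero zero_le_one)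
qed

context bounded_potential
begin

lemma norm_resolvent_contour:
  assumes \<eta>: "0 < \<eta>" "\<eta> \<le> 1" and z: "z \<in> path_image (contour \<eta>)"
  shows "norm (resolvent z (delta m)) \<le> 1 / \<eta>"
proof (cases "\<bar>Im z\<bar> = \<eta>")
  case True
  then show ?thesis using norm_resolvent_Im[of z "delta m"] \<eta> norm_delta by auto
next
  case False
  then have l: "B + 5 \<le> cmod z"
    using contour_image(1)[OF \<eta>(1) z] abs_Re_le_cmod[of z] by auto
  then have "norm (resolvent z (delta m)) \<le> 1 / (cmod z - (2 + B))"
    using norm_resolvent_large[of z "delta m"] norm_delta by simp
  also have "\<dots> \<le> 1 / \<eta>" using l \<eta> by (intro divide_left_mono mult_pos_pos) auto
  finally show ?thesis .
qed

text \<open>The reflection \<open>k \<mapsto> 2 - k\<close> fixes the source site 1 and turns the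
  left tail into a right tail for the reflected potential. Two powers of \<open>1 / \<eta>\<close>
  come from the squared norm of the resolvent, the third from dividing by
  \<open>Im z\<close>.\<close>

lemma resolvent_tail:
  assumes \<eta>: "0 < \<eta>" "\<eta> \<le> 1" and z: "z \<in> path_image (contour \<eta>)"
    and n: "n \<le> N" "barrier V (exp (real n)) N" "barrier (\<lambda>k. V (2 - k)) (exp (real n)) N"
    and F: "finite F" "\<And>k. k \<in> F \<Longrightarrow> int N + 2 \<le> \<bar>k\<bar>"
  shows "(\<Sum>k\<in>F. (cmod (coord (resolvent z (delta 1)) k))\<^sup>2) \<le> 2 * exp (- real n) / \<eta> ^ 3"
proof -
  define u where "u = coord (resolvent z (delta 1))"
  have reg: "z \<in> regular" using contour_regular[OF \<eta>(1)] z by blast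
  have z': "\<bar>Im z\<bar> = \<eta> \<or> B + 5 \<le> cmod z"
    using contour_image(1)[OF \<eta>(1) z] abs_Re_le_cmod[of z] by auto
  have eq: "z * u k = u (k + 1) + u (k - 1) + of_real (V k) * u k" if "k \<noteq> 1" for k
    using resolvent_recurrence[OF reg, of "delta 1" k] that by (simp add: u_def coord_H delta.rep_eq)
  have norm_u: "norm (resolvent z (delta 1)) \<le> 1 / \<eta>"
    by (rule norm_resolvent_contour[OF \<eta> z])
  define M where "M = 1 / \<eta>\<^sup>2"
  have sm: "(\<lambda>k. (cmod (u k))\<^sup>2) summable_on UNIV" unfolding u_def by (rule sq_summable)
  have M: "(\<Sum>\<^sub>\<infinity>k. (cmod (u k))\<^sup>2) \<le> M"
    using power_mono[OF norm_u, of 2] by (simp add: u_def norm_ell2_sq[symmetric] M_def power_divide)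
  have bij: "bij_betw (\<lambda>k. 2 - k) UNIV (UNIV :: int set)"
    by (rule bij_betwI[where g = "\<lambda>k. 2 - k"]) auto
  have sm': "(\<lambda>k. (cmod (u (2 - k)))\<^sup>2) summable_on UNIV"
    using summable_on_reindex_bij_betw[OF bij, of "\<lambda>k. (cmod (u k))\<^sup>2"] sm by simp
  have M': "(\<Sum>\<^sub>\<infinity>k. (cmod (u (2 - k)))\<^sup>2) \<le> M"
    using infsum_reindex_bij_betw[OF bij, of "\<lambda>k. (cmod (u k))\<^sup>2"] M by simp
  have eq': "z * u (2 - k) = u (2 - (k + 1)) + u (2 - (k - 1)) + of_real (V (2 - k)) * u (2 - k)" if "k \<ge> 2" for k
    using eq[of "2 - k"] that by (simp add: algebra_simps)
  define F1 where "F1 = {k \<in> F. k > 0}"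
  define F2 where "F2 = {k \<in> F. k \<le> 0}"
  have r: "(\<Sum>k\<in>F1. (cmod (u k))\<^sup>2) \<le> M * exp (- real n) / \<eta>"
    by (rule right_tail[OF eq sm M V_bound z' \<eta> n(1,2)]) (use F in \<open>force simp: F1_def\<close>)+
  have "(\<Sum>k\<in>F2. (cmod (u k))\<^sup>2) = (\<Sum>k\<in>(\<lambda>k. 2 - k) ` F2. (cmod (u (2 - k)))\<^sup>2)"
    by (subst sum.reindex) (auto simp: inj_on_def)
  also have "\<dots> \<le> M * exp (- real n) / \<eta>"
    by (rule right_tail[where u = "\<lambda>k. u (2 - k)" and V = "\<lambda>k. V (2 - k)", OF eq' sm' M' V_bound z' \<eta> n(1,3)])
      (use F in \<open>force simp: F2_def\<close>)+
  finally have l: "(\<Sum>k\<in>F2. (cmod (u k))\<^sup>2) \<le> M * exp (- real n) / \<eta>" .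
  have "F = F1 \<union> F2" "F1 \<inter> F2 = {}" "finite F1" "finite F2"
    using F(1) by (auto simp: F1_def F2_def)
  then have "(\<Sum>k\<in>F. (cmod (u k))\<^sup>2) = (\<Sum>k\<in>F1. (cmod (u k))\<^sup>2) + (\<Sum>k\<in>F2. (cmod (u k))\<^sup>2)"
    by (simp add: sum.union_disjoint)
  also have "\<dots> \<le> 2 * (M * exp (- real n) / \<eta>)" using r l by simp
  also have "\<dots> = 2 * exp (- real n) / \<eta> ^ 3" by (simp add: M_def power2_eq_square power3_eq_cube)
  finally show ?thesis by (simp add: u_def)
qed

end

section \<open>Time averages\<close>

lemma set_integrable_exp_half_line:
  fixes a :: real
  assumes "a > 0"
  shows "set_integrable lborel {0..} (\<lambda>t. exp (- a * t))" "(LBINT t:{0..}. exp (- a * t)) = 1 / a"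
proof -
  have "((\<lambda>t. exp (- a * t)) has_integral 1 / a) {0..}"
    using has_integral_exp_minus_to_infinity[OF assms, of 0] by simp
  moreover from this have "set_integrable lebesgue {0..} (\<lambda>t. exp (- a * t))"
    by (intro nonnegative_absolutely_integrable_1) auto
  then show s: "set_integrable lborel {0..} (\<lambda>t. exp (- a * t))"
    unfolding set_integrable_def
    by (subst integrable_completion[symmetric])
      (auto intro!: borel_measurable_continuous_on_indicator continuous_intros simp: measurable_lborel1)
  ultimately show "(LBINT t:{0..}. exp (- a * t)) = 1 / a"
    by (simp add: set_borel_integral_eq_integral integral_unique)
qed

context bounded_potential
begin

abbreviation amplitude :: "int \<Rightarrow> real \<Rightarrow> complex" where
  "amplitude n t \<equiv> coord (propagator H t (delta 1)) n"

lemma time_avg_eq: "time_avg H n T = 2 / T * (LBINT t:{0..}. exp (- 2 * t / T) * (cmod (amplitude n t))\<^sup>2)"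
proof -
  have "cinner x (delta n) = coord x n" for x
  proof -
    have "cinner x (delta n) = (\<Sum>\<^sub>\<infinity>k\<in>{n}. coord x k)"
      unfolding cinner.rep_eq by (rule infsum_cong_neutral) (auto simp: delta.rep_eq)
    then show ?thesis by simp
  qed
  then show ?thesis by (simp add: time_avg_def)
qed

lemma time_avg_nonneg: "T > 0 \<Longrightarrow> 0 \<le> time_avg H n T"
  unfolding time_avg_eq set_lebesgue_integral_def by (intro mult_nonneg_nonneg integral_nonneg) auto

section \<open>Regularity and integrability of the amplitudes in time\<close>

lemma isCont_amplitude: "isCont (amplitude n) t"
proof -
  define a where "a k = (- \<i>) ^ k / fact k * coord ((H ^^ k) (delta 1)) n" for k
  have sums: "(\<lambda>k. a k * (of_real t) ^ k) sums amplitude n t" for t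
    using coord_funpow_H_sums[of t "delta 1" n] unfolding a_def power_mult_distrib by (simp add: mult_ac)
  have eq: "amplitude n = (\<lambda>t. \<Sum>k. a k * (of_real t) ^ k)"
    using sums by (simp add: fun_eq_iff sums_iff)
  have "isCont (\<lambda>w. \<Sum>k. a k * w ^ k) (of_real t :: complex)"
    by (rule isCont_powser[of _ "of_real (\<bar>t\<bar> + 1)"])
      (use sums[of "\<bar>t\<bar> + 1"] in \<open>auto simp: sums_iff\<close>)
  then show ?thesis unfolding eq
    by (rule isCont_o2[rotated]) (simp add: continuous_intros)
qed

lemma continuous_amplitude: "continuous_on A (amplitude n)"
  by (intro continuous_at_imp_continuous_on ballI isCont_amplitude)

lemma amplitude_0: "amplitude 1 0 = 1"
proof -
  have "(\<lambda>k. (- \<i> * of_real 0) ^ k / fact k * coord ((H ^^ k) (delta 1)) 1) sums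
      ((- \<i> * of_real 0) ^ 0 / fact 0 * coord ((H ^^ 0) (delta 1)) 1)"
    using sums_single[of 0 "\<lambda>k. (- \<i> * of_real 0) ^ k / fact k * coord ((H ^^ k) (delta 1)) 1"]
    by (rule back_subst[of "\<lambda>f. f sums _"]) (auto simp: fun_eq_iff)
  then show ?thesis
    using sums_unique2[OF coord_funpow_H_sums[of 0 "delta 1" 1]] by (simp add: delta.rep_eq)
qed

lemma integrable_amplitude:
  assumes T: "T > 0" and K: "\<And>t. t \<ge> 0 \<Longrightarrow> (cmod (amplitude n t))\<^sup>2 \<le> K * exp (t / T)"
  shows "set_integrable lborel {0..} (\<lambda>t. exp (- 2 * t / T) * (cmod (amplitude n t))\<^sup>2)"
proof (rule set_integrable_bound)
  show "set_integrable lborel {0..} (\<lambda>t. K * exp (- (1 / T) * t))"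
    using T by (intro set_integrable_mult_right set_integrable_exp_half_line) simp
  show "set_borel_measurable lborel {0..} (\<lambda>t. exp (- 2 * t / T) * (cmod (amplitude n t))\<^sup>2)"
    unfolding set_borel_measurable_def measurable_lborel2
    using T by (intro borel_measurable_continuous_on_indicator continuous_intros continuous_amplitude) auto
  show "AE t in lborel. t \<in> {0..} \<longrightarrow> norm (exp (- 2 * t / T) * (cmod (amplitude n t))\<^sup>2) \<le> norm (K * exp (- (1 / T) * t))"
  proof (intro AE_I2 impI)
    fix t :: real assume "t \<in> {0..}"
    then have "exp (- 2 * t / T) * (cmod (amplitude n t))\<^sup>2 \<le> exp (- 2 * t / T) * (K * exp (t / T))"
      by (intro mult_left_mono K) auto
    also have "\<dots> = K * exp (- (1 / T) * t)"
      by (simp add: exp_add[symmetric] mult.left_commute)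
    finally show "norm (exp (- 2 * t / T) * (cmod (amplitude n t))\<^sup>2) \<le> norm (K * exp (- (1 / T) * t))"
      by simp
  qed
qed

text \<open>A crude bound, for integrability only: the contour estimate for a single site, with
  height \<open>1 / (2 * T)\<close>.\<close>

lemma amplitude_bound:
  assumes T: "T \<ge> 1" and t: "t \<ge> 0"
  shows "(cmod (amplitude n t))\<^sup>2 \<le> ((B + 5 + 1 / (2 * T))\<^sup>2 * (2 * T)\<^sup>2) * exp (t / T)"
proof -
  define \<eta> where "\<eta> = 1 / (2 * T)"
  have \<eta>: "0 < \<eta>" "\<eta> \<le> 1" using T by (auto simp: \<eta>_def)
  have "(\<Sum>n\<in>{n}. (cmod (amplitude n t))\<^sup>2) \<le> (B + 5 + \<eta>)\<^sup>2 * exp (2 * \<eta> * t) * (1 / \<eta>)\<^sup>2"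
  proof (rule propagator_mass_bound[OF \<eta>(1) t])
    fix z assume "z \<in> path_image (contour \<eta>)"
    then have "cmod (coord (resolvent z (delta 1)) n) \<le> 1 / \<eta>"
      using norm_resolvent_contour[OF \<eta>] coord_le_norm order.trans by blast
    then show "(\<Sum>n\<in>{n}. (cmod (coord (resolvent z (delta 1)) n))\<^sup>2) \<le> (1 / \<eta>)\<^sup>2"
      by (simp only: sum.insert finite.emptyI empty_iff sum.empty add_0_right not_False_eq_True) (rule power_mono, auto)
  qed auto
  then show ?thesis by (simp add: \<eta>_def mult_ac)
qed

text \<open>The allowed growth \<open>exp (t / T)\<close> has half the rate of the damping, so the
  integral is at most \<open>K * T\<close> and the prefactor \<open>2 / T\<close> leaves
  \<open>2 * K\<close>.\<close>

lemma sum_time_avg_le: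
  assumes T: "T > 0" and F: "finite F"
    and K: "\<And>t. t \<ge> 0 \<Longrightarrow> (\<Sum>n\<in>F. (cmod (amplitude n t))\<^sup>2) \<le> K * exp (t / T)"
  shows "(\<Sum>n\<in>F. time_avg H n T) \<le> 2 * K"
proof -
  have K1: "(cmod (amplitude n t))\<^sup>2 \<le> K * exp (t / T)" if "t \<ge> 0" "n \<in> F" for n t
    using member_le_sum[OF that(2) _ F, of "\<lambda>n. (cmod (amplitude n t))\<^sup>2"] K[OF that(1)] by simp
  define f where "f n t = exp (- 2 * t / T) * (cmod (amplitude n t))\<^sup>2" for n t
  have int: "set_integrable lborel {0..} (f n)" if "n \<in> F" for n
    unfolding f_def using K1 that by (intro integrable_amplitude[OF T])
  have "(\<Sum>n\<in>F. time_avg H n T) = 2 / T * (\<Sum>n\<in>F. LBINT t:{0..}. f n t)"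
    unfolding time_avg_eq sum_distrib_left f_def ..
  also have "(\<Sum>n\<in>F. LBINT t:{0..}. f n t) = (LBINT t:{0..}. (\<Sum>n\<in>F. f n t))"
    unfolding set_lebesgue_integral_def scaleR_sum_right
    by (rule Bochner_Integration.integral_sum[symmetric]) (use int in \<open>simp add: set_integrable_def\<close>)
  also have "\<dots> \<le> (LBINT t:{0..}. K * exp (- (1 / T) * t))"
  proof (rule set_integral_mono)
    show "set_integrable lborel {0..} (\<lambda>t. \<Sum>n\<in>F. f n t)"
      unfolding set_integrable_def scaleR_sum_right
      by (rule Bochner_Integration.integrable_sum) (use int in \<open>simp add: set_integrable_def\<close>)
    show "set_integrable lborel {0..} (\<lambda>t. K * exp (- (1 / T) * t))"
      using T by (intro set_integrable_mult_right set_integrable_exp_half_line) simp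
    fix t :: real assume "t \<in> {0..}"
    then have "(\<Sum>n\<in>F. f n t) \<le> exp (- 2 * t / T) * (K * exp (t / T))"
      unfolding f_def sum_distrib_left[symmetric] by (intro mult_left_mono K) auto
    also have "\<dots> = K * exp (- (1 / T) * t)"
      by (simp add: exp_add[symmetric] mult.left_commute)
    finally show "(\<Sum>n\<in>F. f n t) \<le> K * exp (- (1 / T) * t)" .
  qed
  also have "\<dots> = K * T"
    using set_integrable_exp_half_line(2)[of "1 / T"] T by (simp add: set_integral_mult_right)
  finally show ?thesis using T by (simp add: mult_left_mono field_simps)
qed

text \<open>The height \<open>\<eta> = 1 / (2 * T)\<close> makes the growth
  \<open>exp (2 * \<eta> * t)\<close> of the contour estimate equal to
  \<open>exp (t / T)\<close>.\<close>

lemma sum_time_avg_resolvent: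
  assumes T: "T \<ge> 1" and F: "finite F" and M: "M \<ge> 0"
    and u: "\<And>z. z \<in> path_image (contour (1 / (2 * T))) \<Longrightarrow>
      (\<Sum>n\<in>F. (cmod (coord (resolvent z (delta 1)) n))\<^sup>2) \<le> M"
  shows "(\<Sum>n\<in>F. time_avg H n T) \<le> 2 * (B + 6)\<^sup>2 * M"
proof -
  define \<eta> where "\<eta> = 1 / (2 * T)"
  have \<eta>: "0 < \<eta>" "\<eta> \<le> 1" using T by (auto simp: \<eta>_def)
  have "(\<Sum>n\<in>F. (cmod (amplitude n t))\<^sup>2) \<le> ((B + 6)\<^sup>2 * M) * exp (t / T)" if "t \<ge> 0" for t
  proof -
    have "(\<Sum>n\<in>F. (cmod (amplitude n t))\<^sup>2) \<le> (B + 5 + \<eta>)\<^sup>2 * exp (2 * \<eta> * t) * M"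
      by (rule propagator_mass_bound[OF \<eta>(1) that F M]) (use u in \<open>simp add: \<eta>_def\<close>)
    also have "\<dots> \<le> (B + 6)\<^sup>2 * exp (2 * \<eta> * t) * M"
      using \<eta> B_nonneg M by (intro mult_right_mono power_mono) auto
    also have "2 * \<eta> * t = t / T" by (simp add: \<eta>_def)
    finally show ?thesis by (simp add: mult_ac)
  qed
  from sum_time_avg_le[OF _ F this] T show ?thesis by simp
qed

lemma outside_prob_le:
  assumes T: "T > 0" and M: "0 \<le> M"
    and F: "\<And>F. finite F \<Longrightarrow> F \<subseteq> {n. N < ereal \<bar>real_of_int n\<bar>} \<Longrightarrow> (\<Sum>n\<in>F. time_avg H n T) \<le> M"
  shows "outside_prob H N T \<le> M"
proof (cases "(\<lambda>n. time_avg H n T) summable_on {n. N < ereal \<bar>real_of_int n\<bar>}")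
  case True
  then show ?thesis unfolding outside_prob_def by (rule infsum_le_finite_sums) (use F in auto)
\<comment> \<open>A non-summable family has \<open>infsum\<close> equal to 0, which is where
  \<open>0 \<le> M\<close> enters.\<close>
qed (use M in \<open>simp add: outside_prob_def infsum_not_exists\<close>)

lemma outside_prob_nonneg: "T > 0 \<Longrightarrow> 0 \<le> outside_prob H N T"
  unfolding outside_prob_def by (intro infsum_nonneg time_avg_nonneg)

lemma outside_prob_barrier:
  assumes T: "T \<ge> 1" and n: "n \<le> N" "barrier V (exp (real n)) N" "barrier (\<lambda>k. V (2 - k)) (exp (real n)) N"
    and R: "real N + 2 \<le> R"
  shows "outside_prob H (ereal R) T \<le> 32 * (B + 6)\<^sup>2 * T ^ 3 * exp (- real n)"
proof (rule outside_prob_le)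
  fix F assume F: "finite F" "F \<subseteq> {n. ereal R < ereal \<bar>real_of_int n\<bar>}"
  define \<eta> where "\<eta> = 1 / (2 * T)"
  have \<eta>: "0 < \<eta>" "\<eta> \<le> 1" using T by (auto simp: \<eta>_def)
  have F': "int N + 2 \<le> \<bar>k\<bar>" if "k \<in> F" for k
  proof -
    have "real_of_int (int N + 2) \<le> real_of_int \<bar>k\<bar>" using F(2) that R by auto
    then show ?thesis by (simp only: of_int_le_iff)
  qed
  have "(\<Sum>n\<in>F. time_avg H n T) \<le> 2 * (B + 6)\<^sup>2 * (2 * exp (- real n) / \<eta> ^ 3)"
    by (rule sum_time_avg_resolvent[OF T F(1)])
      (use \<eta> resolvent_tail[OF \<eta> _ n F(1) F'] in \<open>auto simp: \<eta>_def\<close>)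
  also have "\<dots> = 32 * (B + 6)\<^sup>2 * T ^ 3 * exp (- real n)"
    using T by (simp add: \<eta>_def power3_eq_cube)
  finally show "(\<Sum>n\<in>F. time_avg H n T) \<le> 32 * (B + 6)\<^sup>2 * T ^ 3 * exp (- real n)" .
qed (use T in auto)

text \<open>Needed for lower bounds on \<open>outside_prob\<close>, since the infinite sum of a
  non-summable family would be 0. The finite sums are bounded by the norm of the resolvent on the
  contour.\<close>

lemma summable_time_avg:
  assumes T: "T \<ge> 1"
  shows "(\<lambda>n. time_avg H n T) summable_on A"
proof -
  have "(\<Sum>n\<in>F. time_avg H n T) \<le> 2 * (B + 6)\<^sup>2 * (2 * T)\<^sup>2" if F: "finite F" for F
  proof (rule sum_time_avg_resolvent[OF T F])
    fix z assume z: "z \<in> path_image (contour (1 / (2 * T)))"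
    then have "norm (resolvent z (delta 1)) \<le> 2 * T"
      using norm_resolvent_contour[OF _ _ z, of 1] T by simp
    then have "(norm (resolvent z (delta 1)))\<^sup>2 \<le> (2 * T)\<^sup>2" by (intro power_mono) auto
    then show "(\<Sum>n\<in>F. (cmod (coord (resolvent z (delta 1)) n))\<^sup>2) \<le> (2 * T)\<^sup>2"
      using sum_coord_le_norm[OF F] order.trans by blast
  qed simp
  note fin = this
  show ?thesis
    by (rule nonneg_bdd_above_summable_on)
      (use T fin in \<open>auto intro!: time_avg_nonneg bdd_aboveI\<close>)
qed

text \<open>The amplitude at site 1 equals 1 at time 0 and stays above 1/2 for a short time
  \<open>\<tau>\<close> that does not depend on \<open>T\<close>, so its time average is at least a
  multiple of \<open>1 / T\<close>. The radius -1 is \<open>cutoff 0 T\<close> and excludes no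
  site.\<close>

lemma outside_prob_all_lower_bound:
  obtains c where "c > 0" "\<And>T. T \<ge> 1 \<Longrightarrow> c / T \<le> outside_prob H (ereal (- 1)) T"
proof -
  have "isCont (\<lambda>t. cmod (amplitude 1 t)) 0" by (intro continuous_intros isCont_amplitude)
  then have "((\<lambda>t. cmod (amplitude 1 t)) \<longlongrightarrow> 1) (at 0)"
    unfolding isCont_def by (simp add: amplitude_0)
  then have "eventually (\<lambda>t. 1 / 2 < cmod (amplitude 1 t)) (at 0)"
    by (rule order_tendstoD) simp
  then obtain d where d: "d > 0" "\<And>t. t \<noteq> 0 \<Longrightarrow> dist t 0 < d \<Longrightarrow> 1 / 2 < cmod (amplitude 1 t)"
    unfolding eventually_at by auto
  define \<tau> where "\<tau> = min (d / 2) 1"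
  have \<tau>: "0 < \<tau>" "\<tau> \<le> 1" "\<tau> < d" using d(1) by (auto simp: \<tau>_def)
  have amp: "1 / 2 \<le> cmod (amplitude 1 t)" if "t \<in> {0..\<tau>}" for t
    using d(2)[of t] that \<tau> amplitude_0 by (cases "t = 0") (auto simp: dist_real_def)
  define c where "c = \<tau> * exp (- 2) / 2"
  have "c / T \<le> outside_prob H (ereal (- 1)) T" if T: "T \<ge> 1" for T
  proof -
    define f where "f t = exp (- 2 * t / T) * (cmod (amplitude 1 t))\<^sup>2" for t
    have sm: "(\<lambda>n. time_avg H n T) summable_on UNIV" by (rule summable_time_avg[OF T])
    have int: "set_integrable lborel {0..} f"
      unfolding f_def using T by (intro integrable_amplitude[OF _ amplitude_bound[OF T]]) auto
    have "\<tau> * (exp (- 2) / 4) = (LBINT t:{0..\<tau>}. exp (- 2) / 4)"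
      using \<tau> by (simp add: set_lebesgue_integral_def)
    also have "\<dots> \<le> (LBINT t:{0..}. f t)"
      unfolding set_lebesgue_integral_def
    proof (rule integral_mono)
      show "integrable lborel (\<lambda>t. indicator {0..\<tau>} t *\<^sub>R (exp (- 2) / 4 :: real))"
        using \<tau> by (intro integrable_scaleR_left integrable_real_indicator) auto
      show "integrable lborel (\<lambda>t. indicator {0..} t *\<^sub>R f t)" using int by (simp add: set_integrable_def)
      fix t :: real
      show "indicator {0..\<tau>} t *\<^sub>R (exp (- 2) / 4) \<le> indicator {0..} t *\<^sub>R f t"
      proof (cases "t \<in> {0..\<tau>}")
        case True
        have "t \<le> T" using True \<tau> T by auto
        then have "exp (- 2) \<le> exp (- 2 * t / T)" using T by (simp add: field_simps)
        moreover have "(1 / 2)\<^sup>2 \<le> (cmod (amplitude 1 t))\<^sup>2" using amp[OF True] by (intro power_mono) auto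
        ultimately have "exp (- 2) * (1 / 2)\<^sup>2 \<le> f t" unfolding f_def by (intro mult_mono) auto
        then show ?thesis using True by (simp add: power2_eq_square)
      qed (auto simp: f_def indicator_def)
    qed
    finally have "2 / T * (\<tau> * (exp (- 2) / 4)) \<le> time_avg H 1 T"
      unfolding time_avg_eq f_def using T by (intro mult_left_mono) auto
    also have "time_avg H 1 T \<le> (\<Sum>\<^sub>\<infinity>n. time_avg H n T)"
      using finite_sum_le_infsum[OF sm, of "{1}"] time_avg_nonneg T by simp
    also have "(\<Sum>\<^sub>\<infinity>n. time_avg H n T) = outside_prob H (ereal (- 1)) T"
      unfolding outside_prob_def by (rule infsum_cong_neutral) auto
    finally show ?thesis by (simp add: c_def)
  qed
  moreover have "c > 0" using \<tau> by (simp add: c_def)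
  ultimately show thesis using that by blast
qed

end

section \<open>Convergents of an irrational number\<close>

text \<open>The continued fraction with an arbitrary real last entry \<open>y\<close>: a complete
  quotient as \<open>y\<close> recovers \<open>\<theta>\<close>, a partial quotient gives a
  convergent.\<close>

fun cf_eval :: "int list \<Rightarrow> real \<Rightarrow> real" where
  "cf_eval [] y = y"
| "cf_eval (a # as) y = of_int a + 1 / cf_eval as y"

lemma cf_eval_snoc: "cf_eval (as @ [a]) y = cf_eval as (of_int a + 1 / y)"
  by (induction as) auto

lemma of_rat_cont_frac: "of_rat (cont_frac (as @ [a])) = cf_eval as (of_int a)"
proof (induction as)
  case (Cons b as)
  have "cont_frac (b # (as @ [a])) = of_int b + 1 / cont_frac (as @ [a])"
    by (cases "as @ [a]") auto
  then show ?case using Cons by (simp add: of_rat_add of_rat_divide)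
qed simp

text \<open>Numerators and denominators of the convergents, shifted by two: \<open>p\<^sub>k = cf_num \<theta> (k + 2)\<close>.\<close>

fun cf_num :: "real \<Rightarrow> nat \<Rightarrow> int" where
  "cf_num \<theta> 0 = 0"
| "cf_num \<theta> (Suc 0) = 1"
| "cf_num \<theta> (Suc (Suc k)) = partial_quotient \<theta> k * cf_num \<theta> (Suc k) + cf_num \<theta> k"

fun cf_den :: "real \<Rightarrow> nat \<Rightarrow> int" where
  "cf_den \<theta> 0 = 1"
| "cf_den \<theta> (Suc 0) = 0"
| "cf_den \<theta> (Suc (Suc k)) = partial_quotient \<theta> k * cf_den \<theta> (Suc k) + cf_den \<theta> k"

section \<open>Determinant identity and growth of the denominators\<close>

lemma cf_det: "cf_num \<theta> (Suc k) * cf_den \<theta> k - cf_num \<theta> k * cf_den \<theta> (Suc k) = (- 1) ^ k"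
proof (induction k)
  case (Suc k)
  then show ?case by (simp add: algebra_simps)
qed simp

lemma complete_quotient_irrational: "\<theta> \<notin> \<rat> \<Longrightarrow> complete_quotient \<theta> k \<notin> \<rat>"
proof (induction k)
  case (Suc k)
  then have "frac (complete_quotient \<theta> k) \<notin> \<rat>"
    by (metis Rats_add Rats_of_int add.commute diff_add_cancel frac_def)
  then show ?case
    by (metis Rats_1 Rats_divide complete_quotient.simps(2) div_by_1 divide_divide_eq_right mult_1)
qed simp

lemma complete_quotient_step:
  assumes "\<theta> \<notin> \<rat>"
  shows "complete_quotient \<theta> k = of_int (partial_quotient \<theta> k) + 1 / complete_quotient \<theta> (Suc k)"
    and "complete_quotient \<theta> (Suc k) > 1"
proof -
  have "frac (complete_quotient \<theta> k) \<noteq> 0"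
    using complete_quotient_irrational[OF assms, of k] by (metis Ints_subset_Rats frac_eq_0_iff subsetD)
  then have "0 < frac (complete_quotient \<theta> k)" "frac (complete_quotient \<theta> k) < 1"
    using frac_ge_0[of "complete_quotient \<theta> k"] frac_lt_1[of "complete_quotient \<theta> k"] by auto
  then show "complete_quotient \<theta> (Suc k) > 1" by simp
  show "complete_quotient \<theta> k = of_int (partial_quotient \<theta> k) + 1 / complete_quotient \<theta> (Suc k)"
    by (simp add: partial_quotient_def frac_def)
qed

lemma partial_quotient_pos: "\<theta> \<notin> \<rat> \<Longrightarrow> partial_quotient \<theta> (Suc k) \<ge> 1"
  using complete_quotient_step(2)[of \<theta> k] unfolding partial_quotient_def by linarith

lemma cf_den_pos:
  assumes "\<theta> \<notin> \<rat>"
  shows "cf_den \<theta> (Suc k) \<ge> 0 \<and> cf_den \<theta> (Suc (Suc k)) \<ge> 1"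
proof (induction k)
  case (Suc k)
  have "partial_quotient \<theta> (Suc k) * cf_den \<theta> (Suc (Suc k)) \<ge> 1 * cf_den \<theta> (Suc (Suc k))"
    using Suc by (intro mult_right_mono partial_quotient_pos assms) linarith
  then show ?case unfolding cf_den.simps(3)[of \<theta> "Suc k"] using Suc by linarith
qed simp

lemma cf_den_ge:
  assumes "\<theta> \<notin> \<rat>"
  shows "cf_den \<theta> (Suc (Suc k)) \<ge> int k"
proof (induction k rule: induct_nat_012)
  case 1
  show ?case using cf_den_pos[OF assms, of "Suc 0"] unfolding of_nat_Suc by linarith
next
  case (ge2 k)
  have "partial_quotient \<theta> (Suc (Suc k)) * cf_den \<theta> (Suc (Suc (Suc k))) \<ge> 1 * cf_den \<theta> (Suc (Suc (Suc k)))"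
    using cf_den_pos[OF assms, of "Suc k"] by (intro mult_right_mono partial_quotient_pos assms) linarith
  then show ?case
    unfolding cf_den.simps(3)[of \<theta> "Suc (Suc k)"] using ge2 cf_den_pos[OF assms, of k] by linarith
qed simp

text \<open>Prefixing the partial quotients acts on \<open>y\<close> as the Moebius map whose matrix
  holds consecutive numerators and denominators. At \<open>k = 0\<close> the sign of
  \<open>y\<close> is left free, because the zeroth partial quotient may be negative or 0.\<close>

lemma cf_eval_partial_quotients:
  assumes "\<theta> \<notin> \<rat>" and "k = 0 \<or> y > 0"
  shows "cf_eval (map (partial_quotient \<theta>) [0..<k]) y =
    (of_int (cf_num \<theta> (Suc k)) * y + of_int (cf_num \<theta> k)) / (of_int (cf_den \<theta> (Suc k)) * y + of_int (cf_den \<theta> k))"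
  using assms(2)
proof (induction k arbitrary: y)
  case (Suc k)
  then have y: "y > 0" by simp
  define y' where "y' = of_int (partial_quotient \<theta> k) + 1 / y"
  have "k = 0 \<or> y' > 0"
  proof (cases k)
    case (Suc l)
    then show ?thesis using partial_quotient_pos[OF assms(1), of l] y
      by (simp add: y'_def add_pos_pos)
  qed simp
  from Suc.IH[OF this]
  have "cf_eval (map (partial_quotient \<theta>) [0..<Suc k]) y =
    (of_int (cf_num \<theta> (Suc k)) * y' + of_int (cf_num \<theta> k)) / (of_int (cf_den \<theta> (Suc k)) * y' + of_int (cf_den \<theta> k))"
    by (simp add: cf_eval_snoc y'_def)
  also have "\<dots> = ((of_int (cf_num \<theta> (Suc k)) * y' + of_int (cf_num \<theta> k)) * y) / ((of_int (cf_den \<theta> (Suc k)) * y' + of_int (cf_den \<theta> k)) * y)"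
    using y by simp
  also have "(of_int (cf_num \<theta> (Suc k)) * y' + of_int (cf_num \<theta> k)) * y =
      of_int (cf_num \<theta> (Suc (Suc k))) * y + of_int (cf_num \<theta> (Suc k))"
    using y by (simp add: y'_def algebra_simps)
  also have "(of_int (cf_den \<theta> (Suc k)) * y' + of_int (cf_den \<theta> k)) * y =
      of_int (cf_den \<theta> (Suc (Suc k))) * y + of_int (cf_den \<theta> (Suc k))"
    using y by (simp add: y'_def algebra_simps)
  finally show ?case .
qed simp

lemma cf_eval_complete_quotient:
  assumes "\<theta> \<notin> \<rat>"
  shows "cf_eval (map (partial_quotient \<theta>) [0..<k]) (complete_quotient \<theta> k) = \<theta>"
proof (induction k)
  case (Suc k)
  then show ?case
    using complete_quotient_step(1)[OF assms, of k] by (simp add: cf_eval_snoc del: complete_quotient.simps)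
qed simp

lemma cf_coprime: "coprime (cf_num \<theta> k) (cf_den \<theta> k)"
proof (rule coprimeI)
  fix c assume c: "c dvd cf_num \<theta> k" "c dvd cf_den \<theta> k"
  have "c dvd cf_num \<theta> (Suc k) * cf_den \<theta> k - cf_num \<theta> k * cf_den \<theta> (Suc k)"
    using c by (intro dvd_diff dvd_mult dvd_mult2)
  then have "c dvd (- 1) ^ k" by (simp only: cf_det)
  then show "is_unit c" by (meson dvd_trans dvd_minus_iff dvd_refl is_unit_power_iff one_dvd)
qed

lemma convergent_denom_eq:
  assumes "\<theta> \<notin> \<rat>"
  shows "convergent_denom \<theta> k = cf_den \<theta> (Suc (Suc k))"
proof -
  define p where "p = cf_num \<theta> (Suc (Suc k))"
  define q where "q = cf_den \<theta> (Suc (Suc k))"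
  have q: "q > 0" using cf_den_pos[OF assms, of k] by (simp add: q_def)
  have "k = 0 \<or> of_int (partial_quotient \<theta> k) > (0 :: real)"
    using partial_quotient_pos[OF assms, of "k - 1"] by (cases k) auto
  from cf_eval_partial_quotients[OF assms this]
  have "real_of_rat (cf_convergent \<theta> k) = of_int p / of_int q"
    by (simp add: cf_convergent_def of_rat_cont_frac p_def q_def mult.commute)
  also have "\<dots> = of_rat (Fract p q)" using q by (simp add: of_rat_rat)
  finally have "cf_convergent \<theta> k = Fract p q" by simp
  moreover have "coprime p q" unfolding p_def q_def by (rule cf_coprime)
  ultimately show ?thesis
    using q by (simp add: convergent_denom_def quotient_of_Fract normalize_stable q_def)
qed

text \<open>Inserting the next complete quotient \<open>\<xi>\<close> into the Moebius formula makes
  the error exactly \<open>1 / (q * (q * \<xi> + q'))\<close>, and \<open>\<xi> > 1\<close>.\<close>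

lemma convergent_denom_approx:
  assumes "\<theta> \<notin> \<rat>"
  obtains p where "coprime p (convergent_denom \<theta> k)"
    "\<bar>\<theta> - of_int p / of_int (convergent_denom \<theta> k)\<bar> \<le> 1 / (of_int (convergent_denom \<theta> k))\<^sup>2"
proof -
  define p where "p = cf_num \<theta> (Suc (Suc k))"
  define q where "q = cf_den \<theta> (Suc (Suc k))"
  define p' where "p' = cf_num \<theta> (Suc k)"
  define q' where "q' = cf_den \<theta> (Suc k)"
  define \<xi> where "\<xi> = complete_quotient \<theta> (Suc k)"
  have q: "q \<ge> 1" "q' \<ge> 0" using cf_den_pos[OF assms, of k] by (auto simp: q_def q'_def)
  have \<xi>: "\<xi> > 1" unfolding \<xi>_def by (rule complete_quotient_step(2)[OF assms])
  have \<theta>: "\<theta> = (of_int p * \<xi> + of_int p') / (of_int q * \<xi> + of_int q')"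
    unfolding p_def q_def p'_def q'_def \<xi>_def
    by (rule trans[OF cf_eval_complete_quotient[OF assms, symmetric] cf_eval_partial_quotients[OF assms]])
      (use \<xi> in \<open>unfold \<xi>_def, linarith\<close>)
  have pos: "of_int q * \<xi> + of_int q' \<ge> (of_int q :: real)"
  proof -
    have "real_of_int q * 1 \<le> real_of_int q * \<xi>"
      using q \<xi> by (intro mult_left_mono) auto
    moreover have "real_of_int q' \<ge> 0" using q by simp
    ultimately show ?thesis by linarith
  qed
  have q0: "(of_int q :: real) > 0" using q by simp
  have det: "\<bar>p * q' - p' * q\<bar> = 1"
    using cf_det[of \<theta> "Suc k"] unfolding p_def q_def p'_def q'_def by (simp add: power_abs)
  have diff: "\<theta> - of_int p / of_int q = of_int (p' * q - p * q') / (of_int q * (of_int q * \<xi> + of_int q'))"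
    unfolding \<theta> using pos q0 by (simp add: field_simps)
  have "\<bar>\<theta> - of_int p / of_int q\<bar> = 1 / (of_int q * (of_int q * \<xi> + of_int q'))"
  proof -
    have "\<bar>p' * q - p * q'\<bar> = 1" using det by linarith
    then have "\<bar>real_of_int (p' * q - p * q')\<bar> = 1" by (simp only: of_int_abs[symmetric] of_int_1)
    moreover have "\<bar>of_int q * (of_int q * \<xi> + of_int q')\<bar> = of_int q * (of_int q * \<xi> + of_int q')"
      using pos q0 by (intro abs_of_pos mult_pos_pos) linarith+
    ultimately show ?thesis by (simp only: diff abs_divide)
  qed
  also have "\<dots> \<le> 1 / (of_int q)\<^sup>2"
    using pos q0 by (intro divide_left_mono) (auto simp: power2_eq_square)
  finally show thesis
    using that[of p] cf_coprime[of \<theta> "Suc (Suc k)"] by (simp add: convergent_denom_eq[OF assms] p_def q_def)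
qed

lemma convergent_denom_ge:
  assumes "\<theta> \<notin> \<rat>"
  shows "convergent_denom \<theta> k \<ge> int k" "convergent_denom \<theta> k \<ge> 1"
  using cf_den_ge[OF assms, of k] cf_den_pos[OF assms, of k]
  unfolding convergent_denom_eq[OF assms] by blast+

section \<open>Transport exponents\<close>

text \<open>In a representation of least degree one of the two extreme coefficients is nonzero. As
  \<open>g\<close> is real, conjugation gives another representation with the two exchanged, so the
  top one may be taken nonzero.\<close>

lemma trig_poly_leading_coeff:
  assumes "trig_poly g" "\<not> g constant_on UNIV"
  obtains m :: nat and c :: "int \<Rightarrow> complex" where "m > 0" "c (int m) \<noteq> 0"
    "\<And>x. complex_of_real (g x) = (\<Sum>k\<in>{- int m..int m}. c k * cis (2 * pi * of_int k * x))"
proof -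
  define rep where "rep m c \<longleftrightarrow>
    (\<forall>x. complex_of_real (g x) = (\<Sum>k\<in>{- int m..int m}. c k * cis (2 * pi * of_int k * x)))" for m :: nat and c
  define m where "m = (LEAST m. \<exists>c. rep m c)"
  have ex: "\<exists>m c. rep m c" using assms(1) by (simp add: trig_poly_def rep_def)
  then have "\<exists>c. rep m c" unfolding m_def by (rule LeastI_ex)
  then obtain c where c: "rep m c" by blast
  have least: "\<not> rep l c" if "l < m" for l c
    using not_less_Least[OF that[unfolded m_def]] by simp
  have m0: "m > 0"
  proof (rule ccontr)
    assume "\<not> m > 0"
    then have "complex_of_real (g x) = c 0" for x using c by (simp add: rep_def)
    then have "g x = Re (c 0)" for x by (metis Re_complex_of_real)
    then show False using assms(2) by (simp add: constant_on_def)
  qed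
  have "c (int m) \<noteq> 0 \<or> c (- int m) \<noteq> 0"
  proof (rule ccontr)
    assume neg: "\<not> ?thesis"
    obtain l where l: "m = Suc l" using m0 by (cases m) auto
    have "{- int m..int m} = insert (int m) (insert (- int m) {- int l..int l})" using l by auto
    then have "rep l c" using c neg l unfolding rep_def by simp
    then show False using least[of l c] l by simp
  qed
  then show thesis
  proof
    assume "c (int m) \<noteq> 0"
    then show thesis using that m0 c by (simp add: rep_def)
  next
    assume nz: "c (- int m) \<noteq> 0"
    define c' where "c' k = cnj (c (- k))" for k
    have "complex_of_real (g x) = (\<Sum>k\<in>{- int m..int m}. c' k * cis (2 * pi * of_int k * x))" for x
    proof -
      have "complex_of_real (g x) = cnj (\<Sum>k\<in>{- int m..int m}. c k * cis (2 * pi * of_int k * x))"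
        using c unfolding rep_def by (metis complex_cnj_complex_of_real)
      also have "\<dots> = (\<Sum>k\<in>{- int m..int m}. cnj (c k) * cis (- (2 * pi * of_int k * x)))"
        by (simp add: cis_cnj)
      also have "\<dots> = (\<Sum>k\<in>{- int m..int m}. c' k * cis (2 * pi * of_int k * x))"
        by (rule sum.reindex_bij_witness[of _ uminus uminus]) (auto simp: c'_def)
      finally show ?thesis .
    qed
    moreover have "c' (int m) \<noteq> 0" using nz by (simp add: c'_def)
    ultimately show thesis using that m0 by blast
  qed
qed

lemma elog_ratio_le:
  assumes "0 \<le> x" "x \<le> exp (- C * ln T)" "ln T > 0"
  shows "elog x / ereal (ln T) \<le> ereal (- C)"
proof (cases "x = 0")
  case True
  then show ?thesis using assms(3) by (simp add: elog_def)
next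
  case False
  then have "ln x \<le> ln (exp (- C * ln T))" using assms by (subst ln_le_cancel_iff) auto
  then show ?thesis using False assms(3) by (simp add: elog_def field_simps)
qed

section \<open>Outside probabilities of the quasi-periodic operator\<close>

locale quasi_periodic =
  fixes g :: "real \<Rightarrow> real" and m :: nat and c :: "int \<Rightarrow> complex" and Bg lam \<theta> \<omega> :: real
  assumes g: "complex_of_real (g x) = (\<Sum>k\<in>{- int m..int m}. c k * cis (2 * pi * of_int k * x))"
    and g_bound: "\<bar>g x\<bar> \<le> Bg" and m: "m > 0"
    and lam: "exp 1 * 2 ^ (32 * m) * 3 ^ m \<le> lam * cmod (c (int m))" and lam0: "lam \<ge> 0"
    and irrational: "\<theta> \<notin> \<rat>"
begin

sublocale bounded_potential "\<lambda>n. lam * g (of_int n * \<theta> + \<omega>)" "lam * Bg"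
  by unfold_locales (simp add: abs_mult lam0 mult_left_mono g_bound)

text \<open>The phase is shifted by \<open>2 * \<phi>\<close> because a barrier is counted from site
  2. The angle \<open>\<phi>\<close> is kept general so that the reflected potential, a rotation by
  \<open>- \<theta>\<close>, is covered too.\<close>

lemma barrier_rotation:
  assumes cop: "coprime p (int q)" and \<phi>: "\<bar>\<phi> - of_int p / of_nat q\<bar> \<le> 1 / (of_nat q)\<^sup>2"
    and n: "n > 0" and q: "16 * m * n \<le> q" "q < 16 * m * Suc n"
  shows "barrier (\<lambda>k. lam * g (of_int k * \<phi> + \<sigma>)) (exp (real n)) (q - 2)"
  unfolding barrier_def
proof
  fix z
  obtain j where j: "j \<le> 2 * m * n"
    "exp (real n) \<le> cmod (continuant (\<lambda>k. z - of_real (lam * g (of_nat (j + k) * \<phi> + (\<sigma> + 2 * \<phi>)))) (Suc n))"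
    using large_determinant[OF g m n lam lam0 cop \<phi> q, of z "\<sigma> + 2 * \<phi>"] by (elim exE conjE)
  have "n \<le> m * n" using m by simp
  moreover have "2 * m * n = 2 * (m * n)" "16 * m * n = 16 * (m * n)" by simp_all
  ultimately have "j + n \<le> q - 2" using j(1) q(1) n by linarith
  moreover have eq: "of_nat (j + k) * \<phi> + (\<sigma> + 2 * \<phi>) = of_int (2 + int j + int k) * \<phi> + \<sigma>" for k
    by (simp add: algebra_simps)
  ultimately show "\<exists>j n'. j + n' \<le> q - 2 \<and> exp (real n) \<le>
      cmod (continuant (\<lambda>i. z - complex_of_real (lam * g (of_int (2 + int j + int i) * \<phi> + \<sigma>))) (Suc n'))"
    using j(2) unfolding eq by (intro exI[of _ j] exI[of _ n] conjI)
qed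

definition Q :: "nat \<Rightarrow> nat" where
  "Q k = nat (convergent_denom \<theta> k)"

lemma int_Q: "int (Q k) = convergent_denom \<theta> k"
  using convergent_denom_ge(2)[OF irrational, of k] by (simp add: Q_def)

lemma real_Q: "real (Q k) = of_int (convergent_denom \<theta> k)"
  unfolding int_Q[symmetric] by simp

lemma Q_ge: "k \<le> Q k"
  using convergent_denom_ge(1)[OF irrational, of k] unfolding int_Q[symmetric] by simp

lemma outside_prob_convergent:
  assumes T: "T \<ge> 1" and Q: "16 * m \<le> Q k" "real (Q k) \<le> R"
  shows "outside_prob H (ereal R) T \<le>
    32 * (lam * Bg + 6)\<^sup>2 * exp 1 * T ^ 3 * exp (- real (Q k) / (16 * m))"
proof -
  define q where "q = Q k"
  define n where "n = q div (16 * m)"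
  have n: "n > 0" using Q(1) m by (simp add: n_def q_def div_greater_zero_iff)
  have q: "16 * m * n \<le> q" "q < 16 * m * Suc n"
    using m dividend_less_div_times[of "16 * m" q] div_times_less_eq_dividend[of q "16 * m"]
    by (simp_all add: n_def mult_ac)
  obtain p where p: "coprime p (int q)" "\<bar>\<theta> - of_int p / of_nat q\<bar> \<le> 1 / (of_nat q)\<^sup>2"
    using convergent_denom_approx[OF irrational, of k] unfolding int_Q[symmetric] of_int_of_nat_eq q_def
    by metis
  have p': "coprime (- p) (int q)" "\<bar>- \<theta> - of_int (- p) / of_nat q\<bar> \<le> 1 / (of_nat q)\<^sup>2"
    using p by (simp_all add: abs_minus_commute)
  have b1: "barrier (\<lambda>k. lam * g (of_int k * \<theta> + \<omega>)) (exp (real n)) (q - 2)"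
    by (rule barrier_rotation[OF p n q])
  \<comment> \<open>Reflection about site 1 is the rotation by \<open>- \<theta>\<close> with
    initial phase \<open>\<omega> + 2 * \<theta>\<close>; its rational approximation is
    \<open>- p / q\<close>.\<close>
  have "of_int k * - \<theta> + (\<omega> + 2 * \<theta>) = of_int (2 - k) * \<theta> + \<omega>" for k
    by (simp add: algebra_simps)
  then have b2: "barrier (\<lambda>k. lam * g (of_int (2 - k) * \<theta> + \<omega>)) (exp (real n)) (q - 2)"
    using barrier_rotation[OF p' n q, of "\<omega> + 2 * \<theta>"] by (simp only:)
  have "16 * 1 \<le> 16 * m * n" using m n by (simp add: Suc_le_eq)
  then have "16 \<le> q" "n \<le> q - 2"
  proof -
    show "16 \<le> q" using \<open>16 * 1 \<le> 16 * m * n\<close> q(1) by linarith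
    have "n \<le> m * n" "16 * m * n = 16 * (m * n)" using m by simp_all
    then show "n \<le> q - 2" using q(1) n by linarith
  qed
  then have "outside_prob H (ereal R) T \<le> 32 * (lam * Bg + 6)\<^sup>2 * T ^ 3 * exp (- real n)"
    using Q(2) by (intro outside_prob_barrier[OF T _ b1 b2]) (auto simp: q_def)
  also have "\<dots> \<le> 32 * (lam * Bg + 6)\<^sup>2 * T ^ 3 * (exp 1 * exp (- real q / (16 * m)))"
  proof (intro mult_left_mono)
    have "real q < real (16 * m * Suc n)" using q(2) by (simp only: of_nat_less_iff)
    then have "real q / (16 * m) \<le> real n + 1" using m by (simp add: field_simps)
    then show "exp (- real n) \<le> exp 1 * exp (- real q / (16 * m))" by (simp flip: exp_add)
  qed (use T in auto)
  finally show ?thesis by (simp add: q_def mult_ac)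
qed

lemma decay_at_convergents:
  assumes C: "C \<ge> 0"
  obtains D where "D > 0" "\<And>a T k. \<lbrakk>exp 1 \<le> T; 16 * m \<le> Q k; real (Q k) \<le> T powr a - 2; D * ln T \<le> Q k\<rbrakk>
    \<Longrightarrow> elog (outside_prob H (cutoff (ereal a) T) T) / ereal (ln T) \<le> ereal (- C)"
proof -
  define K where "K = max 1 (32 * (lam * Bg + 6)\<^sup>2 * exp 1)"
  have K: "K \<ge> 1" "32 * (lam * Bg + 6)\<^sup>2 * exp 1 \<le> K" by (auto simp: K_def)
  \<comment> \<open>Of the decay \<open>exp (- Q k / (16 * m))\<close>, the part \<open>C\<close> is
    the rate to be reached, 3 pays for \<open>T ^ 3\<close>, and \<open>ln K\<close> for the
    constant, as \<open>ln T \<ge> 1\<close>.\<close>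
  define D where "D = 16 * m * (C + 3 + ln K)"
  have D: "D > 0" using m C K(1) by (simp add: D_def add_nonneg_pos add_pos_nonneg)
  have "elog (outside_prob H (cutoff (ereal a) T) T) / ereal (ln T) \<le> ereal (- C)"
    if T: "exp 1 \<le> T" and Q: "16 * m \<le> Q k" "real (Q k) \<le> T powr a - 2" "D * ln T \<le> Q k" for a T k
  proof (rule elog_ratio_le)
    have T1: "T \<ge> 1" using T order.trans[OF _ T, of 1] by simp
    have lnT: "ln T \<ge> 1" using T T1 ln_ge_iff[of T 1] by simp
    show "ln T > 0" using lnT by simp
    show "0 \<le> outside_prob H (cutoff (ereal a) T) T" using T1 by (intro outside_prob_nonneg) simp
    have "outside_prob H (cutoff (ereal a) T) T \<le>
        32 * (lam * Bg + 6)\<^sup>2 * exp 1 * T ^ 3 * exp (- real (Q k) / (16 * m))"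
      unfolding cutoff_def using outside_prob_convergent[OF T1 Q(1,2)] by simp
    also have "\<dots> \<le> K * T ^ 3 * exp (- real (Q k) / (16 * m))"
      using T1 by (intro mult_right_mono K) auto
    also have "\<dots> = exp (ln K + 3 * ln T - real (Q k) / (16 * m))"
      using K(1) T1 exp_of_nat_mult[of 3 "ln T"] by (simp add: exp_add exp_diff exp_minus field_simps)
    also have "\<dots> \<le> exp (- C * ln T)"
    proof -
      have "(C + 3 + ln K) * ln T \<le> real (Q k) / (16 * m)"
        using Q(3) m by (simp add: D_def field_simps)
      moreover have "ln K \<le> ln K * ln T" using mult_left_mono[OF lnT, of "ln K"] K(1) by simp
      ultimately show ?thesis by (simp add: algebra_simps)
    qed
    finally show "outside_prob H (cutoff (ereal a) T) T \<le> exp (- C * ln T)" .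
  qed
  then show thesis using that D by blast
qed

text \<open>Once \<open>T \<ge> 1 / d\<close>, the lower bound \<open>d / T\<close> is at least
  \<open>1 / T\<^sup>2\<close>. This puts the exponent 0 into the sets whose suprema are the
  transport exponents.\<close>

lemma ratio_lower_bound_zero:
  "eventually (\<lambda>T. ereal (- 2) \<le> elog (outside_prob H (cutoff 0 T) T) / ereal (ln T)) at_top"
proof -
  obtain d where d: "d > 0" "\<And>T. T \<ge> 1 \<Longrightarrow> d / T \<le> outside_prob H (ereal (- 1)) T"
    using outside_prob_all_lower_bound by blast
  show ?thesis
    using eventually_ge_at_top[of "exp 1"] eventually_ge_at_top[of "1 / d"]
  proof eventually_elim
    case (elim T)
    have T1: "T \<ge> 1" using elim(1) order.trans[of 1 "exp 1" T] by simp
    have lnT: "ln T \<ge> 1" using elim(1) T1 ln_ge_iff[of T 1] by simp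
    define x where "x = outside_prob H (cutoff 0 T) T"
    have "cutoff 0 T = ereal (- 1)" using T1 by (simp add: cutoff_def)
    then have x: "d / T \<le> x" using d(2)[OF T1] by (simp add: x_def)
    have "1 / T / T \<le> d / T" using elim(2) d(1) T1 by (intro divide_right_mono) (auto simp: field_simps)
    then have x': "1 / T / T \<le> x" using x by linarith
    have "ln (1 / T / T) \<le> ln x" using x' T1 by (intro ln_mono) (auto simp: divide_pos_pos intro: less_le_trans[OF _ x'])
    then have "- 2 * ln T \<le> ln x" using T1 by (simp add: ln_div ln_mult)
    moreover have "x > 0" using x' T1 by (intro less_le_trans[OF _ x']) (auto simp: divide_pos_pos)
    ultimately show ?case using lnT unfolding x_def[symmetric] by (simp add: elog_def field_simps)
  qed
qed

text \<open>No site lies beyond an infinite radius, so the sum is empty and \<open>elog\<close>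
  returns minus infinity.\<close>

lemma ratio_infinity:
  assumes "T > 1"
  shows "elog (outside_prob H (cutoff \<infinity> T) T) / ereal (ln T) = - \<infinity>"
  using assms by (simp add: cutoff_def outside_prob_def elog_def)

text \<open>Choosing \<open>T\<close> with \<open>T powr a = Q k + 2\<close> makes the cutoff equal
  to \<open>Q k\<close>, while \<open>ln T\<close> is only logarithmic in \<open>Q k\<close>. Such
  \<open>T\<close> are arbitrarily large because the denominators are unbounded.\<close>

lemma ratio_frequently:
  assumes a: "a > 0" and C: "C \<ge> 0"
  shows "frequently (\<lambda>T. elog (outside_prob H (cutoff (ereal a) T) T) / ereal (ln T) \<le> ereal (- C)) at_top"
proof -
  obtain D where D: "D > 0" "\<And>a T k. \<lbrakk>exp 1 \<le> T; 16 * m \<le> Q k; real (Q k) \<le> T powr a - 2; D * ln T \<le> Q k\<rbrakk>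
    \<Longrightarrow> elog (outside_prob H (cutoff (ereal a) T) T) / ereal (ln T) \<le> ereal (- C)"
    using decay_at_convergents[OF C] by blast
  show ?thesis unfolding frequently_def
  proof
    assume "eventually (\<lambda>T. \<not> elog (outside_prob H (cutoff (ereal a) T) T) / ereal (ln T) \<le> ereal (- C)) at_top"
    then obtain T0 where T0: "\<And>T. T \<ge> T0 \<Longrightarrow> \<not> elog (outside_prob H (cutoff (ereal a) T) T) / ereal (ln T) \<le> ereal (- C)"
      unfolding eventually_at_top_linorder by blast
    have "((\<lambda>y::real. ln y / y) \<longlongrightarrow> 0) at_top" by (rule ln_x_over_x_tendsto_0)
    then have "eventually (\<lambda>y::real. ln y / y < a / (2 * D)) at_top"
      using a D(1) by (intro order_tendstoD) auto
    then obtain Y where Y: "\<And>y. y \<ge> Y \<Longrightarrow> ln y / y < a / (2 * D)"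
      unfolding eventually_at_top_linorder by blast
    define S where "S = max (max T0 (exp 1)) 1"
    obtain k where k: "max (max Y (S powr a)) (max 4 (16 * m)) \<le> real k" using real_arch_simple by blast
    define y where "y = real (Q k) + 2"
    have y: "y \<ge> Y" "y \<ge> S powr a" "y \<ge> 4" "16 * m \<le> Q k"
      using k Q_ge[of k] unfolding y_def by auto
    define T where "T = y powr (1 / a)"
    have Ta: "T powr a = y" using a y(3) by (simp add: T_def powr_powr)
    have "S = (S powr a) powr (1 / a)" using a by (simp add: powr_powr S_def)
    also have "\<dots> \<le> T" unfolding T_def using y a by (intro powr_mono2) auto
    finally have TS: "T \<ge> S" .
    have "ln y < a / (2 * D) * y" using Y[OF y(1)] y(3) by (simp add: field_simps)
    \<comment> \<open>The threshold \<open>a / (2 * D)\<close> leaves half of \<open>y\<close>, and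
      \<open>y / 2 \<le> Q k\<close> because \<open>y = Q k + 2\<close> is at least 4.\<close>
    then have "D * ln T \<le> y / 2" using a D(1) by (simp add: T_def ln_powr field_simps)
    also have "\<dots> \<le> Q k" using y(3) by (simp add: y_def)
    finally have "elog (outside_prob H (cutoff (ereal a) T) T) / ereal (ln T) \<le> ereal (- C)"
      using TS y(4) Ta by (intro D(2)[of T k a]) (auto simp: S_def y_def)
    then show False using T0[of T] TS by (simp add: S_def)
  qed
qed

text \<open>For each large \<open>T\<close> take the last \<open>k\<close> with
  \<open>Q k \<le> T powr a - 2\<close>. The next denominator exceeds \<open>T powr (a / 2)\<close>,
  so \<open>ln T\<close> is at most \<open>2 / a\<close> times \<open>ln (Q (Suc k))\<close>, which
  is small compared with \<open>Q k\<close> by hypothesis.\<close>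

lemma ratio_eventually:
  assumes a: "a > 0" and C: "C \<ge> 0" and lim: "(\<lambda>k. ln (real (Q (Suc k))) / real (Q k)) \<longlonglongrightarrow> 0"
  shows "eventually (\<lambda>T. elog (outside_prob H (cutoff (ereal a) T) T) / ereal (ln T) \<le> ereal (- C)) at_top"
proof -
  obtain D where D: "D > 0" "\<And>a T k. \<lbrakk>exp 1 \<le> T; 16 * m \<le> Q k; real (Q k) \<le> T powr a - 2; D * ln T \<le> Q k\<rbrakk>
    \<Longrightarrow> elog (outside_prob H (cutoff (ereal a) T) T) / ereal (ln T) \<le> ereal (- C)"
    using decay_at_convergents[OF C] by blast
  have "eventually (\<lambda>k. ln (real (Q (Suc k))) / real (Q k) < a / (2 * D)) sequentially"
    using a D(1) by (intro order_tendstoD[OF lim]) auto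
  then obtain k1 where k1: "\<And>k. k \<ge> k1 \<Longrightarrow> ln (real (Q (Suc k))) / real (Q k) < a / (2 * D)"
    unfolding eventually_sequentially by blast
  define k0 where "k0 = max k1 (16 * m)"
  show ?thesis
    using eventually_ge_at_top[of "exp 1"] eventually_ge_at_top[of "2 powr (2 / a)"]
      eventually_ge_at_top[of "(real (Q k0) + 2) powr (1 / a)"]
  proof eventually_elim
    case (elim T)
    define w where "w = T powr (a / 2)"
    have T0: "T > 0" using elim(1) less_le_trans[OF exp_gt_zero] by blast
    have ww: "T powr a = w * w" by (simp add: w_def powr_add[symmetric])
    have "2 = (2 powr (2 / a)) powr (a / 2)" using a by (simp add: powr_powr)
    also have "\<dots> \<le> w" unfolding w_def using elim(2) a by (intro powr_mono2) auto
    finally have w2: "2 \<le> w" .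
    have "real (Q k0) + 2 = ((real (Q k0) + 2) powr (1 / a)) powr a" using a by (simp add: powr_powr)
    also have "\<dots> \<le> T powr a" using elim(3) a by (intro powr_mono2) auto
    finally have k0: "real (Q k0) \<le> T powr a - 2" by simp
    define A where "A = {k. real (Q k) \<le> T powr a - 2}"
    have "A \<subseteq> {..nat \<lceil>T powr a\<rceil>}"
    proof
      fix k assume "k \<in> A"
      then have "real k \<le> T powr a" using Q_ge[of k] by (simp add: A_def)
      then show "k \<in> {..nat \<lceil>T powr a\<rceil>}" by (simp add: le_nat_iff ceiling_le_iff) linarith
    qed
    then have fin: "finite A" using finite_subset by blast
    define k where "k = Max A"
    have kA: "k \<in> A" unfolding k_def using fin k0 by (intro Max_in) (auto simp: A_def)
    have kk0: "k0 \<le> k" unfolding k_def using fin k0 by (intro Max_ge) (auto simp: A_def)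
    have "Suc k \<notin> A" using Max_ge[OF fin, of "Suc k"] unfolding k_def by auto
    then have next_k: "T powr a - 2 < real (Q (Suc k))" by (simp add: A_def)
    \<comment> \<open>Passing to the square root \<open>w\<close> of \<open>T powr a\<close> absorbs
      the shift by 2, which is possible as soon as \<open>w \<ge> 2\<close>.\<close>
    have "w \<le> T powr a - 2"
    proof -
      have "2 * w \<le> w * w" using w2 by (intro mult_right_mono) auto
      then show ?thesis using w2 unfolding ww by linarith
    qed
    then have "w \<le> real (Q (Suc k))" using next_k by linarith
    then have "ln w \<le> ln (real (Q (Suc k)))" using w2 by (intro ln_mono) auto
    moreover have "ln w = a / 2 * ln T" using T0 by (simp add: w_def ln_powr)
    moreover have Q0: "real (Q k) > 0" using kk0 Q_ge[of k] m by (simp add: k0_def)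
    moreover have "ln (real (Q (Suc k))) < a / (2 * D) * real (Q k)"
      using k1[of k] kk0 Q0 by (simp add: k0_def field_simps)
    ultimately have "a / 2 * ln T \<le> a / (2 * D) * real (Q k)" by linarith
    then have "D * ln T \<le> Q k" using a D(1) by (simp add: field_simps)
    then show ?case
      using elim(1) kk0 Q_ge[of k] kA by (intro D(2)[of T k a]) (auto simp: k0_def A_def)
  qed
qed

section \<open>Vanishing of the transport exponents\<close>

lemma alpha_u_minus_zero: "alpha_u_minus H = 0"
proof -
  have "S_minus H 0 \<le> 2"
    unfolding S_minus_def using Liminf_bounded[OF ratio_lower_bound_zero] by (simp add: ereal_uminus_le_reorder)
  then have z: "S_minus H 0 < \<infinity>" by (rule le_less_trans) simp
  have "\<alpha> \<le> 0" if \<alpha>: "0 \<le> \<alpha>" "S_minus H \<alpha> < \<infinity>" for \<alpha>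
  proof (rule ccontr)
    assume "\<not> \<alpha> \<le> 0"
    define L where "L = Liminf at_top (\<lambda>T. elog (outside_prob H (cutoff \<alpha> T) T) / ereal (ln T))"
    have "L \<noteq> - \<infinity>" using \<alpha>(2) by (auto simp: S_minus_def L_def)
    \<comment> \<open>A finite \<open>S_minus\<close> would keep the ratio above some fixed
      \<open>- C\<close> for all large \<open>T\<close>, against its dropping below
      \<open>- C\<close> at arbitrarily large \<open>T\<close>.\<close>
    then obtain C where C: "ereal (- C) < L" "C \<ge> 0"
    proof -
      assume *: "L \<noteq> - \<infinity>"
      obtain r where r: "ereal r < L" using * by (metis ereal_dense2 ereal_infty_less(2) MInfty_neq_PInfty(1) less_ereal.simps(6))
      have "ereal (- max 0 (- r)) \<le> ereal r" by simp
      then have "ereal (- max 0 (- r)) < L" using r by (rule le_less_trans)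
      then show thesis by (intro that[of "max 0 (- r)"]) auto
    qed
    have ev: "eventually (\<lambda>T. ereal (- C) < elog (outside_prob H (cutoff \<alpha> T) T) / ereal (ln T)) at_top"
      using less_LiminfD[of "ereal (- C)"] C(1) unfolding L_def by blast
    show False
    proof (cases \<alpha>)
      case (real a)
      then have "a > 0" using \<open>\<not> \<alpha> \<le> 0\<close> by simp
      from ratio_frequently[OF this C(2)] ev show False
        unfolding frequently_def real by (simp add: not_le)
    next
      case PInf
      have "eventually (\<lambda>T::real. False) at_top"
        using ev[unfolded PInf] eventually_gt_at_top[of 1] by eventually_elim (simp add: ratio_infinity)
      then show False by simp
    qed (use \<alpha> in simp)
  qed
  then show ?thesis unfolding alpha_u_minus_def using z by (intro antisym Sup_least Sup_upper) auto
qed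

lemma alpha_u_plus_zero:
  assumes lim: "(\<lambda>k. ln (real (Q (Suc k))) / real (Q k)) \<longlonglongrightarrow> 0"
  shows "alpha_u_plus H = 0"
proof -
  have "ereal (- 2) \<le> Limsup at_top (\<lambda>T. elog (outside_prob H (cutoff 0 T) T) / ereal (ln T))"
    by (rule order.trans[OF Liminf_bounded[OF ratio_lower_bound_zero] Liminf_le_Limsup]) simp
  then have "S_plus H 0 \<le> 2"
    unfolding S_plus_def by (simp add: ereal_uminus_le_reorder)
  then have z: "S_plus H 0 < \<infinity>" by (rule le_less_trans) simp
  have "\<alpha> \<le> 0" if \<alpha>: "0 \<le> \<alpha>" "S_plus H \<alpha> < \<infinity>" for \<alpha>
  proof (rule ccontr)
    assume "\<not> \<alpha> \<le> 0"
    define L where "L = Limsup at_top (\<lambda>T. elog (outside_prob H (cutoff \<alpha> T) T) / ereal (ln T))"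
    have le: "L \<le> ereal (- C)" if "C \<ge> 0" for C
      unfolding L_def
    proof (rule Limsup_bounded)
      show "eventually (\<lambda>T. elog (outside_prob H (cutoff \<alpha> T) T) / ereal (ln T) \<le> ereal (- C)) at_top"
      proof (cases \<alpha>)
        case (real a)
        then have "a > 0" using \<open>\<not> \<alpha> \<le> 0\<close> by simp
        from ratio_eventually[OF this that lim] show ?thesis unfolding real .
      next
        case PInf
        show ?thesis
          unfolding PInf using eventually_gt_at_top[of 1] by eventually_elim (simp add: ratio_infinity)
      qed (use \<alpha> in simp)
    qed
    have "L = - \<infinity>"
    proof (rule ereal_bot)
      fix r :: real
      have "L \<le> ereal (- max 0 (- r))" by (rule le) simp
      also have "\<dots> \<le> ereal r" by simp
      finally show "L \<le> ereal r" .
    qed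
    then show False using \<alpha>(2) by (simp add: S_plus_def L_def)
  qed
  then show ?thesis unfolding alpha_u_plus_def using z by (intro antisym Sup_least Sup_upper) auto
qed

end

theorem theorem6:
  fixes g :: "real \<Rightarrow> real"
  assumes "trig_poly g" and "\<not> g constant_on UNIV"
  shows "\<exists>lam0 :: real. \<forall>lam>lam0. \<forall>\<theta>. \<theta> \<notin> \<rat> \<longrightarrow> (\<forall>\<omega>\<in>{0..<1}.
           alpha_u_minus (qp_operator g lam \<theta> \<omega>) = 0 \<and>
           ((\<lambda>k. ln (real_of_int (convergent_denom \<theta> (Suc k))) / real_of_int (convergent_denom \<theta> k))
               \<longlonglongrightarrow> 0 \<longrightarrow>
             alpha_u_plus (qp_operator g lam \<theta> \<omega>) = 0))"
proof -
  obtain m :: nat and c :: "int \<Rightarrow> complex" where m: "m > 0" "c (int m) \<noteq> 0"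
    and g: "\<And>x. complex_of_real (g x) = (\<Sum>k\<in>{- int m..int m}. c k * cis (2 * pi * of_int k * x))"
    using trig_poly_leading_coeff[OF assms] by metis
  obtain Bg where Bg: "\<And>x. \<bar>g x\<bar> \<le> Bg" using trig_poly_bounded[OF assms(1)] by blast
  \<comment> \<open>The threshold from \<open>large_determinant\<close>; it depends only on the
    degree and the leading coefficient, hence serves all \<open>\<theta>\<close> and
    \<open>\<omega>\<close>.\<close>
  define lam0 where "lam0 = exp 1 * 2 ^ (32 * m) * 3 ^ m / cmod (c (int m))"
  have lam0: "lam0 \<ge> 0" by (simp add: lam0_def)
  show ?thesis
  proof (intro exI[of _ lam0] allI impI ballI)
    fix lam \<theta> \<omega> :: real assume lam: "lam0 < lam" and \<theta>: "\<theta> \<notin> \<rat>"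
    interpret quasi_periodic g m c Bg lam \<theta> \<omega>
    proof
      show "exp 1 * 2 ^ (32 * m) * 3 ^ m \<le> lam * cmod (c (int m))"
        using lam m(2) by (simp add: lam0_def divide_less_eq)
    qed (use g Bg m lam lam0 \<theta> in auto)
    show "alpha_u_minus (qp_operator g lam \<theta> \<omega>) = 0 \<and>
       ((\<lambda>k. ln (real_of_int (convergent_denom \<theta> (Suc k))) / real_of_int (convergent_denom \<theta> k))
           \<longlonglongrightarrow> 0 \<longrightarrow>
         alpha_u_plus (qp_operator g lam \<theta> \<omega>) = 0)"
      using alpha_u_minus_zero alpha_u_plus_zero by (simp add: qp_operator_def real_Q)
  qed
qed

end
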